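(* Let $q$ be an odd prime power, $n\ge1$, and let $G=\operatorname{Sp}(2n,q)$ be the isometry group of a nondegenerate alternating form $B$ on $V=\mathbb{F}_q^{2n}$. Let $C$ be a conjugacy class of $G$ with representative $g$, and let $o(C)$ be the number of orbits of $C_G(g)$ on $V/[g,V]$, where $[g,V]=(I-g)V$. Let $V_1=\ker(g-I)^{2n}$ (the generalized $1$-eigenspace, on which $B$ is nondegenerate and $g$ is unipotent), and let $a_i$ be the number of Jordan blocks of size $i$ of $g$ on $V_1$. Write $V_1$ as a $B$-orthogonal direct sum of $g$-invariant subspaces $W_i$ such that $g|_{W_i}$ has exactly $a_i$ Jordan blocks, all of size $i$. For even $i$, the form $(x,y)\mapsto B(x,(g-I)^{i-1}y)$ induces a nondegenerate symmetric bilinear form on the $a_i$-dimensional space $W_i/(g-I)W_i$; when $a_i=2$, say that the sign attached to $i$ is $+$ if this $2$-dimensional form is isotropic (hyperbolic) and $-$ otherwise. Then \[ o(C)=1+\#\{i\text{ odd}: a_i\neq0\}+\sum_{i\text{ even},\,a_i\ne0} f_i, \] where $f_i=q$ if $a_i>2$; $f_i=q$ if $a_i=2$ and the sign is $+$; $f_i=q-1$ if $a_i=2$ and the sign is $-$; and $f_i=(q-1)/2$ if $a_i=1$.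
   Context: $o(C)$ depends only on the class $C$. The signs are those of the standard parametrization of unipotent classes of symplectic groups in odd characteristic by signed partitions (a sign for each even part size); the isometry type of the form described does not depend on the chosen decomposition. *)

theory Defs
  imports
    "HOL-Analysis.Cartesian_Space"
    "HOL-Algebra.Group_Action"
    "Jordan_Normal_Form.Jordan_Normal_Form"
begin

type_synonym ('a, 'm) vector_map = "'a^'m \<Rightarrow> 'a^'m"
type_synonym ('a, 'm) form = "'a^'m \<Rightarrow> 'a^'m \<Rightarrow> 'a"

subsection \<open>Symplectic groups\<close>

definition bilinear_form :: "('a::field, 'm::finite) form \<Rightarrow> bool" where
  "bilinear_form B \<longleftrightarrow>
     (\<forall>x. Vector_Spaces.linear (*s) (*) (\<lambda>y. B x y)) \<and>
     (\<forall>y. Vector_Spaces.linear (*s) (*) (\<lambda>x. B x y))"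

definition nondegenerate_on :: "('a::field, 'm::finite) form \<Rightarrow> ('a^'m) set \<Rightarrow> bool" where
  "nondegenerate_on B U \<longleftrightarrow> (\<forall>x\<in>U. (\<forall>y\<in>U. B x y = 0) \<longrightarrow> x = 0)"

definition symplectic_form :: "('a::field, 'm::finite) form \<Rightarrow> bool" where
  "symplectic_form B \<longleftrightarrow> bilinear_form B \<and> (\<forall>x. B x x = 0) \<and> nondegenerate_on B UNIV"

definition isometry_group :: "('a::field, 'm::finite) form \<Rightarrow> ('a, 'm) vector_map monoid" where
  "isometry_group B =
     \<lparr>carrier = {h. Vector_Spaces.linear (*s) (*s) h \<and> bij h \<and> (\<forall>x y. B (h x) (h y) = B x y)},
      monoid.mult = (\<circ>), one = id\<rparr>"

definition conjugacy_class :: "('g, 'r) monoid_scheme \<Rightarrow> 'g \<Rightarrow> 'g set" where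
  "conjugacy_class G g = {h \<otimes>\<^bsub>G\<^esub> g \<otimes>\<^bsub>G\<^esub> inv\<^bsub>G\<^esub> h | h. h \<in> carrier G}"

definition centralizer :: "('g, 'r) monoid_scheme \<Rightarrow> 'g \<Rightarrow> 'g set" where
  "centralizer G g = {h \<in> carrier G. h \<otimes>\<^bsub>G\<^esub> g = g \<otimes>\<^bsub>G\<^esub> h}"

subsection \<open>Quotients and orbit counts\<close>

definition coset :: "'v::ab_group_add set \<Rightarrow> 'v \<Rightarrow> 'v set" where
  "coset U x = (\<lambda>u. x + u) ` U"

definition quotient_space :: "'v::ab_group_add set \<Rightarrow> 'v set \<Rightarrow> 'v set set" where
  "quotient_space W U = coset U ` W"

definition commutator_space :: "('a::field, 'm::finite) vector_map \<Rightarrow> ('a^'m) set" where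
  "commutator_space g = range (\<lambda>v. v - g v)"

definition num_orbits :: "('a::field, 'm::finite) form \<Rightarrow> ('a, 'm) vector_map \<Rightarrow> nat" where
  "num_orbits B g =
     card (orbits ((isometry_group B)\<lparr>carrier := centralizer (isometry_group B) g\<rparr>)
             (quotient_space UNIV (commutator_space g)) (\<lambda>h X. h ` X))"

text \<open>The value \<open>o(C)\<close>: the number of orbits attached to any representative of \<open>C\<close>.\<close>

definition class_orbits :: "('a::field, 'm::finite) form \<Rightarrow> ('a, 'm) vector_map set \<Rightarrow> nat" where
  "class_orbits B C = (THE k. \<forall>g\<in>C. num_orbits B g = k)"

subsection \<open>Jordan blocks on an invariant subspace\<close>

definition minus_id :: "('a::field, 'm::finite) vector_map \<Rightarrow> ('a, 'm) vector_map" where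
  "minus_id g = (\<lambda>v. g v - v)"

definition gen_one_space :: "('a::field, 'm::finite) vector_map \<Rightarrow> ('a^'m) set" where
  "gen_one_space g = {v. (minus_id g ^^ CARD('m)) v = 0}"

text \<open>Some ordered basis \<open>ws\<close> of \<open>W\<close> puts the restriction of \<open>g\<close> to \<open>W\<close> into the Jordan normal form
  with the given list of (block size, eigenvalue) pairs; the \<open>j\<close>-th column of the matrix
  consists of the coordinates of \<open>g (ws ! j)\<close>.\<close>

definition has_jordan_form_on ::
    "('a::field, 'm::finite) vector_map \<Rightarrow> ('a^'m) set \<Rightarrow> (nat \<times> 'a) list \<Rightarrow> bool" where
  "has_jordan_form_on g W n_as \<longleftrightarrow>
     0 \<notin> fst ` set n_as \<and>
     (\<exists>ws. length ws = sum_list (map fst n_as) \<and> distinct ws \<and>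
           vec.independent (set ws) \<and> vec.span (set ws) = W \<and>
           (\<forall>j < length ws.
              g (ws ! j) = (\<Sum>i < length ws. jordan_matrix n_as $$ (i, j) *s ws ! i)))"

definition num_jordan_blocks ::
    "('a::field, 'm::finite) vector_map \<Rightarrow> ('a^'m) set \<Rightarrow> nat \<Rightarrow> nat" where
  "num_jordan_blocks g W i =
     (THE k. \<exists>n_as. has_jordan_form_on g W n_as \<and> k = length (filter (\<lambda>p. fst p = i) n_as))"

subsection \<open>Orthogonal decompositions and signs\<close>

definition is_direct_sum :: "'i set \<Rightarrow> ('i \<Rightarrow> ('a::field^'m::finite) set) \<Rightarrow> ('a^'m) set \<Rightarrow> bool" where
  "is_direct_sum I W U \<longleftrightarrow>
     (\<forall>i\<in>I. vec.subspace (W i)) \<and> bij_betw (\<lambda>w. \<Sum>i\<in>I. w i) (\<Pi>\<^sub>E i\<in>I. W i) U"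

text \<open>The summands are indexed by all possible block sizes \<open>1, \<dots>, dim V\<close>;
  the summand is zero for sizes that do not occur.\<close>

definition orthogonal_block_decomposition ::
    "('a::field, 'm::finite) form \<Rightarrow> ('a, 'm) vector_map \<Rightarrow> (nat \<Rightarrow> ('a^'m) set) \<Rightarrow> bool" where
  "orthogonal_block_decomposition B g W \<longleftrightarrow>
     is_direct_sum {1..CARD('m)} W (gen_one_space g) \<and>
     (\<forall>i\<in>{1..CARD('m)}. \<forall>j\<in>{1..CARD('m)}. i \<noteq> j \<longrightarrow> (\<forall>x\<in>W i. \<forall>y\<in>W j. B x y = 0)) \<and>
     (\<forall>i\<in>{1..CARD('m)}. g ` W i \<subseteq> W i \<and>
        has_jordan_form_on g (W i) (replicate (num_jordan_blocks g (gen_one_space g) i) (i, 1)))"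

text \<open>The form on \<open>W / (g - I) W\<close> induced by \<open>(x, y) \<mapsto> B x ((g - I)^(i - 1) y)\<close>.\<close>

definition induced_form ::
    "('a::field, 'm::finite) form \<Rightarrow> ('a, 'm) vector_map \<Rightarrow> nat \<Rightarrow> ('a^'m) set \<Rightarrow> ('a^'m) set \<Rightarrow> 'a" where
  "induced_form B g i X Y = (THE c. \<forall>x\<in>X. \<forall>y\<in>Y. B x ((minus_id g ^^ (i - 1)) y) = c)"

text \<open>Bilinearity of the induced form is part of the first conjunct: it is induced by a
  bilinear form on representatives.\<close>

definition induces_nondegenerate_symmetric_form ::
    "('a::field, 'm::finite) form \<Rightarrow> ('a, 'm) vector_map \<Rightarrow> nat \<Rightarrow> ('a^'m) set \<Rightarrow> bool" where
  "induces_nondegenerate_symmetric_form B g i W \<longleftrightarrow>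
     (let U = minus_id g ` W; Q = quotient_space W U; b = induced_form B g i in
        (\<forall>x\<in>W. \<forall>y\<in>W. b (coset U x) (coset U y) = B x ((minus_id g ^^ (i - 1)) y)) \<and>
        (\<forall>X\<in>Q. \<forall>Y\<in>Q. b X Y = b Y X) \<and>
        (\<forall>X\<in>Q. (\<forall>Y\<in>Q. b X Y = 0) \<longrightarrow> X = U))"

text \<open>The sign is \<open>+\<close> if the induced form has a nonzero isotropic vector
  (the zero vector of the quotient is the coset \<open>(g - I) W\<close>).\<close>

definition plus_sign ::
    "('a::field, 'm::finite) form \<Rightarrow> ('a, 'm) vector_map \<Rightarrow> nat \<Rightarrow> ('a^'m) set \<Rightarrow> bool" where
  "plus_sign B g i W \<longleftrightarrow>
     (\<exists>X\<in>quotient_space W (minus_id g ` W). X \<noteq> minus_id g ` W \<and> induced_form B g i X X = 0)"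

text \<open>The summand for an even block size of multiplicity \<open>m > 0\<close>.\<close>

definition even_contribution :: "nat \<Rightarrow> nat \<Rightarrow> bool \<Rightarrow> nat" where
  "even_contribution q m pos =
     (if m > 2 then q
      else if m = 2 then (if pos then q else q - 1)
      else (q - 1) div 2)"

end

(*
  Put T = g - 1 and b_i(x, y) = B(x, T^(i-1) y). On ker T^i the form b_i is (-1)^i-symmetric.

  Existence of the decomposition: if T^i = 0 on a nondegenerate invariant subspace, the T-translates of a
  complement X of ker T^(i-1) span a nondegenerate subspace that is free over F[T]/(T^i), since b_i is
  nondegenerate on X; one continues in its orthogonal complement with i - 1. The block numbers are
  determined by the dimensions of the T^k V_1.

  Orbit count: V / TV is filtered by the images F_i of ker T^i, and b_i makes F_i / F_(i-1) isometric
  to W_i / T W_i. The centralizer preserves the F_i and the values b_i(x, x), and these are the only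
  invariants of a vector in F_i outside F_(i-1). For even i two such vectors x, y with b_i(x, x) = b_i(y, y)
  are related, modulo TV, by the involution that is -1 on the span of the T-translates of x - y (or x + y)
  and 1 on its orthogonal complement, with a detour through a third vector if x - y and x + y are both isotropic.
  For odd i the form b_i is alternating, and an analogue of a symplectic transvection along x - y, obtained
  as a Cayley transform, does the job. It remains to count the values of a quadratic form over a finite field.
*)

theory Submission
  imports Defs
begin

text \<open>The top power escapes this, because T^(i-1) y is fixed by g for y in ker T^i; arguments
  about radicals and intersections are therefore pushed into ker T, where only that power survives.
  For odd i the transvection v \<mapsto> v + c b_i(v, u) u does not commute with g. Its corrected
  version has an adjoint that belongs to g^(-1), and the symmetrized operator is skew but need not
  have square zero, hence the Cayley transform. The decomposition in the theorem is arbitrary, so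
  the orbit invariants are computed from components in it, while their invariance under the
  centralizer is read off from representatives in ker T^i, where no decomposition enters.\<close>

lemma linear_funpow:
  fixes f :: "('a::field, 'm::finite) vector_map"
  assumes "Vector_Spaces.linear (*s) (*s) f"
  shows "Vector_Spaces.linear (*s) (*s) (f ^^ k)"
proof (induction k)
  case 0
  show ?case using vec.linear_id by (simp add: id_def)
next
  case (Suc k)
  then show ?case using Vector_Spaces.linear_compose[OF Suc assms] by (simp add: o_def)
qed

section \<open>The operator T and its adjoint\<close>

locale symplectic_isometry =
  fixes B :: "('a::{field,finite}, 'm::finite) form" and g :: "('a, 'm) vector_map"
  assumes symplectic: "symplectic_form B"
    and isometry: "g \<in> carrier (isometry_group B)"
    and two_nonzero: "(2::'a) \<noteq> 0"
begin

abbreviation T :: "('a, 'm) vector_map" where "T \<equiv> minus_id g"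

lemma B_linear_right: "Vector_Spaces.linear (*s) (*) (B x)"
  and B_linear_left: "Vector_Spaces.linear (*s) (*) (\<lambda>x. B x y)"
  using symplectic unfolding symplectic_form_def bilinear_form_def by (auto simp: eta_contract_eq)

lemma B_add_right: "B x (y + z) = B x y + B x z"
  and B_scale_right: "B x (c *s y) = c * B x y"
  and B_zero_right [simp]: "B x 0 = 0"
  and B_minus_right: "B x (- y) = - B x y"
  and B_diff_right: "B x (y - z) = B x y - B x z"
  and B_sum_right: "B x (sum f S) = (\<Sum>s\<in>S. B x (f s))"
proof -
  interpret Vector_Spaces.linear "(*s)" "(*)" "B x" by (rule B_linear_right)
  show "B x (y + z) = B x y + B x z" "B x (c *s y) = c * B x y" "B x 0 = 0" "B x (- y) = - B x y"
    "B x (y - z) = B x y - B x z" "B x (sum f S) = (\<Sum>s\<in>S. B x (f s))"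
    by (simp_all add: add scale neg diff sum)
qed

lemma B_add_left: "B (y + z) x = B y x + B z x"
  and B_scale_left: "B (c *s y) x = c * B y x"
  and B_zero_left [simp]: "B 0 x = 0"
  and B_minus_left: "B (- y) x = - B y x"
  and B_diff_left: "B (y - z) x = B y x - B z x"
  and B_sum_left: "B (sum f S) x = (\<Sum>s\<in>S. B (f s) x)"
proof -
  interpret Vector_Spaces.linear "(*s)" "(*)" "\<lambda>y. B y x" by (rule B_linear_left)
  show "B (y + z) x = B y x + B z x" "B (c *s y) x = c * B y x" "B 0 x = 0" "B (- y) x = - B y x"
    "B (y - z) x = B y x - B z x" "B (sum f S) x = (\<Sum>s\<in>S. B (f s) x)"
    by (simp_all add: add scale neg diff sum)
qed

lemmas B_simps = B_add_right B_scale_right B_minus_right B_diff_right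
  B_add_left B_scale_left B_minus_left B_diff_left

lemma B_self [simp]: "B x x = 0"
  using symplectic unfolding symplectic_form_def by blast

lemma B_skew: "B x y = - B y x"
proof -
  have "B x y + B y x = B (x + y) (x + y)" by (simp add: B_simps del: B_self) simp
  then have "B x y + B y x = 0" by (simp only: B_self)
  then show ?thesis by (simp add: eq_neg_iff_add_eq_0)
qed

lemma nondegenerate: "nondegenerate_on B UNIV"
  using symplectic unfolding symplectic_form_def by blast

lemma g_linear: "Vector_Spaces.linear (*s) (*s) g"
  and g_bij: "bij g"
  and B_g: "B (g x) (g y) = B x y"
  using isometry unfolding isometry_group_def by auto

lemma T_linear: "Vector_Spaces.linear (*s) (*s) T"
  unfolding minus_id_def using vec.linear_compose_sub[OF g_linear vec.linear_id] by simp

lemmas T_power_linear = linear_funpow[OF T_linear]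

lemma g_eq: "g x = x + T x"
  by (simp add: minus_id_def)

lemma g_T: "g (T x) = T (g x)"
  by (simp add: minus_id_def vec.linear_diff[OF g_linear])

lemma funpow_commute: "(f ^^ k) (h x) = h ((f ^^ k) x)" if "\<And>x. f (h x) = h (f x)" for f h :: "'z \<Rightarrow> 'z"
  using that by (induction k) auto

text \<open>The adjoint of \<open>T\<close> is -g^(-1) T: since B(x, y) = B(g x, g y), the
  difference B(g x, y) - B(x, y) is -B(g x, T y). Moving \<open>T\<close> to the right costs a sign
  and leaves a \<open>g\<close> on the left.\<close>

lemma B_T_left: "B (T x) y = - B (g x) (T y)"
  by (simp add: minus_id_def B_simps B_g)

lemma B_T_power_left: "B ((T ^^ k) x) y = (-1) ^ k * B ((g ^^ k) x) ((T ^^ k) y)"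
proof (induction k arbitrary: x y)
  case (Suc k)
  have "B ((T ^^ Suc k) x) y = - B (g ((T ^^ k) x)) (T y)"
    by (simp add: B_T_left)
  also have "g ((T ^^ k) x) = (T ^^ k) (g x)"
    by (rule funpow_commute[symmetric]) (simp add: g_T)
  also have "- B ((T ^^ k) (g x)) (T y) = - ((-1) ^ k * B ((g ^^ k) (g x)) ((T ^^ k) (T y)))"
    by (simp only: Suc.IH)
  finally show ?case by (simp add: funpow_swap1)
qed auto

lemma T_power_add: "(T ^^ k) ((T ^^ l) x) = (T ^^ (k + l)) x"
  by (simp add: funpow_add)

lemma T_power_zero_mono: "(T ^^ l) x = 0" if "(T ^^ k) x = 0" "k \<le> l"
proof -
  have "(T ^^ l) x = (T ^^ (l - k)) ((T ^^ k) x)" unfolding T_power_add using that by simp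
  also have "\<dots> = 0" unfolding that(1) by (rule vec.linear_0[OF T_power_linear])
  finally show ?thesis .
qed

text \<open>On \<open>ker (T ^ (k + 1))\<close> the vector \<open>T ^ k y\<close> is fixed by \<open>g\<close>, so that it pairs to \<open>0\<close> with \<open>T V\<close>.\<close>

lemma B_T_left_top: "B (T x) ((T ^^ k) y) = 0" if "(T ^^ Suc k) y = 0"
  using that by (simp add: B_T_left)

lemma B_T_pos_left_top: "B ((T ^^ l) x) ((T ^^ k) y) = 0" if "(T ^^ Suc k) y = 0" "l > 0"
  using that B_T_left_top[of k y "(T ^^ (l - 1)) x"] by (cases l) auto

lemma B_g_power_left_top: "B ((g ^^ l) x) ((T ^^ k) y) = B x ((T ^^ k) y)" if "(T ^^ Suc k) y = 0"
proof (induction l)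
  case (Suc l)
  have "B ((g ^^ Suc l) x) ((T ^^ k) y) = B ((g ^^ l) x) ((T ^^ k) y) + B (T ((g ^^ l) x)) ((T ^^ k) y)"
    by (simp add: g_eq[of "(g ^^ l) x"] B_simps)
  then show ?case using Suc B_T_left_top[OF that] by simp
qed auto

text \<open>Moving T^k across gives k signs, the skewness of \<open>B\<close> one more, and g^k
  disappears because T^k y is fixed by \<open>g\<close>. Here \<open>x\<close> ranges over all of V,
  as the skew operators for odd i require.\<close>

lemma B_top_symmetric: "B y ((T ^^ k) x) = (-1) ^ Suc k * B x ((T ^^ k) y)" if "(T ^^ Suc k) y = 0"
proof -
  have "B y ((T ^^ k) x) = - B ((T ^^ k) x) y" by (rule B_skew)
  also have "\<dots> = - ((-1) ^ k * B ((g ^^ k) x) ((T ^^ k) y))" by (simp only: B_T_power_left)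
  also have "B ((g ^^ k) x) ((T ^^ k) y) = B x ((T ^^ k) y)" by (rule B_g_power_left_top[OF that])
  finally show ?thesis by simp
qed

section \<open>Invariant subspaces and orthogonal projection\<close>

definition invariant_subspace :: "('a^'m) set \<Rightarrow> bool" where
  "invariant_subspace U \<longleftrightarrow> vec.subspace U \<and> T ` U \<subseteq> U"

definition perp :: "('a^'m) set \<Rightarrow> ('a^'m) set" where
  "perp U = {x. \<forall>u\<in>U. B x u = 0}"

lemma perp_sym: "x \<in> perp U \<longleftrightarrow> (\<forall>u\<in>U. B u x = 0)"
proof -
  have "B x u = 0 \<longleftrightarrow> B u x = 0" for u
    by (subst B_skew) simp
  then show ?thesis by (simp add: perp_def)
qed

lemma subspace_perp: "vec.subspace (perp U)"
  unfolding perp_def vec.subspace_def by (auto simp: B_simps)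

lemma invariant_subspaceD:
  assumes "invariant_subspace U"
  shows "vec.subspace U" "\<And>x. x \<in> U \<Longrightarrow> T x \<in> U" "\<And>x. x \<in> U \<Longrightarrow> (T ^^ k) x \<in> U"
    "\<And>x. x \<in> U \<Longrightarrow> g x \<in> U" "g ` U = U"
proof -
  show s: "vec.subspace U" and T: "\<And>x. x \<in> U \<Longrightarrow> T x \<in> U"
    using assms unfolding invariant_subspace_def by auto
  show "\<And>x. x \<in> U \<Longrightarrow> (T ^^ k) x \<in> U"
    by (induction k) (auto intro: T)
  show g: "\<And>x. x \<in> U \<Longrightarrow> g x \<in> U"
    using vec.subspace_add[OF s] T by (simp add: g_eq)
  have "inj_on g U" using g_bij by (metis bij_is_inj inj_on_subset subset_UNIV)
  then show "g ` U = U" by (intro endo_inj_surj) (use g in auto)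
qed

text \<open>\<open>T\<close> is not skew, so the argument goes through \<open>g\<close>, which maps
  the finite space \<open>U\<close> onto itself: for u = g u' one gets B(T x, u) = B(x, u') - B(x,
  u), where both terms vanish.\<close>

lemma invariant_perp: assumes "invariant_subspace U" shows "invariant_subspace (perp U)"
  unfolding invariant_subspace_def
proof (intro conjI subspace_perp subsetI)
  fix y assume "y \<in> T ` perp U"
  then obtain x where x: "x \<in> perp U" "y = T x" by auto
  have "B y u = 0" if "u \<in> U" for u
  proof -
    have "u \<in> g ` U" using that invariant_subspaceD(5)[OF assms] by simp
    then obtain u' where u': "u' \<in> U" "u = g u'" by (elim imageE) blast
    have "B y u = B (g x) (g u') - B x u" by (simp add: x u' minus_id_def B_simps)
    then show ?thesis using x u' that by (simp add: perp_def B_g)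
  qed
  then show "y \<in> perp U" by (simp add: perp_def)
qed

lemma nondegenerate_on_iff: "nondegenerate_on B U \<longleftrightarrow> U \<inter> perp U \<subseteq> {0}"
  unfolding nondegenerate_on_def perp_def by auto

text \<open>The map \<open>v \<mapsto> \<Sum>b. B v b *s b\<close> over a basis of \<open>U\<close> sends \<open>V\<close> to \<open>U\<close>, has kernel \<open>perp U\<close>
  and is injective on the finite set \<open>U\<close>, hence maps \<open>U\<close> onto itself.\<close>

lemma orthogonal_projection:
  assumes U: "vec.subspace U" and nd: "nondegenerate_on B U"
  obtains u where "u \<in> U" "v - u \<in> perp U"
proof -
  obtain b where b: "b \<subseteq> U" "vec.independent b" "U \<subseteq> vec.span b"
    by (metis vec.basis_exists)
  have span: "vec.span b = U" using b U by (intro subset_antisym vec.span_minimal) auto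
  define p where "p v = (\<Sum>x\<in>b. B v x *s x)" for v
  have ker: "v \<in> perp U" if "p v = 0" for v
  proof -
    have 0: "\<forall>x\<in>b. B v x = 0"
      using b(2) that unfolding p_def vec.independent_explicit by blast
    have "B v u = 0" if "u \<in> U" for u
      using that[folded span]
      by (induction rule: vec.span_induct_alt) (use 0 in \<open>auto simp: B_simps\<close>)
    then show ?thesis by (simp add: perp_def)
  qed
  have diff: "p (x - y) = p x - p y" for x y
    by (simp add: p_def B_simps sum_subtractf vec.scale_left_diff_distrib)
  have pU: "p v \<in> U" for v
    unfolding p_def by (intro vec.subspace_sum U vec.subspace_scale) (use b in auto)
  have "inj_on p U"
  proof (rule inj_onI)
    fix x y assume xy: "x \<in> U" "y \<in> U" "p x = p y"
    then have "x - y \<in> perp U" by (intro ker) (simp add: diff)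
    moreover have "x - y \<in> U" using xy U by (simp add: vec.subspace_diff)
    ultimately show "x = y" using nd by (auto simp: nondegenerate_on_iff)
  qed
  then have "p ` U = U" by (intro endo_inj_surj) (use pU in auto)
  then have "p v \<in> p ` U" using pU by simp
  then obtain u where u: "u \<in> U" "p v = p u" by (elim imageE) blast
  then have "v - u \<in> perp U" by (intro ker) (simp add: diff)
  with u that show ?thesis by blast
qed

section \<open>Submodules generated under T\<close>

definition cyclic :: "nat \<Rightarrow> ('a^'m) set \<Rightarrow> ('a^'m) set" where
  "cyclic i X = {\<Sum>k<i. (T ^^ k) (f k) | f. \<forall>k<i. f k \<in> X}"

lemma cyclicE:
  assumes "v \<in> cyclic i X"
  obtains f where "v = (\<Sum>k<i. (T ^^ k) (f k))" "\<And>k. k < i \<Longrightarrow> f k \<in> X"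
  using assms unfolding cyclic_def by blast

lemma cyclicI: "v = (\<Sum>k<i. (T ^^ k) (f k)) \<Longrightarrow> (\<And>k. k < i \<Longrightarrow> f k \<in> X) \<Longrightarrow> v \<in> cyclic i X"
  unfolding cyclic_def by blast

lemma subspace_cyclic: assumes "vec.subspace X" shows "vec.subspace (cyclic i X)"
  unfolding vec.subspace_def
proof (intro conjI ballI allI)
  show "0 \<in> cyclic i X"
    by (rule cyclicI[where f = "\<lambda>_. 0"])
      (auto simp: vec.linear_0[OF T_power_linear] vec.subspace_0[OF assms])
next
  fix x y assume "x \<in> cyclic i X" "y \<in> cyclic i X"
  then obtain f f' where "x = (\<Sum>k<i. (T ^^ k) (f k))" "\<And>k. k < i \<Longrightarrow> f k \<in> X"
    "y = (\<Sum>k<i. (T ^^ k) (f' k))" "\<And>k. k < i \<Longrightarrow> f' k \<in> X"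
    by (elim cyclicE) blast
  then show "x + y \<in> cyclic i X"
    by (intro cyclicI[where f = "\<lambda>k. f k + f' k"])
      (auto simp: vec.linear_add[OF T_power_linear] sum.distrib vec.subspace_add[OF assms])
next
  fix c x assume "x \<in> cyclic i X"
  then obtain f where "x = (\<Sum>k<i. (T ^^ k) (f k))" "\<And>k. k < i \<Longrightarrow> f k \<in> X"
    by (elim cyclicE) blast
  then show "c *s x \<in> cyclic i X"
    by (intro cyclicI[where f = "\<lambda>k. c *s f k"])
      (auto simp: vec.linear_scale[OF T_power_linear] vec.scale_sum_right vec.subspace_scale[OF assms])
qed

lemma T_power_in_cyclic:
  assumes "vec.subspace X" "x \<in> X" "k < i"
  shows "(T ^^ k) x \<in> cyclic i X"
proof (rule cyclicI[where f = "\<lambda>l. if l = k then x else 0"])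
  have "(\<Sum>l<i. (T ^^ l) (if l = k then x else 0)) = (\<Sum>l<i. if l = k then (T ^^ k) x else 0)"
    by (intro sum.cong) (auto simp: vec.linear_0[OF T_power_linear])
  then show "(T ^^ k) x = (\<Sum>l<i. (T ^^ l) (if l = k then x else 0))"
    using assms by simp
qed (use assms vec.subspace_0 in auto)

lemma T_power_cyclic_zero:
  assumes "\<And>x. x \<in> X \<Longrightarrow> (T ^^ i) x = 0" "v \<in> cyclic i X"
  shows "(T ^^ i) v = 0"
proof -
  obtain f where f: "v = (\<Sum>k<i. (T ^^ k) (f k))" "\<And>k. k < i \<Longrightarrow> f k \<in> X"
    using assms(2) by (elim cyclicE) blast
  have "(T ^^ i) v = (\<Sum>k<i. (T ^^ k) ((T ^^ i) (f k)))"
    unfolding f(1) by (simp add: vec.linear_sum[OF T_power_linear] T_power_add add.commute)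
  also have "\<dots> = 0"
    using f(2) assms(1) by (intro sum.neutral) (simp add: vec.linear_0[OF T_power_linear])
  finally show ?thesis .
qed

lemma invariant_cyclic:
  assumes X: "vec.subspace X" "\<And>x. x \<in> X \<Longrightarrow> (T ^^ i) x = 0"
  shows "invariant_subspace (cyclic i X)"
  unfolding invariant_subspace_def
proof (intro conjI subspace_cyclic X subsetI)
  fix y assume "y \<in> T ` cyclic i X"
  then obtain v where v: "v \<in> cyclic i X" "y = T v" by auto
  then obtain f where f: "v = (\<Sum>k<i. (T ^^ k) (f k))" "\<And>k. k < i \<Longrightarrow> f k \<in> X"
    by (elim cyclicE) blast
  have y: "y = (\<Sum>k<i. (T ^^ Suc k) (f k))"
    unfolding v f(1) by (simp add: vec.linear_sum[OF T_linear])
  have "(T ^^ Suc k) (f k) \<in> cyclic i X" if "k < i" for k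
  proof (cases "Suc k = i")
    case True
    then show ?thesis
      using X f that vec.subspace_0[OF subspace_cyclic] by metis
  next
    case False
    then show ?thesis using that f X by (intro T_power_in_cyclic) auto
  qed
  then show "y \<in> cyclic i X"
    unfolding y by (intro vec.subspace_sum subspace_cyclic X) auto
qed

text \<open>Apply to \<open>T v = 0\<close> the power of \<open>T\<close> that kills all but the lowest nonzero term of \<open>v\<close>.\<close>

lemma kernel_cyclic:
  assumes X: "vec.subspace X" "\<And>x. x \<in> X \<Longrightarrow> (T ^^ i) x = 0"
    and inj: "\<And>x. x \<in> X \<Longrightarrow> (T ^^ (i - 1)) x = 0 \<Longrightarrow> x = 0"
    and v: "v \<in> cyclic i X" "T v = 0"
  obtains x where "x \<in> X" "v = (T ^^ (i - 1)) x"
proof (cases i)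
  case 0
  then show ?thesis
    using v that[of 0] vec.subspace_0[OF X(1)] by (auto simp: cyclic_def)
next
  case (Suc m)
  obtain f where f: "v = (\<Sum>k<i. (T ^^ k) (f k))" "\<And>k. k < i \<Longrightarrow> f k \<in> X"
    using v by (elim cyclicE) blast
  have "f k = 0" if "k < m" for k
    using that
  proof (induction k rule: less_induct)
    case (less k)
    have "0 = (T ^^ (m - k)) v"
      using v(2) less.prems T_power_zero_mono[of 1 v "m - k"] by simp
    also have "\<dots> = (\<Sum>l<i. (T ^^ (m - k + l)) (f l))"
      unfolding f(1) by (simp add: vec.linear_sum[OF T_power_linear] T_power_add)
    also have "\<dots> = (\<Sum>l<i. if l = k then (T ^^ m) (f k) else 0)"
    proof (intro sum.cong refl)
      fix l assume "l \<in> {..<i}"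
      then have l: "l < i" by simp
      consider "l < k" | "l = k" | "l > k" by linarith
      then show "(T ^^ (m - k + l)) (f l) = (if l = k then (T ^^ m) (f k) else 0)"
      proof cases
        case 1
        then show ?thesis using less.IH[of l] less.prems by (simp add: vec.linear_0[OF T_power_linear])
      next
        case 2
        then show ?thesis using less.prems by simp
      next
        case 3
        then show ?thesis
          using T_power_zero_mono[OF X(2)[OF f(2)[OF l]], of "m - k + l"] less.prems Suc by simp
      qed
    qed
    also have "\<dots> = (T ^^ m) (f k)" using less.prems Suc by simp
    finally show ?case using inj[of "f k"] f(2)[of k] less.prems Suc by simp
  qed
  then have "v = (T ^^ m) (f m)"
    unfolding f(1) Suc by (simp add: vec.linear_0[OF T_power_linear])
  then show ?thesis using that[of "f m"] f(2) Suc by simp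
qed

text \<open>Nilpotency pushes a nonzero vector of an invariant subspace to a nonzero vector of the
  same subspace in ker T. That a radical or an intersection vanishes is therefore tested on ker T
  only.\<close>

lemma lowest_power:
  assumes "(T ^^ i) w = 0" "w \<noteq> 0"
  obtains r where "T ((T ^^ r) w) = 0" "(T ^^ r) w \<noteq> 0" "r < i"
proof -
  define s where "s = (LEAST k. (T ^^ k) w = 0)"
  have s: "(T ^^ s) w = 0" unfolding s_def by (rule LeastI[of _ i]) (rule assms)
  have "s \<le> i" unfolding s_def by (rule Least_le) (rule assms)
  have "s \<noteq> 0" using s assms by (cases s) auto
  have "(T ^^ (s - 1)) w \<noteq> 0"
    using not_less_Least[of "s - 1" "\<lambda>k. (T ^^ k) w = 0"] \<open>s \<noteq> 0\<close> by (simp add: s_def[symmetric])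
  then show ?thesis using that[of "s - 1"] s \<open>s \<noteq> 0\<close> \<open>s \<le> i\<close> by (cases s) auto
qed

text \<open>The left and right radicals of b_i on \<open>X\<close> coincide by
  \<open>B_top_symmetric\<close>. In particular T^(i-1) is injective on \<open>X\<close>, which
  \<open>kernel_cyclic\<close> asks for.\<close>

lemma top_form_inj:
  assumes X: "\<And>x. x \<in> X \<Longrightarrow> (T ^^ i) x = 0" and i: "i > 0"
    and nd: "\<And>x. x \<in> X \<Longrightarrow> (\<And>y. y \<in> X \<Longrightarrow> B x ((T ^^ (i - 1)) y) = 0) \<Longrightarrow> x = 0"
    and x: "x \<in> X" "\<And>y. y \<in> X \<Longrightarrow> B y ((T ^^ (i - 1)) x) = 0"
  shows "x = 0"
proof (rule nd[OF x(1)])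
  fix y assume y: "y \<in> X"
  have "B x ((T ^^ (i - 1)) y) = (-1) ^ Suc (i - 1) * B y ((T ^^ (i - 1)) x)"
    by (rule B_top_symmetric) (use X x i in auto)
  then show "B x ((T ^^ (i - 1)) y) = 0" using x y by simp
qed

text \<open>The radical is invariant, so a nonzero vector in it may be taken in ker T. There it has
  the form T^(i-1) x with x in \<open>X\<close>, and pairing it with \<open>X\<close> gives b_i,
  which is nondegenerate by assumption.\<close>

lemma nondegenerate_cyclic:
  assumes X: "vec.subspace X" "\<And>x. x \<in> X \<Longrightarrow> (T ^^ i) x = 0" and i: "i > 0"
    and nd: "\<And>x. x \<in> X \<Longrightarrow> (\<And>y. y \<in> X \<Longrightarrow> B x ((T ^^ (i - 1)) y) = 0) \<Longrightarrow> x = 0"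
  shows "nondegenerate_on B (cyclic i X)"
  unfolding nondegenerate_on_iff
proof (intro subsetI; rule ccontr)
  let ?W = "cyclic i X"
  fix w assume w: "w \<in> ?W \<inter> perp ?W" "w \<notin> {0}"
  have inv: "invariant_subspace ?W" by (rule invariant_cyclic[OF X])
  obtain r where r: "T ((T ^^ r) w) = 0" "(T ^^ r) w \<noteq> 0"
    using lowest_power[of i w] T_power_cyclic_zero[OF X(2), where v=w] w by blast
  have "(T ^^ r) w \<in> ?W" "(T ^^ r) w \<in> perp ?W"
    using invariant_subspaceD(3)[OF inv] invariant_subspaceD(3)[OF invariant_perp[OF inv]] w by auto
  moreover obtain x where x: "x \<in> X" "(T ^^ r) w = (T ^^ (i - 1)) x"
  proof (rule kernel_cyclic[OF X])
    show "\<And>x. x \<in> X \<Longrightarrow> (T ^^ (i - 1)) x = 0 \<Longrightarrow> x = 0"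
      by (rule top_form_inj[OF X(2) i nd]) auto
  qed (use calculation r in auto)
  ultimately have "B y ((T ^^ (i - 1)) x) = 0" if "y \<in> X" for y
    using that T_power_in_cyclic[OF X(1) that i] by (auto simp: perp_sym)
  then have "x = 0" by (intro top_form_inj[OF X(2) i nd x(1)])
  then show False using x r by (simp add: vec.linear_0[OF T_power_linear])
qed

end

subsection \<open>Orthogonal decompositions\<close>

text \<open>Replaces the extensional functions of the definition by arbitrary families and
  injectivity by a trivial kernel, so that families can be subtracted and changed at one
  index.\<close>

lemma is_direct_sum_iff:
  assumes I: "finite I"
  shows "is_direct_sum I W U \<longleftrightarrow>
    (\<forall>i\<in>I. vec.subspace (W i)) \<and>
    (\<forall>u. u \<in> U \<longleftrightarrow> (\<exists>w. (\<forall>i\<in>I. w i \<in> W i) \<and> u = (\<Sum>i\<in>I. w i))) \<and>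
    (\<forall>w. (\<forall>i\<in>I. w i \<in> W i) \<longrightarrow> (\<Sum>i\<in>I. w i) = 0 \<longrightarrow> (\<forall>i\<in>I. w i = 0))"
proof -
  let ?s = "\<lambda>w. \<Sum>i\<in>I. w i"
  have im: "?s ` (\<Pi>\<^sub>E i\<in>I. W i) = {u. \<exists>w. (\<forall>i\<in>I. w i \<in> W i) \<and> u = ?s w}"
  proof (intro subset_antisym subsetI)
    fix u assume "u \<in> {u. \<exists>w. (\<forall>i\<in>I. w i \<in> W i) \<and> u = ?s w}"
    then obtain w where w: "\<forall>i\<in>I. w i \<in> W i" "u = ?s w" by blast
    then show "u \<in> ?s ` (\<Pi>\<^sub>E i\<in>I. W i)"
      by (intro image_eqI[of _ _ "restrict w I"]) auto
  qed blast
  have "inj_on ?s (\<Pi>\<^sub>E i\<in>I. W i) \<longleftrightarrow>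
      (\<forall>w. (\<forall>i\<in>I. w i \<in> W i) \<longrightarrow> ?s w = 0 \<longrightarrow> (\<forall>i\<in>I. w i = 0))"
    if sub: "\<forall>i\<in>I. vec.subspace (W i)"
  proof (intro iffI allI impI ballI)
    fix w i assume inj: "inj_on ?s (\<Pi>\<^sub>E i\<in>I. W i)" and w: "\<forall>i\<in>I. w i \<in> W i" "?s w = 0" and i: "i \<in> I"
    have "restrict w I = restrict (\<lambda>_. 0) I"
      by (rule inj_onD[OF inj]) (use w sub in \<open>auto simp: vec.subspace_0\<close>)
    then show "w i = 0" using i by (metis restrict_apply')
  next
    assume *: "\<forall>w. (\<forall>i\<in>I. w i \<in> W i) \<longrightarrow> ?s w = 0 \<longrightarrow> (\<forall>i\<in>I. w i = 0)"
    show "inj_on ?s (\<Pi>\<^sub>E i\<in>I. W i)"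
    proof (rule inj_onI)
      fix w w' assume w: "w \<in> (\<Pi>\<^sub>E i\<in>I. W i)" "w' \<in> (\<Pi>\<^sub>E i\<in>I. W i)" "?s w = ?s w'"
      have "\<forall>i\<in>I. w i - w' i = 0"
        using *[rule_format, of "\<lambda>i. w i - w' i"] w sub
        by (auto simp: sum_subtractf vec.subspace_diff PiE_mem)
      then show "w = w'" using w by (intro PiE_ext[of w I W w']) auto
    qed
  qed
  moreover have "{u. \<exists>w. (\<forall>i\<in>I. w i \<in> W i) \<and> u = ?s w} = U \<longleftrightarrow>
      (\<forall>u. u \<in> U \<longleftrightarrow> (\<exists>w. (\<forall>i\<in>I. w i \<in> W i) \<and> u = ?s w))"
    by (simp only: set_eq_iff mem_Collect_eq) blast
  ultimately show ?thesis
    unfolding is_direct_sum_def bij_betw_def im by blast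
qed

lemma is_direct_sum_cong:
  assumes "\<And>i. i \<in> I \<Longrightarrow> W i = W' i"
  shows "is_direct_sum I W U \<longleftrightarrow> is_direct_sum I W' U"
proof -
  have "(\<Pi>\<^sub>E i\<in>I. W i) = (\<Pi>\<^sub>E i\<in>I. W' i)" using assms by (rule PiE_cong)
  then show ?thesis using assms by (simp add: is_direct_sum_def)
qed

context
  fixes I :: "'i set" and W :: "'i \<Rightarrow> ('a::field^'m::finite) set" and U :: "('a^'m) set"
  assumes direct: "is_direct_sum I W U" and finite_index: "finite I"
begin

lemma direct_sum_subspace: "i \<in> I \<Longrightarrow> vec.subspace (W i)"
  using direct by (simp add: is_direct_sum_def)

lemma direct_sumE:
  assumes "u \<in> U"
  obtains w where "\<And>i. i \<in> I \<Longrightarrow> w i \<in> W i" "u = (\<Sum>i\<in>I. w i)"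
  using assms direct unfolding is_direct_sum_iff[OF finite_index] by blast

lemma direct_sumI: "(\<And>i. i \<in> I \<Longrightarrow> w i \<in> W i) \<Longrightarrow> (\<Sum>i\<in>I. w i) \<in> U"
  using direct unfolding is_direct_sum_iff[OF finite_index] by blast

lemma direct_sum_zero: "(\<And>i. i \<in> I \<Longrightarrow> w i \<in> W i) \<Longrightarrow> (\<Sum>i\<in>I. w i) = 0 \<Longrightarrow> i \<in> I \<Longrightarrow> w i = 0"
  using direct unfolding is_direct_sum_iff[OF finite_index] by blast

lemma direct_sum_summand: "i \<in> I \<Longrightarrow> W i \<subseteq> U"
proof
  fix x assume i: "i \<in> I" and x: "x \<in> W i"
  have "(\<Sum>j\<in>I. if j = i then x else 0) \<in> U"
    by (rule direct_sumI) (use x direct_sum_subspace vec.subspace_0 in auto)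
  then show "x \<in> U" using i finite_index by simp
qed

end

lemma is_direct_sum_insert:
  assumes d: "is_direct_sum I W U'" and I: "finite I" "n \<notin> I"
    and Wn: "vec.subspace (W n)" and disj: "W n \<inter> U' \<subseteq> {0}"
    and U: "\<And>u. u \<in> U \<longleftrightarrow> (\<exists>w\<in>W n. \<exists>u'\<in>U'. u = w + u')"
  shows "is_direct_sum (insert n I) W U"
  unfolding is_direct_sum_iff[OF finite.insertI[OF I(1)]]
proof (intro conjI ballI allI impI)
  fix i assume "i \<in> insert n I"
  then show "vec.subspace (W i)" using Wn direct_sum_subspace[OF d I(1)] by auto
next
  fix u
  show "u \<in> U \<longleftrightarrow> (\<exists>w. (\<forall>i\<in>insert n I. w i \<in> W i) \<and> u = (\<Sum>i\<in>insert n I. w i))"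
  proof
    assume "u \<in> U"
    then obtain x u' where x: "x \<in> W n" "u' \<in> U'" "u = x + u'" using U by blast
    obtain w where w: "\<And>i. i \<in> I \<Longrightarrow> w i \<in> W i" "u' = (\<Sum>i\<in>I. w i)"
      using direct_sumE[OF d I(1) x(2)] by blast
    have "(\<Sum>i\<in>I. (w(n := x)) i) = u'"
      unfolding w(2) by (intro sum.cong) (use I in auto)
    then show "\<exists>w. (\<forall>i\<in>insert n I. w i \<in> W i) \<and> u = (\<Sum>i\<in>insert n I. w i)"
      by (intro exI[of _ "w(n := x)"]) (use I w x in auto)
  next
    assume "\<exists>w. (\<forall>i\<in>insert n I. w i \<in> W i) \<and> u = (\<Sum>i\<in>insert n I. w i)"
    then obtain w where w: "\<forall>i\<in>insert n I. w i \<in> W i" "u = (\<Sum>i\<in>insert n I. w i)" by blast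
    have "(\<Sum>i\<in>I. w i) \<in> U'" using w by (intro direct_sumI[OF d I(1)]) auto
    then show "u \<in> U" using w I U by auto
  qed
next
  fix w i assume w: "\<forall>i\<in>insert n I. w i \<in> W i" "(\<Sum>i\<in>insert n I. w i) = 0" "i \<in> insert n I"
  have s: "(\<Sum>i\<in>I. w i) \<in> U'" using w by (intro direct_sumI[OF d I(1)]) auto
  have "w n = - (\<Sum>i\<in>I. w i)" using w(2) I by (simp add: eq_neg_iff_add_eq_0)
  then have "(\<Sum>i\<in>I. w i) = - w n" by simp
  then have "- w n \<in> U'" using s by simp
  moreover have "- w n \<in> W n" using w Wn by (simp add: vec.subspace_neg)
  ultimately have 0: "w n = 0" using disj by auto
  then have "(\<Sum>i\<in>I. w i) = 0" using w(2) I by simp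
  then show "w i = 0"
    using 0 w direct_sum_zero[OF d I(1), of w i] by auto
qed

section \<open>Fitting decomposition and orthogonal splitting\<close>

context symplectic_isometry
begin

text \<open>The Fitting complement of \<open>V1\<close>: \<open>T\<close> is bijective on it, so it
  lies in T V and contributes nothing to V / T V.\<close>

definition T_range :: "('a^'m) set" where "T_range = range (T ^^ CARD('m))"

abbreviation V1 :: "('a^'m) set" where "V1 \<equiv> gen_one_space g"

lemma T_range_eq: "T ` T_range = T_range"
proof -
  define R where "R k = range (T ^^ k)" for k
  have TR: "T ` R k = R (Suc k)" for k
    unfolding R_def by (simp add: image_image o_def)
  have mono: "R (Suc k) \<subseteq> R k" for k
    unfolding R_def by (auto simp: funpow_swap1)
  have sub: "vec.subspace (R k)" for k
    unfolding R_def by (intro vec.linear_subspace_image T_power_linear vec.subspace_UNIV)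
  \<comment> \<open>Equality of two consecutive ranges persists for all later exponents. A drop
    after exponent \<open>CARD('m)\<close> would force a drop at each of the first
    \<open>CARD('m) + 1\<close> steps, more than the dimension allows.\<close>
  have "R (Suc (CARD('m))) = R (CARD('m))"
  proof (rule ccontr)
    assume neq: "R (Suc (CARD('m))) \<noteq> R (CARD('m))"
    have neq': "R (Suc k) \<noteq> R k" if "k \<le> CARD('m)" for k
    proof
      assume eq: "R (Suc k) = R k"
      have "R (k + l) = R k" for l
      proof (induction l)
        case (Suc l)
        then have "R (k + Suc l) = T ` R k" using TR[of "k + l"] by simp
        then show ?case using TR[of k] eq by simp
      qed simp
      from this[of "CARD('m) - k"] this[of "Suc (CARD('m)) - k"] show False
        using neq that by simp
    qed
    have "vec.dim (R k) + k \<le> CARD('m)" if "k \<le> Suc (CARD('m))" for k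
      using that
    proof (induction k)
      case 0
      then show ?case using vec.dim_subset_UNIV[of "R 0"] by (simp add: vec.dimension_def card_cart_basis)
    next
      case (Suc k)
      have "R (Suc k) \<subset> R k" using mono neq' Suc.prems by auto
      then have "vec.dim (R (Suc k)) < vec.dim (R k)"
        using sub by (intro vec.dim_psubset) (simp add: vec.span_eq_iff[THEN iffD2])
      then show ?case using Suc by simp
    qed
    from this[of "Suc (CARD('m))"] show False by simp
  qed
  then show ?thesis using TR[of "CARD('m)"] by (simp add: T_range_def R_def)
qed

lemma subspace_T_range: "vec.subspace T_range"
  unfolding T_range_def by (intro vec.linear_subspace_image T_power_linear vec.subspace_UNIV)

lemma subspace_V1: "vec.subspace V1"
proof -
  have "V1 = {x. (T ^^ CARD('m)) x = 0}" by (simp add: gen_one_space_def)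
  then show ?thesis using vec.linear_subspace_kernel[OF T_power_linear] by simp
qed

lemma T_range_power_eq: "(T ^^ k) ` T_range = T_range"
proof (induction k)
  case (Suc k)
  have "(T ^^ Suc k) ` T_range = T ` ((T ^^ k) ` T_range)" by (simp add: image_comp)
  then show ?case by (simp add: Suc T_range_eq)
qed simp

text \<open>A surjection of the finite set \<open>T_range\<close> onto itself is injective.\<close>

lemma T_range_power_zero:
  assumes "x \<in> T_range" "(T ^^ k) x = 0"
  shows "x = 0"
proof -
  have "inj_on (T ^^ k) T_range"
    by (intro eq_card_imp_inj_on) (simp_all add: T_range_power_eq)
  moreover have "(T ^^ k) 0 = 0" by (rule vec.linear_0[OF T_power_linear])
  ultimately show ?thesis
    using assms vec.subspace_0[OF subspace_T_range] inj_onD[of "T ^^ k" T_range x 0] by simp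
qed

text \<open>Any exponent will do: \<open>(T ^^ CARD('m)) x\<close> lies in \<open>T_range\<close>
  and is killed by T^k, which is injective there.\<close>

lemma V1_I: "x \<in> V1" if "(T ^^ k) x = 0"
proof -
  have "(T ^^ k) ((T ^^ CARD('m)) x) = (T ^^ CARD('m)) ((T ^^ k) x)"
    by (simp add: T_power_add add.commute)
  then have "(T ^^ k) ((T ^^ CARD('m)) x) = 0"
    unfolding that by (simp add: vec.linear_0[OF T_power_linear])
  then have "(T ^^ CARD('m)) x = 0"
    using T_range_power_zero[of "(T ^^ CARD('m)) x" k] by (simp add: T_range_def)
  then show ?thesis by (simp add: gen_one_space_def)
qed

lemma invariant_V1: "invariant_subspace V1"
  unfolding invariant_subspace_def
proof (intro conjI subspace_V1 subsetI)
  fix y assume "y \<in> T ` V1"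
  then obtain x where "x \<in> V1" "y = T x" by auto
  then have "(T ^^ CARD('m)) y = 0"
    by (simp add: gen_one_space_def funpow_swap1[symmetric] vec.linear_0[OF T_linear])
  then show "y \<in> V1" by (rule V1_I)
qed

lemma Fitting_decomposition:
  obtains u r where "u \<in> V1" "r \<in> T_range" "v = u + r"
proof -
  have "(T ^^ CARD('m)) v \<in> (T ^^ CARD('m)) ` T_range"
    unfolding T_range_power_eq by (simp add: T_range_def)
  then obtain r where r: "r \<in> T_range" "(T ^^ CARD('m)) v = (T ^^ CARD('m)) r" by auto
  then have "(T ^^ CARD('m)) (v - r) = 0" by (simp add: vec.linear_diff[OF T_power_linear])
  then have "v - r \<in> V1" by (rule V1_I)
  then show ?thesis using that[of "v - r" r] r by simp
qed

text \<open>Moving the power \<open>T ^^ CARD('m)\<close> that defines \<open>r\<close> to the other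
  side of the form lets it act on \<open>x\<close>, where it vanishes.\<close>

lemma V1_perp_T_range: "x \<in> V1 \<Longrightarrow> r \<in> T_range \<Longrightarrow> B x r = 0"
  unfolding T_range_def gen_one_space_def by (subst B_skew) (auto simp: B_T_power_left)

lemma nondegenerate_V1: "nondegenerate_on B V1"
  unfolding nondegenerate_on_def
proof (intro ballI impI)
  fix x assume x: "x \<in> V1" "\<forall>y\<in>V1. B x y = 0"
  have "B x v = 0" for v
  proof -
    obtain u r where "u \<in> V1" "r \<in> T_range" "v = u + r" using Fitting_decomposition by blast
    then show ?thesis using x by (simp add: B_simps V1_perp_T_range)
  qed
  then show "x = 0" using nondegenerate by (simp add: nondegenerate_on_def)
qed

text \<open>\<open>cyclic i X\<close> is then a free module over \<open>F[T]/(T ^ i)\<close> on a basis of \<open>X\<close>.\<close>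

definition generates_freely :: "nat \<Rightarrow> ('a^'m) set \<Rightarrow> bool" where
  "generates_freely i X \<longleftrightarrow> vec.subspace X \<and> (\<forall>x\<in>X. (T ^^ i) x = 0) \<and>
     (\<forall>x\<in>X. (T ^^ (i - 1)) x = 0 \<longrightarrow> x = 0)"

lemma orthogonal_cyclic_decomposition:
  assumes "invariant_subspace U" "nondegenerate_on B U" "\<And>u. u \<in> U \<Longrightarrow> (T ^^ i) u = 0"
  shows "\<exists>X. (\<forall>j\<in>{1..i}. generates_freely j (X j)) \<and> is_direct_sum {1..i} (\<lambda>j. cyclic j (X j)) U \<and>
    (\<forall>j\<in>{1..i}. \<forall>k\<in>{1..i}. j \<noteq> k \<longrightarrow> (\<forall>x\<in>cyclic j (X j). \<forall>y\<in>cyclic k (X k). B x y = 0))"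
  using assms
proof (induction i arbitrary: U)
  case 0
  then have "U = {0}" using invariant_subspaceD(1)[OF 0(1)] vec.subspace_0 by auto
  then show ?case by (auto simp: is_direct_sum_def bij_betw_def)
next
  case (Suc i)
  note U = invariant_subspaceD[OF Suc.prems(1)]
  \<comment> \<open>A linear section of T^i over T^i U. The image \<open>X\<close> of T^i U under it
    is a complement of ker T^i in \<open>U\<close>; it is {0} if no block of size i + 1 occurs, and
    the summand is then {0} as well.\<close>
  obtain s where s: "s ` UNIV \<subseteq> U" "Vector_Spaces.linear (*s) (*s) s" "\<forall>v\<in>(T ^^ i) ` U. (T ^^ i) (s v) = v"
    using vec.linear_exists_right_inverse_on[OF T_power_linear U(1)] by blast
  define X where "X = s ` ((T ^^ i) ` U)"
  define W where "W = cyclic (Suc i) X"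
  have subX: "vec.subspace X"
    unfolding X_def by (intro vec.linear_subspace_image s T_power_linear U)
  have XU: "X \<subseteq> U" using s unfolding X_def by auto
  have X0: "(T ^^ Suc i) x = 0" if "x \<in> X" for x using XU that Suc.prems(3) by blast
  have Xi: "x = 0" if "x \<in> X" "(T ^^ i) x = 0" for x
    using that s vec.linear_0[OF s(2)] unfolding X_def by auto
  have split: "\<exists>x\<in>X. (T ^^ i) u = (T ^^ i) x" if "u \<in> U" for u
    using that s unfolding X_def by (intro bexI[of _ "s ((T ^^ i) u)"]) auto
  \<comment> \<open>Up to sign, B(u, T^i x) is B(x, T^i u), and every T^i u is some T^i y with y in
    \<open>X\<close>. If x is in the radical on \<open>X\<close>, then T^i x is orthogonal to all of
    \<open>U\<close>.\<close>
  have nd: "x = 0" if x: "x \<in> X" "\<And>y. y \<in> X \<Longrightarrow> B x ((T ^^ (Suc i - 1)) y) = 0" for x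
  proof -
    have "B u ((T ^^ i) x) = 0" if u: "u \<in> U" for u
    proof -
      obtain y where y: "y \<in> X" "(T ^^ i) u = (T ^^ i) y" using split[OF u] by blast
      have "B u ((T ^^ i) x) = (-1) ^ Suc i * B x ((T ^^ i) u)"
        by (rule B_top_symmetric) (use Suc.prems(3) u in blast)
      then show ?thesis using y x by simp
    qed
    then have "(T ^^ i) x \<in> perp U" by (simp add: perp_sym)
    moreover have "(T ^^ i) x \<in> U" using U(3) XU x by auto
    ultimately have "(T ^^ i) x = 0" using Suc.prems(2) by (auto simp: nondegenerate_on_iff)
    then show ?thesis using Xi x by simp
  qed
  have invW: "invariant_subspace W" unfolding W_def by (rule invariant_cyclic[OF subX X0])
  have ndW: "nondegenerate_on B W" unfolding W_def by (rule nondegenerate_cyclic[OF subX X0 _ nd]) auto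
  have WU: "W \<subseteq> U"
  proof
    fix v assume "v \<in> W"
    then obtain f where "v = (\<Sum>k<Suc i. (T ^^ k) (f k))" "\<And>k. k < Suc i \<Longrightarrow> f k \<in> X"
      unfolding W_def by (elim cyclicE) blast
    moreover have "(\<Sum>k<Suc i. (T ^^ k) (f k)) \<in> U"
      by (intro vec.subspace_sum U(1)) (use U(3) XU calculation(2) in blast)
    ultimately show "v \<in> U" by simp
  qed
  define U' where "U' = U \<inter> perp W"
  have invU': "invariant_subspace U'"
    using Suc.prems(1) invariant_perp[OF invW] unfolding U'_def invariant_subspace_def
    by (auto intro: vec.subspace_inter)
  have splitU: "u \<in> U \<longleftrightarrow> (\<exists>w\<in>W. \<exists>u'\<in>U'. u = w + u')" for u
  proof
    assume u: "u \<in> U"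
    obtain w where w: "w \<in> W" "u - w \<in> perp W"
      using orthogonal_projection[OF invariant_subspaceD(1)[OF invW] ndW] by blast
    then have "u - w \<in> U'" using u WU U(1) by (auto simp: U'_def intro: vec.subspace_diff)
    then show "\<exists>w\<in>W. \<exists>u'\<in>U'. u = w + u'" using w by (intro bexI[of _ w] bexI[of _ "u - w"]) auto
  qed (use WU U(1) in \<open>auto simp: U'_def intro: vec.subspace_add\<close>)
  have ndU': "nondegenerate_on B U'"
    unfolding nondegenerate_on_def
  proof (intro ballI impI)
    fix x assume x: "x \<in> U'" "\<forall>y\<in>U'. B x y = 0"
    have "B x u = 0" if u: "u \<in> U" for u
    proof -
      obtain w u' where "w \<in> W" "u' \<in> U'" "u = w + u'" using u splitU by blast
      then show ?thesis using x by (simp add: B_simps U'_def perp_def)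
    qed
    then show "x = 0" using Suc.prems(2) x unfolding nondegenerate_on_def U'_def by blast
  qed
  \<comment> \<open>T^i u equals some T^i x with x in \<open>X\<close>, hence lies in
    \<open>W\<close>; being also orthogonal to \<open>W\<close>, it is zero. This lowers the
    exponent on \<open>U'\<close>.\<close>
  have "(T ^^ i) u = 0" if u: "u \<in> U'" for u
  proof -
    obtain x where x: "x \<in> X" "(T ^^ i) u = (T ^^ i) x" using split u U'_def by blast
    then have "(T ^^ i) u \<in> W" unfolding W_def using T_power_in_cyclic[OF subX x(1)] by simp
    moreover have "(T ^^ i) u \<in> perp W" using invariant_subspaceD(3)[OF invU' u, of i] by (simp add: U'_def)
    ultimately show ?thesis using ndW by (auto simp: nondegenerate_on_iff)
  qed
  from Suc.IH[OF invU' ndU' this] obtain X' where X': "\<forall>j\<in>{1..i}. generates_freely j (X' j)"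
    "is_direct_sum {1..i} (\<lambda>j. cyclic j (X' j)) U'"
    "\<forall>j\<in>{1..i}. \<forall>k\<in>{1..i}. j \<noteq> k \<longrightarrow> (\<forall>x\<in>cyclic j (X' j). \<forall>y\<in>cyclic k (X' k). B x y = 0)"
    by blast
  define Y where "Y = X'(Suc i := X)"
  have Y: "Y (Suc i) = X" "\<And>j. j \<in> {1..i} \<Longrightarrow> Y j = X' j" unfolding Y_def by auto
  have ins: "{1..Suc i} = insert (Suc i) {1..i}" by auto
  have "is_direct_sum {1..i} (\<lambda>j. cyclic j (Y j)) U'"
    using X'(2) Y(2) is_direct_sum_cong[of "{1..i}" "\<lambda>j. cyclic j (X' j)" "\<lambda>j. cyclic j (Y j)"] by simp
  then have d: "is_direct_sum {1..Suc i} (\<lambda>j. cyclic j (Y j)) U"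
    unfolding ins
  proof (rule is_direct_sum_insert)
    show "cyclic (Suc i) (Y (Suc i)) \<inter> U' \<subseteq> {0}"
      using ndW by (auto simp: U'_def Y W_def nondegenerate_on_iff)
  qed (use splitU subspace_cyclic subX in \<open>auto simp: W_def Y\<close>)
  have gf: "\<forall>j\<in>{1..Suc i}. generates_freely j (Y j)"
    unfolding ins using X'(1) subX X0 Xi Y by (auto simp: generates_freely_def)
  have o1: "B x y = 0" if "j \<in> {1..i}" "x \<in> cyclic j (Y j)" "y \<in> W" for x y j
  proof -
    have "x \<in> U'" using direct_sum_summand[OF X'(2) _ that(1)] that(1,2) Y(2) by auto
    then show ?thesis using that(3) by (simp add: U'_def perp_def)
  qed
  have o2: "B x y = 0" if "j \<in> {1..i}" "x \<in> W" "y \<in> cyclic j (Y j)" for x y j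
    using o1[OF that(1) that(3,2)] by (subst B_skew) simp
  have "\<forall>j\<in>{1..Suc i}. \<forall>k\<in>{1..Suc i}. j \<noteq> k \<longrightarrow> (\<forall>x\<in>cyclic j (Y j). \<forall>y\<in>cyclic k (Y k). B x y = 0)"
  proof (intro ballI impI)
    fix j k x y assume j: "j \<in> {1..Suc i}" and k: "k \<in> {1..Suc i}" and jk: "j \<noteq> k"
      and x: "x \<in> cyclic j (Y j)" and y: "y \<in> cyclic k (Y k)"
    consider "j \<in> {1..i}" "k \<in> {1..i}" | "j \<in> {1..i}" "k = Suc i" | "j = Suc i" "k \<in> {1..i}"
      using j k jk by fastforce
    then show "B x y = 0"
    proof cases
      case 1
      then show ?thesis using X'(3) x y jk Y(2) by simp
    next
      case 2
      then show ?thesis using o1[OF _ x] y by (simp add: Y(1) W_def)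
    next
      case 3
      then show ?thesis using o2[OF _ _ y] x by (simp add: Y(1) W_def)
    qed
  qed
  with gf d show ?case by blast
qed

end

subsection \<open>Jordan forms\<close>

text \<open>Zero-based position of the index j inside its Jordan block. Column j of
  \<open>jordan_matrix\<close> has an off-diagonal 1 exactly when this is nonzero, so the block
  matrix is described by a single index.\<close>

fun block_pos :: "(nat \<times> 'a) list \<Rightarrow> nat \<Rightarrow> nat" where
  "block_pos [] j = 0"
| "block_pos ((n, c) # n_as) j = (if j < n then j else block_pos n_as (j - n))"

fun block_eigenvalue :: "(nat \<times> 'a::zero) list \<Rightarrow> nat \<Rightarrow> 'a" where
  "block_eigenvalue [] j = 0"
| "block_eigenvalue ((n, c) # n_as) j = (if j < n then c else block_eigenvalue n_as (j - n))"

abbreviation jordan_dim :: "(nat \<times> 'a) list \<Rightarrow> nat" where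
  "jordan_dim n_as \<equiv> sum_list (map fst n_as)"

lemma block_pos_le: "block_pos n_as j \<le> j"
  by (induction n_as j rule: block_pos.induct) (auto intro: order_trans)

lemma block_pos_pred:
  assumes "block_pos n_as j \<noteq> 0"
  shows "block_pos n_as (j - 1) = block_pos n_as j - 1"
  using assms
proof (induction n_as j rule: block_pos.induct)
  case (2 n c n_as j)
  show ?case
  proof (cases "j < n")
    case False
    then have ne: "block_pos n_as (j - n) \<noteq> 0" using 2 by simp
    then have "j - n \<noteq> 0" using block_pos_le[of n_as "j - n"] by simp
    then have "\<not> j - 1 < n" "j - 1 - n = j - n - 1" by auto
    then show ?thesis using 2 False ne by simp
  qed auto
qed auto

lemma block_eigenvalue_pred:
  assumes "block_pos n_as j \<noteq> 0"
  shows "block_eigenvalue n_as (j - 1) = block_eigenvalue n_as j"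
  using assms
proof (induction n_as j rule: block_pos.induct)
  case (2 n c n_as j)
  show ?case
  proof (cases "j < n")
    case False
    then have ne: "block_pos n_as (j - n) \<noteq> 0" using 2 by simp
    then have "j - n \<noteq> 0" using block_pos_le[of n_as "j - n"] by simp
    then have "\<not> j - 1 < n" "j - 1 - n = j - n - 1" by auto
    then show ?thesis using 2 False ne by simp
  qed auto
qed auto

lemma block_pos_append:
  "block_pos (n1 @ n2) j = (if j < jordan_dim n1 then block_pos n1 j else block_pos n2 (j - jordan_dim n1))"
  by (induction n1 j rule: block_pos.induct) auto

lemma block_eigenvalue_append:
  "block_eigenvalue (n1 @ n2) j =
    (if j < jordan_dim n1 then block_eigenvalue n1 j else block_eigenvalue n2 (j - jordan_dim n1))"
  by (induction n1 j rule: block_eigenvalue.induct) auto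

lemma jordan_matrix_entry:
  assumes "i < jordan_dim n_as" "j < jordan_dim n_as"
  shows "jordan_matrix n_as $$ (i, j) =
    (if i = j then block_eigenvalue n_as j else if Suc i = j \<and> block_pos n_as j \<noteq> 0 then 1 else 0)"
  using assms
proof (induction n_as arbitrary: i j)
  case (Cons p n_as)
  obtain n c where p: "p = (n, c)" by (cases p)
  have le: "block_pos n_as k \<le> k" for k by (rule block_pos_le)
  show ?case
    unfolding p jordan_matrix_Cons using Cons p le[of 0]
    by (auto simp: Suc_diff_le not_less)
qed auto

lemma sum_jordan_matrix_column:
  fixes n_as :: "(nat \<times> 'a::field) list" and ws :: "('a^'m::finite) list"
  assumes "j < length ws" "length ws = jordan_dim n_as"
  shows "(\<Sum>i < length ws. jordan_matrix n_as $$ (i, j) *s ws ! i) =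
    block_eigenvalue n_as j *s ws ! j + (if block_pos n_as j = 0 then 0 else ws ! (j - 1))"
proof -
  have "(\<Sum>i < length ws. jordan_matrix n_as $$ (i, j) *s ws ! i) =
    (\<Sum>i < length ws. (if i = j then block_eigenvalue n_as j *s ws ! j else 0) +
       (if i = j - 1 then if block_pos n_as j = 0 then 0 else ws ! (j - 1) else 0))"
  proof (intro sum.cong refl)
    fix i assume "i \<in> {..<length ws}"
    moreover have "j \<noteq> 0" if "block_pos n_as j \<noteq> 0" using block_pos_le[of n_as j] that by auto
    ultimately show "jordan_matrix n_as $$ (i, j) *s ws ! i =
       (if i = j then block_eigenvalue n_as j *s ws ! j else 0) +
       (if i = j - 1 then if block_pos n_as j = 0 then 0 else ws ! (j - 1) else 0)"
      using assms by (auto simp: jordan_matrix_entry)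
  qed
  also have "\<dots> = block_eigenvalue n_as j *s ws ! j + (if block_pos n_as j = 0 then 0 else ws ! (j - 1))"
    using assms by (subst sum.distrib) simp
  finally show ?thesis .
qed

lemma has_jordan_form_on_iff:
  "has_jordan_form_on g W n_as \<longleftrightarrow> 0 \<notin> fst ` set n_as \<and>
     (\<exists>ws. length ws = jordan_dim n_as \<and> distinct ws \<and> vec.independent (set ws) \<and> vec.span (set ws) = W \<and>
       (\<forall>j < length ws. g (ws ! j) =
          block_eigenvalue n_as j *s ws ! j + (if block_pos n_as j = 0 then 0 else ws ! (j - 1))))"
proof -
  have eq: "(\<forall>j < length ws. g (ws ! j) = (\<Sum>i < length ws. jordan_matrix n_as $$ (i, j) *s ws ! i)) \<longleftrightarrow>
      (\<forall>j < length ws. g (ws ! j) =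
         block_eigenvalue n_as j *s ws ! j + (if block_pos n_as j = 0 then 0 else ws ! (j - 1)))"
    if "length ws = jordan_dim n_as" for ws
    by (simp only: sum_jordan_matrix_column[OF _ that] cong: imp_cong)
  show ?thesis
    unfolding has_jordan_form_on_def by (intro conj_cong refl ex_cong1 eq)
qed

lemma sum_lessThan_add: "(\<Sum>j<n + s. f j) = (\<Sum>j<n. f j) + (\<Sum>j<s. f (n + j))"
  for f :: "nat \<Rightarrow> nat"
  by (induction s) auto

text \<open>A block of size n contains the position k exactly once if k < n, and not at all
  otherwise.\<close>

lemma card_block_pos:
  "card {j. j < jordan_dim n_as \<and> block_pos n_as j = k} = length (filter (\<lambda>p. k < fst p) n_as)"
proof -
  have card: "card {j. j < s \<and> P j} = (\<Sum>j<s. if P j then 1 else 0)" for s :: nat and P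
  proof -
    have "{j. j < s \<and> P j} = {..<s} \<inter> {j. P j}" by auto
    then show ?thesis by (simp add: sum.If_cases)
  qed
  show ?thesis
  proof (induction n_as)
    case (Cons p n_as)
    obtain n c where p: "p = (n, c)" by (cases p)
    have "card {j. j < jordan_dim (p # n_as) \<and> block_pos (p # n_as) j = k} =
        (\<Sum>j<n. if j = k then 1 else 0) + (\<Sum>j<jordan_dim n_as. if block_pos n_as j = k then 1 else 0)"
      unfolding card p by (simp add: sum_lessThan_add)
    also have "\<dots> = (if k < n then 1 else 0) + length (filter (\<lambda>p. k < fst p) n_as)"
      using Cons unfolding card by simp
    finally show ?case by (simp add: p)
  qed simp
qed

lemma disjoint_union_independent:
  fixes X Y :: "('a::field^'m::finite) set"
  assumes X: "vec.independent X" and Y: "vec.independent Y"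
    and disj: "vec.span X \<inter> vec.span Y \<subseteq> {0}"
  shows "X \<inter> Y = {}" "vec.independent (X \<union> Y)"
proof -
  show xy: "X \<inter> Y = {}"
    using disj vec.span_base vec.dependent_zero X by blast
  have fin: "finite X" "finite Y" using X Y by (auto intro: vec.finiteI_independent)
  have "vec.span X \<inter> vec.span Y = {0}" using disj vec.span_zero by blast
  then have "vec.dim (vec.span (X \<union> Y)) = card X + card Y"
    using vec.dim_sums_Int[of "vec.span X" "vec.span Y"] X Y
    by (simp add: vec.span_Un vec.dim_eq_card_independent)
  then show "vec.independent (X \<union> Y)"
    using fin xy by (intro vec.card_le_dim_spanning[of _ "vec.span (X \<union> Y)"])
      (auto simp: vec.span_superset card_Un_disjoint)
qed

lemma has_jordan_form_on_append:
  assumes 1: "has_jordan_form_on g W1 n1" and 2: "has_jordan_form_on g W2 n2" and disj: "W1 \<inter> W2 \<subseteq> {0}"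
  shows "has_jordan_form_on g {x + y | x y. x \<in> W1 \<and> y \<in> W2} (n1 @ n2)"
proof -
  obtain ws1 where ws1: "length ws1 = jordan_dim n1" "distinct ws1" "vec.independent (set ws1)"
    "vec.span (set ws1) = W1" "\<And>j. j < length ws1 \<Longrightarrow> g (ws1 ! j) =
          block_eigenvalue n1 j *s ws1 ! j + (if block_pos n1 j = 0 then 0 else ws1 ! (j - 1))"
    using 1 unfolding has_jordan_form_on_iff by blast
  obtain ws2 where ws2: "length ws2 = jordan_dim n2" "distinct ws2" "vec.independent (set ws2)"
    "vec.span (set ws2) = W2" "\<And>j. j < length ws2 \<Longrightarrow> g (ws2 ! j) =
          block_eigenvalue n2 j *s ws2 ! j + (if block_pos n2 j = 0 then 0 else ws2 ! (j - 1))"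
    using 2 unfolding has_jordan_form_on_iff by blast
  have ind: "set ws1 \<inter> set ws2 = {}" "vec.independent (set ws1 \<union> set ws2)"
    using disjoint_union_independent[OF ws1(3) ws2(3)] ws1 ws2 disj by auto
  have eq: "g ((ws1 @ ws2) ! j) = block_eigenvalue (n1 @ n2) j *s (ws1 @ ws2) ! j +
      (if block_pos (n1 @ n2) j = 0 then 0 else (ws1 @ ws2) ! (j - 1))"
    if j: "j < length (ws1 @ ws2)" for j
  proof (cases "j < length ws1")
    case True
    then have "j - 1 < length ws1" by simp
    then show ?thesis using True ws1(1) ws1(5)[OF True]
      by (simp add: block_pos_append block_eigenvalue_append nth_append)
  next
    case False
    define k where "k = j - length ws1"
    have k: "j = length ws1 + k" "k < length ws2" using False j by (auto simp: k_def)
    have "k \<noteq> 0" if "block_pos n2 k \<noteq> 0" using block_pos_le[of n2 k] that by auto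
    then show ?thesis using ws1(1) ws2(5)[OF k(2)]
      by (auto simp: block_pos_append block_eigenvalue_append nth_append k(1))
  qed
  show ?thesis
    unfolding has_jordan_form_on_iff
    by (intro conjI exI[of _ "ws1 @ ws2"])
      (use 1 2 ws1 ws2 ind eq in \<open>auto simp: vec.span_Un has_jordan_form_on_iff\<close>)
qed

lemma rank_nullity_on:
  fixes f :: "('a::field, 'm::finite) vector_map"
  assumes f: "Vector_Spaces.linear (*s) (*s) f" and W: "vec.subspace W"
  shows "vec.dim W = vec.dim (f ` W) + vec.dim (W \<inter> {x. f x = 0})"
proof -
  let ?K = "W \<inter> {x. f x = 0}"
  have subK: "vec.subspace ?K"
    by (intro vec.subspace_inter W) (use vec.linear_subspace_kernel[OF f] in simp)
  obtain s where s: "s ` UNIV \<subseteq> W" "Vector_Spaces.linear (*s) (*s) s" "\<forall>v\<in>f ` W. f (s v) = v"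
    using vec.linear_exists_right_inverse_on[OF f W] by blast
  define X where "X = s ` (f ` W)"
  have subX: "vec.subspace X" unfolding X_def by (intro vec.linear_subspace_image s f W)
  have XW: "X \<subseteq> W" using s(1) unfolding X_def by auto
  have 0: "x = 0" if "x \<in> X" "f x = 0" for x
    using that s vec.linear_0[OF s(2)] unfolding X_def by auto
  have sfX: "s (f x) = x" if "x \<in> X" for x using that s unfolding X_def by auto
  have "inj_on f X" by (rule inj_on_inverseI[of _ s]) (rule sfX)
  then have "vec.dim (f ` X) = vec.dim X"
    using subX by (intro vec.dim_image_eq f) (simp add: vec.span_eq_iff[THEN iffD2])
  moreover have "f ` X = f ` W"
    unfolding X_def image_image using s(3) by (intro image_cong) auto
  moreover have "{x + y | x y. x \<in> X \<and> y \<in> ?K} = W"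
  proof (intro subset_antisym subsetI)
    fix w assume w: "w \<in> W"
    have "s (f w) \<in> X" using w by (simp add: X_def)
    moreover have "w - s (f w) \<in> ?K"
      using w s XW calculation by (auto simp: vec.linear_diff[OF f] intro: vec.subspace_diff[OF W])
    ultimately show "w \<in> {x + y | x y. x \<in> X \<and> y \<in> ?K}"
      by (intro CollectI exI[of _ "s (f w)"] exI[of _ "w - s (f w)"]) auto
  next
    fix w assume "w \<in> {x + y | x y. x \<in> X \<and> y \<in> ?K}"
    then obtain x y where "x \<in> X" "y \<in> ?K" "w = x + y" by blast
    then show "w \<in> W" using XW vec.subspace_add[OF W, of x y] by auto
  qed
  moreover have "X \<inter> ?K = {0}"
    using 0 vec.subspace_0[OF subX] vec.subspace_0[OF subK] by blast
  ultimately show ?thesis using vec.dim_sums_Int[OF subX subK] by simp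
qed

section \<open>Block numbers from the dimensions of T^k W\<close>

context symplectic_isometry
begin

text \<open>At the start of a block the basis vector is an eigenvector of \<open>T\<close>, and
  nilpotency forces the eigenvalue 0 there. The eigenvalue is constant along a block, so the claim
  passes to later positions.\<close>

lemma jordan_eigenvalue_one:
  assumes eq: "\<And>j. j < length ws \<Longrightarrow> g (ws ! j) =
          block_eigenvalue n_as j *s ws ! j + (if block_pos n_as j = 0 then 0 else ws ! (j - 1))"
    and ind: "vec.independent (set ws)" and nil: "\<And>w. w \<in> set ws \<Longrightarrow> (T ^^ N) w = 0"
    and j: "j < length ws"
  shows "block_eigenvalue n_as j = 1"
  using j
proof (induction j rule: less_induct)
  case (less j)
  show ?case
  proof (cases "block_pos n_as j = 0")
    case True
    define c where "c = block_eigenvalue n_as j - 1"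
    have "T (ws ! j) = c *s ws ! j"
      using eq[OF less.prems] True by (simp add: minus_id_def c_def vec.scale_left_diff_distrib)
    then have "(T ^^ k) (ws ! j) = c ^ k *s ws ! j" for k
      by (induction k) (simp_all add: vec.linear_scale[OF T_linear] mult.commute)
    then have "c ^ N *s ws ! j = 0" using nil less.prems by (metis nth_mem)
    moreover have "ws ! j \<noteq> 0" using ind less.prems vec.dependent_zero nth_mem by metis
    ultimately show ?thesis by (simp add: c_def)
  next
    case False
    then have "j - 1 < j" using block_pos_le[of n_as j] by auto
    then show ?thesis
      using less.IH[of "j - 1"] less.prems block_eigenvalue_pred[OF False] by simp
  qed
qed

text \<open>T^k lowers positions by k inside each block and kills the positions below k. The
  surviving basis vectors go to distinct basis vectors, hence stay independent.\<close>

lemma dim_T_power_image: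
  assumes jf: "has_jordan_form_on g W n_as" and nil: "\<And>w. w \<in> W \<Longrightarrow> (T ^^ N) w = 0"
  shows "vec.dim ((T ^^ k) ` W) = card {j. j < jordan_dim n_as \<and> k \<le> block_pos n_as j}"
proof -
  obtain ws where ws: "length ws = jordan_dim n_as" "distinct ws" "vec.independent (set ws)"
    "vec.span (set ws) = W" "\<And>j. j < length ws \<Longrightarrow> g (ws ! j) =
          block_eigenvalue n_as j *s ws ! j + (if block_pos n_as j = 0 then 0 else ws ! (j - 1))"
    using jf unfolding has_jordan_form_on_iff by blast
  have nil': "(T ^^ N) w = 0" if "w \<in> set ws" for w
    using nil that ws(4) vec.span_base by blast
  have ev: "block_eigenvalue n_as j = 1" if "j < length ws" for j
    by (rule jordan_eigenvalue_one[of ws n_as N]) (use ws nil' that in auto)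
  have Tws: "T (ws ! j) = (if block_pos n_as j = 0 then 0 else ws ! (j - 1))" if "j < length ws" for j
    using ws(5)[OF that] ev[OF that] by (simp add: minus_id_def)
  have Tk: "(T ^^ k) (ws ! j) = (if block_pos n_as j < k then 0 else ws ! (j - k))" if "j < length ws" for j k
    using that
  proof (induction k arbitrary: j)
    case (Suc k)
    have "(T ^^ Suc k) (ws ! j) = (T ^^ k) (T (ws ! j))" by (simp add: funpow_swap1)
    also have "\<dots> = (if block_pos n_as j < Suc k then 0 else ws ! (j - Suc k))"
      using Suc.IH[of "j - 1"] Suc.prems block_pos_pred[of n_as j] block_pos_le[of n_as j]
      by (auto simp: Tws vec.linear_0[OF T_power_linear])
    finally show ?case .
  qed simp
  define P where "P = {j. j < jordan_dim n_as \<and> k \<le> block_pos n_as j}"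
  have inj: "inj_on (\<lambda>j. ws ! (j - k)) P"
  proof (rule inj_onI)
    fix i j assume ij: "i \<in> P" "j \<in> P" "ws ! (i - k) = ws ! (j - k)"
    then have "k \<le> i" "k \<le> j" using block_pos_le[of n_as] unfolding P_def by (auto intro: order_trans)
    moreover have "i - k = j - k"
      using ij ws(1,2) by (subst (asm) nth_eq_iff_index_eq) (auto simp: P_def)
    ultimately show "i = j" by simp
  qed
  have sub: "(\<lambda>j. ws ! (j - k)) ` P \<subseteq> set ws" using ws(1) by (auto simp: P_def)
  have "(T ^^ k) ` W = vec.span ((T ^^ k) ` set ws)"
    using vec.linear_span_image[OF T_power_linear] ws(4) by simp
  moreover have "(T ^^ k) ` set ws - {0} = (\<lambda>j. ws ! (j - k)) ` P - {0}"
  proof (intro subset_antisym subsetI)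
    fix x assume x: "x \<in> (T ^^ k) ` set ws - {0}"
    then obtain j where "j < length ws" "x = (T ^^ k) (ws ! j)" by (auto simp: in_set_conv_nth)
    then show "x \<in> (\<lambda>j. ws ! (j - k)) ` P - {0}"
      using x ws(1) by (auto simp: Tk P_def split: if_splits)
  next
    fix x assume x: "x \<in> (\<lambda>j. ws ! (j - k)) ` P - {0}"
    then obtain j where j: "j < length ws" "k \<le> block_pos n_as j" "x = ws ! (j - k)"
      using ws(1) by (auto simp: P_def)
    then have "x = (T ^^ k) (ws ! j)" by (simp add: Tk)
    then show "x \<in> (T ^^ k) ` set ws - {0}" using x j by auto
  qed
  then have "vec.span ((T ^^ k) ` set ws) = vec.span ((\<lambda>j. ws ! (j - k)) ` P)"
    by (metis vec.span_delete_0)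
  ultimately have "vec.dim ((T ^^ k) ` W) = card ((\<lambda>j. ws ! (j - k)) ` P)"
    using vec.independent_mono[OF ws(3) sub] by (simp add: vec.dim_eq_card_independent)
  then show ?thesis using inj by (simp add: card_image P_def)
qed

lemma number_of_larger_blocks:
  assumes jf: "has_jordan_form_on g W n_as" and nil: "\<And>w. w \<in> W \<Longrightarrow> (T ^^ N) w = 0"
  shows "vec.dim ((T ^^ k) ` W) = vec.dim ((T ^^ Suc k) ` W) + length (filter (\<lambda>p. k < fst p) n_as)"
proof -
  have eq: "{j. j < jordan_dim n_as \<and> k \<le> block_pos n_as j} =
     {j. j < jordan_dim n_as \<and> Suc k \<le> block_pos n_as j} \<union> {j. j < jordan_dim n_as \<and> block_pos n_as j = k}"
    by auto
  have "card {j. j < jordan_dim n_as \<and> k \<le> block_pos n_as j} =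
     card {j. j < jordan_dim n_as \<and> Suc k \<le> block_pos n_as j} + card {j. j < jordan_dim n_as \<and> block_pos n_as j = k}"
    by (subst eq, intro card_Un_disjoint) auto
  then show ?thesis by (simp only: dim_T_power_image[OF jf nil] card_block_pos)
qed

text \<open>Makes the definite description in \<open>num_jordan_blocks\<close> usable. The drop in
  dimension from T^k W to T^(k+1) W counts the blocks larger than k in any Jordan form, and
  differences of these counts give the number of blocks of each exact size.\<close>

lemma num_jordan_blocks_eq:
  assumes jf: "has_jordan_form_on g W n_as" and nil: "\<And>w. w \<in> W \<Longrightarrow> (T ^^ N) w = 0"
  shows "num_jordan_blocks g W i = length (filter (\<lambda>p. fst p = i) n_as)"
proof -
  have split: "length (filter (\<lambda>p. l < fst p) n_as) =
      length (filter (\<lambda>p. fst p = Suc l) n_as) + length (filter (\<lambda>p. Suc l < fst p) n_as)"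
    for l and n_as :: "(nat \<times> 'a) list"
    by (induction n_as) auto
  have unique: "length (filter (\<lambda>p. fst p = i) n_as') = length (filter (\<lambda>p. fst p = i) n_as)"
    if jf': "has_jordan_form_on g W n_as'" for n_as'
  proof (cases i)
    case 0
    have "0 \<notin> fst ` set n_as" "0 \<notin> fst ` set n_as'"
      using jf jf' unfolding has_jordan_form_on_def by auto
    then show ?thesis using 0 by (auto simp: filter_empty_conv image_iff)
  next
    case (Suc l)
    have eq: "length (filter (\<lambda>p. k < fst p) n_as') = length (filter (\<lambda>p. k < fst p) n_as)" for k
      using number_of_larger_blocks[OF jf nil, of k] number_of_larger_blocks[OF jf' nil, of k] by simp
    then show ?thesis using split[of l n_as] split[of l n_as'] Suc eq[of l] eq[of "Suc l"] by simp
  qed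
  show ?thesis
    unfolding num_jordan_blocks_def
  proof (rule the_equality)
    show "\<exists>n_as'. has_jordan_form_on g W n_as' \<and>
        length (filter (\<lambda>p. fst p = i) n_as) = length (filter (\<lambda>p. fst p = i) n_as')"
      using jf by blast
  qed (elim exE conjE, simp only: unique)
qed

text \<open>For the last claim, T W lies in the kernel of T^(i-1) on \<open>W\<close>, and both
  spaces have dimension dim W - a, since T^(i-1) W has dimension \<open>a\<close>.\<close>

lemma homogeneous_block:
  assumes jf: "has_jordan_form_on g W (replicate a (i, 1))" and nil: "\<And>w. w \<in> W \<Longrightarrow> (T ^^ N) w = 0"
    and i: "i > 0" and inv: "invariant_subspace W"
  shows "vec.dim W = vec.dim (T ` W) + a"
    "\<And>w. w \<in> W \<Longrightarrow> (T ^^ i) w = 0"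
    "\<And>w. w \<in> W \<Longrightarrow> (T ^^ (i - 1)) w = 0 \<Longrightarrow> w \<in> T ` W"
proof -
  note W = invariant_subspaceD[OF inv]
  have step: "vec.dim ((T ^^ k) ` W) = vec.dim ((T ^^ Suc k) ` W) + (if k < i then a else 0)" for k
    using number_of_larger_blocks[OF jf nil, of k] by simp
  show dim: "vec.dim W = vec.dim (T ` W) + a" using step[of 0] i by simp
  \<comment> \<open>The dimension is constant from exponent i on, and it is 0 at exponent i +
    N.\<close>
  have "vec.dim ((T ^^ (i + l)) ` W) = vec.dim ((T ^^ i) ` W)" for l
    by (induction l) (use step in auto)
  from this[of N] have "vec.dim ((T ^^ i) ` W) = vec.dim ((T ^^ (i + N)) ` W)" by simp
  also have "(T ^^ (i + N)) ` W \<subseteq> {0}"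
    using nil T_power_zero_mono[of N _ "i + N"] by auto
  then have "vec.dim ((T ^^ (i + N)) ` W) = 0" by (simp add: vec.dim_eq_0)
  finally have Ti: "(T ^^ i) ` W \<subseteq> {0}" by (simp add: vec.dim_eq_0)
  then show "\<And>w. w \<in> W \<Longrightarrow> (T ^^ i) w = 0" by auto
  let ?K = "W \<inter> {x. (T ^^ (i - 1)) x = 0}"
  have "vec.dim ((T ^^ i) ` W) = 0" using Ti by (simp add: vec.dim_eq_0)
  then have "vec.dim ((T ^^ (i - 1)) ` W) = a" using step[of "i - 1"] i by simp
  then have "vec.dim ?K = vec.dim (T ` W)"
    using rank_nullity_on[OF T_power_linear W(1), of "i - 1"] dim by simp
  moreover have "T ` W \<subseteq> ?K"
  proof
    fix y assume "y \<in> T ` W"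
    then obtain x where x: "x \<in> W" "y = T x" by auto
    then have "(T ^^ (i - 1)) y = (T ^^ i) x" using i by (cases i) (simp_all add: funpow_swap1)
    then show "y \<in> ?K" using x W(2) Ti by auto
  qed
  moreover have "vec.subspace ?K"
    by (intro vec.subspace_inter W) (use vec.linear_subspace_kernel[OF T_power_linear] in simp)
  moreover have "vec.subspace (T ` W)" by (intro vec.linear_subspace_image T_linear W)
  ultimately have "T ` W = ?K" by (intro vec.subspace_dim_equal) auto
  then show "\<And>w. w \<in> W \<Longrightarrow> (T ^^ (i - 1)) w = 0 \<Longrightarrow> w \<in> T ` W" by blast
qed

section \<open>Jordan bases from chains\<close>

lemma chain_independent:
  assumes "(T ^^ i) x = 0" "i > 0 \<Longrightarrow> (T ^^ (i - 1)) x \<noteq> 0"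
  shows "vec.independent ((\<lambda>k. (T ^^ k) x) ` {..<i}) \<and> inj_on (\<lambda>k. (T ^^ k) x) {..<i}"
  using assms
proof (induction i arbitrary: x)
  case (Suc i)
  let ?S = "(\<lambda>k. (T ^^ k) (T x)) ` {..<i}"
  have S: "?S = (\<lambda>k. (T ^^ k) x) ` Suc ` {..<i}"
    by (simp add: image_image funpow_swap1)
  have IH: "vec.independent ?S" "inj_on (\<lambda>k. (T ^^ k) (T x)) {..<i}"
    using Suc.IH[of "T x"] Suc.prems by (cases i; simp add: funpow_swap1)+
  \<comment> \<open>The chain of T x spans a subspace of ker T^i, whereas T^i x is nonzero; so x
    lies outside that span and can be added to the chain.\<close>
  have Ti: "(T ^^ i) y = 0" if "y \<in> vec.span ?S" for y
    using that
  proof (induction rule: vec.span_induct)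
    case base
    show ?case using vec.linear_subspace_kernel[OF T_power_linear] by simp
  next
    case (step y)
    then obtain k where "y = (T ^^ k) (T x)" by auto
    then have "(T ^^ i) y = (T ^^ k) ((T ^^ Suc i) x)"
      by (simp add: T_power_add funpow_swap1 add.commute)
    then show ?case using Suc.prems by (simp add: vec.linear_0[OF T_power_linear])
  qed
  then have x: "x \<notin> vec.span ?S" using Suc.prems by auto
  have "(\<lambda>k. (T ^^ k) x) ` {..<Suc i} = insert x ?S"
    unfolding S lessThan_Suc_eq_insert_0 by simp
  moreover have "x \<notin> ?S" by (rule contra_subsetD[OF vec.span_superset x])
  then have "card (insert x ?S) = Suc i"
    using IH(2) by (subst card_insert_disjoint) (simp_all add: card_image)
  ultimately show ?case
    using vec.independent_insertI[OF x IH(1)] by (auto intro: eq_card_imp_inj_on)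
qed (simp add: vec.independent_empty)

lemma cyclic_mono: "X \<subseteq> Y \<Longrightarrow> cyclic i X \<subseteq> cyclic i Y"
  unfolding cyclic_def by blast

lemma jordan_form_chain:
  assumes x: "(T ^^ i) x = 0" "(T ^^ (i - 1)) x \<noteq> 0" and i: "i > 0"
  shows "has_jordan_form_on g (cyclic i (vec.span {x})) [(i, 1)]"
proof -
  \<comment> \<open>\<open>jordan_matrix\<close> has its ones above the diagonal, so
    \<open>T\<close> must send each basis vector to its predecessor: the chain is listed from the
    highest power of \<open>T\<close> down to x.\<close>
  define ws where "ws = map (\<lambda>k. (T ^^ (i - 1 - k)) x) [0..<i]"
  have len: "length ws = i" by (simp add: ws_def)
  have set: "set ws = (\<lambda>k. (T ^^ k) x) ` {..<i}"
  proof (intro subset_antisym subsetI)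
    fix y assume "y \<in> (\<lambda>k. (T ^^ k) x) ` {..<i}"
    then obtain k where "k < i" "y = (T ^^ k) x" by auto
    then show "y \<in> set ws"
      unfolding ws_def by (auto intro!: image_eqI[of _ _ "i - 1 - k"])
  qed (auto simp: ws_def)
  have ind: "vec.independent (set ws)" "card (set ws) = i"
    using chain_independent[of i x] x unfolding set by (auto simp: card_image)
  then have "distinct ws" using len by (simp add: card_distinct)
  moreover have "vec.span (set ws) = cyclic i (vec.span {x})"
  proof (intro subset_antisym vec.span_minimal subspace_cyclic vec.subspace_span subsetI)
    fix y assume "y \<in> set ws"
    then obtain k where "k < i" "y = (T ^^ k) x" unfolding set by auto
    then show "y \<in> cyclic i (vec.span {x})"
      by (auto intro!: T_power_in_cyclic vec.span_base)
  next
    fix y assume "y \<in> cyclic i (vec.span {x})"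
    then obtain f where f: "y = (\<Sum>k<i. (T ^^ k) (f k))" "\<And>k. k < i \<Longrightarrow> f k \<in> vec.span {x}"
      by (elim cyclicE) blast
    have "(T ^^ k) (f k) \<in> vec.span (set ws)" if k: "k < i" for k
    proof -
      obtain c where "f k = c *s x" using f(2)[OF k] by (auto simp: vec.span_singleton)
      moreover have "(T ^^ k) x \<in> set ws" using k by (simp add: set)
      ultimately show ?thesis
        by (simp add: vec.linear_scale[OF T_power_linear] vec.span_base vec.span_scale)
    qed
    then show "y \<in> vec.span (set ws)" unfolding f(1) by (intro vec.span_sum) auto
  qed
  moreover have "g (ws ! j) = block_eigenvalue [(i, 1)] j *s ws ! j +
      (if block_pos [(i, 1 :: 'a)] j = 0 then 0 else ws ! (j - 1))" if "j < length ws" for j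
  proof -
    have "T (ws ! j) = (T ^^ Suc (i - 1 - j)) x" using that by (simp add: ws_def)
    also have "Suc (i - 1 - j) = i - j" using that len by simp
    finally have "T (ws ! j) = (if j = 0 then 0 else ws ! (j - 1))"
      using that x(1) by (auto simp: ws_def)
    then show ?thesis using that len by (simp add: g_eq)
  qed
  ultimately show ?thesis
    unfolding has_jordan_form_on_iff using i len ind(1) by (auto intro!: exI[of _ ws])
qed

lemma jordan_form_zero: "has_jordan_form_on g {0} []"
  unfolding has_jordan_form_on_iff by (auto simp: vec.independent_empty)

text \<open>Each basis vector contributes one chain. A nonzero common vector of the modules of
  \<open>x\<close> and of the rest could be pushed to ker T, where it is T^(i-1) y = T^(i-1) z with
  y a multiple of x and z in the span of \<open>b\<close>; injectivity of T^(i-1) gives y = z, hence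
  both are 0.\<close>

lemma jordan_form_cyclic_span:
  assumes "finite b" "vec.independent b" "\<And>x. x \<in> vec.span b \<Longrightarrow> (T ^^ i) x = 0"
    "\<And>x. x \<in> vec.span b \<Longrightarrow> (T ^^ (i - 1)) x = 0 \<Longrightarrow> x = 0" and i: "i > 0"
  shows "has_jordan_form_on g (cyclic i (vec.span b)) (replicate (card b) (i, 1))"
  using assms(1-4)
proof (induction b)
  case empty
  have "cyclic i {0} = {0}"
  proof (intro subset_antisym subsetI)
    fix v assume "v \<in> cyclic i {0}"
    then obtain f where "v = (\<Sum>k<i. (T ^^ k) (f k))" "\<And>k. k < i \<Longrightarrow> f k \<in> {0}"
      by (elim cyclicE) blast
    then show "v \<in> {0}" by (simp add: vec.linear_0[OF T_power_linear])
  qed (use vec.subspace_0[OF subspace_cyclic[OF vec.subspace_single_0]] in auto)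
  then show ?case using jordan_form_zero by simp
next
  case (insert x b)
  let ?x = "vec.span {x}" and ?b = "vec.span b"
  have span: "vec.span (insert x b) = {y + z | y z. y \<in> ?x \<and> z \<in> ?b}"
    using vec.span_Un[of "{x}" b] by simp
  have sub: "?x \<subseteq> vec.span (insert x b)" "?b \<subseteq> vec.span (insert x b)"
    by (auto intro: vec.span_mono[THEN subsetD])
  have indep: "vec.independent b" "x \<notin> ?b"
    using insert by (auto simp: vec.independent_insert)
  have x: "(T ^^ i) x = 0" "(T ^^ (i - 1)) x \<noteq> 0"
    using insert.prems(2)[of x] insert.prems(3)[of x] insert.prems(1) vec.dependent_zero
    by (auto intro: vec.span_base)
  have disj: "cyclic i ?x \<inter> cyclic i ?b \<subseteq> {0}"
  proof (intro subsetI; rule ccontr)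
    fix v assume v: "v \<in> cyclic i ?x \<inter> cyclic i ?b" "v \<notin> {0}"
    have inv: "invariant_subspace (cyclic i ?x)" "invariant_subspace (cyclic i ?b)"
      using insert.prems(2) sub by (auto intro!: invariant_cyclic)
    have "(T ^^ i) v = 0" by (rule T_power_cyclic_zero[of ?x]) (use v sub insert.prems(2) in auto)
    then obtain r where r: "T ((T ^^ r) v) = 0" "(T ^^ r) v \<noteq> 0"
      using lowest_power[of i v] v by blast
    have "(T ^^ r) v \<in> cyclic i ?x" "(T ^^ r) v \<in> cyclic i ?b"
      using v invariant_subspaceD(3)[OF inv(1)] invariant_subspaceD(3)[OF inv(2)] by auto
    moreover obtain y where y: "y \<in> ?x" "(T ^^ r) v = (T ^^ (i - 1)) y"
      by (rule kernel_cyclic[OF vec.subspace_span _ _ calculation(1) r(1)])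
        (use insert.prems sub in blast)+
    moreover obtain z where z: "z \<in> ?b" "(T ^^ r) v = (T ^^ (i - 1)) z"
      by (rule kernel_cyclic[OF vec.subspace_span _ _ calculation(2) r(1)])
        (use insert.prems sub in blast)+
    ultimately have "(T ^^ (i - 1)) (y - z) = 0" by (simp add: vec.linear_diff[OF T_power_linear])
    then have "y = z"
      using insert.prems(3)[of "y - z"] sub y(1) z(1) vec.span_diff[of y "insert x b" z] by auto
    moreover obtain c where c: "y = c *s x" using y(1) by (auto simp: vec.span_singleton)
    ultimately have "c *s x \<in> ?b" using z by simp
    then have "c = 0" using indep(2) vec.span_scale[of "c *s x" b "inverse c"] by (cases "c = 0") auto
    then show False using r y c by (simp add: vec.linear_0[OF T_power_linear])
  qed
  have "cyclic i (vec.span (insert x b)) = {v + w | v w. v \<in> cyclic i ?x \<and> w \<in> cyclic i ?b}"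
  proof (intro subset_antisym subsetI)
    fix v assume "v \<in> cyclic i (vec.span (insert x b))"
    then obtain f where f: "v = (\<Sum>k<i. (T ^^ k) (f k))" "\<And>k. k < i \<Longrightarrow> f k \<in> vec.span (insert x b)"
      by (elim cyclicE) blast
    then have "\<forall>k. \<exists>y z. k < i \<longrightarrow> y \<in> ?x \<and> z \<in> ?b \<and> f k = y + z" unfolding span by blast
    then obtain p q where pq: "\<And>k. k < i \<Longrightarrow> p k \<in> ?x \<and> q k \<in> ?b \<and> f k = p k + q k" by metis
    then have "v = (\<Sum>k<i. (T ^^ k) (p k)) + (\<Sum>k<i. (T ^^ k) (q k))"
      unfolding f(1) by (simp add: vec.linear_add[OF T_power_linear] sum.distrib)
    moreover have "(\<Sum>k<i. (T ^^ k) (p k)) \<in> cyclic i ?x" "(\<Sum>k<i. (T ^^ k) (q k)) \<in> cyclic i ?b"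
      using pq by (auto intro!: cyclicI)
    ultimately show "v \<in> {v + w | v w. v \<in> cyclic i ?x \<and> w \<in> cyclic i ?b}" by blast
  next
    fix v assume "v \<in> {v + w | v w. v \<in> cyclic i ?x \<and> w \<in> cyclic i ?b}"
    then obtain y z where "v = y + z" "y \<in> cyclic i ?x" "z \<in> cyclic i ?b" by blast
    then show "v \<in> cyclic i (vec.span (insert x b))"
      using cyclic_mono[OF sub(1)] cyclic_mono[OF sub(2)]
      by (auto intro!: vec.subspace_add subspace_cyclic)
  qed
  moreover have "has_jordan_form_on g (cyclic i ?b) (replicate (card b) (i, 1))"
    using insert.IH indep insert.prems sub by blast
  ultimately show ?case
    using has_jordan_form_on_append[OF jordan_form_chain[OF x i] _ disj] insert.hyps by simp
qed

lemma jordan_form_generated_freely: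
  assumes X: "generates_freely i X" and i: "i > 0"
  shows "\<exists>a. has_jordan_form_on g (cyclic i X) (replicate a (i, 1))"
proof -
  obtain b where b: "b \<subseteq> X" "vec.independent b" "X \<subseteq> vec.span b"
    by (metis vec.basis_exists)
  have "vec.span b = X"
    using b X unfolding generates_freely_def by (intro subset_antisym vec.span_minimal) auto
  then show ?thesis
    using jordan_form_cyclic_span[of b i] b(2) i X unfolding generates_freely_def
    by (auto simp: vec.finiteI_independent)
qed

lemma jordan_form_direct_sum:
  assumes "is_direct_sum {1..N} W U"
    "\<And>j. j \<in> {1..N} \<Longrightarrow> has_jordan_form_on g (W j) (replicate (m j) (j, 1))"
  shows "has_jordan_form_on g U (concat (map (\<lambda>j. replicate (m j) (j, 1)) [1..<Suc N]))"
  using assms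
proof (induction N arbitrary: U)
  case 0
  then have "U = {0}" by (auto simp: is_direct_sum_def bij_betw_def)
  then show ?case using jordan_form_zero by simp
next
  case (Suc N)
  note d = Suc.prems(1) note fin = finite_atLeastAtMost[of 1 "Suc N"]
  define U' where "U' = {u. \<exists>w. (\<forall>i\<in>{1..N}. w i \<in> W i) \<and> u = (\<Sum>i\<in>{1..N}. w i)}"
  have zero: "\<forall>i\<in>{1..Suc N}. w i = 0"
    if "\<forall>i\<in>{1..Suc N}. w i \<in> W i" "(\<Sum>i=1..Suc N. w i) = 0" for w
    using direct_sum_zero[OF d fin, of w] that by blast
  have sub: "vec.subspace (W i)" if "i \<in> {1..Suc N}" for i
    using direct_sum_subspace[OF d fin that] .
  have d': "is_direct_sum {1..N} W U'"
    unfolding is_direct_sum_iff[OF finite_atLeastAtMost]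
  proof (intro conjI allI ballI impI)
    fix w i assume w: "\<forall>i\<in>{1..N}. w i \<in> W i" "(\<Sum>i=1..N. w i) = 0" "i \<in> {1..N}"
    define w' where "w' = w(Suc N := 0)"
    have "(\<Sum>i=1..N. w' i) = (\<Sum>i=1..N. w i)" by (intro sum.cong) (auto simp: w'_def)
    then have "(\<Sum>i=1..Suc N. w' i) = 0" using w by (simp add: w'_def)
    moreover have "\<forall>i\<in>{1..Suc N}. w' i \<in> W i"
      using w sub vec.subspace_0 by (auto simp: w'_def le_Suc_eq)
    ultimately have "\<forall>i\<in>{1..Suc N}. w' i = 0" by (intro zero)
    then have "w' i = 0" using w(3) by simp
    then show "w i = 0" using w(3) by (simp add: w'_def)
  qed (use sub in \<open>auto simp: U'_def\<close>)
  have disj: "U' \<inter> W (Suc N) \<subseteq> {0}"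
  proof
    fix u assume u: "u \<in> U' \<inter> W (Suc N)"
    then obtain w where w: "\<forall>i\<in>{1..N}. w i \<in> W i" "u = (\<Sum>i\<in>{1..N}. w i)" unfolding U'_def by blast
    define w' where "w' = w(Suc N := - u)"
    have "(\<Sum>i=1..N. w' i) = (\<Sum>i=1..N. w i)" by (intro sum.cong) (auto simp: w'_def)
    then have "(\<Sum>i=1..Suc N. w' i) = 0" using w by (simp add: w'_def)
    moreover have "\<forall>i\<in>{1..Suc N}. w' i \<in> W i"
      using w u sub by (auto simp: w'_def le_Suc_eq intro: vec.subspace_neg)
    ultimately have "\<forall>i\<in>{1..Suc N}. w' i = 0" by (intro zero)
    then have "w' (Suc N) = 0" by simp
    then show "u \<in> {0}" by (simp add: w'_def)
  qed
  have U: "U = {x + y | x y. x \<in> U' \<and> y \<in> W (Suc N)}"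
  proof (intro subset_antisym subsetI)
    fix u assume "u \<in> U"
    then obtain w where w: "\<And>i. i \<in> {1..Suc N} \<Longrightarrow> w i \<in> W i" "u = (\<Sum>i\<in>{1..Suc N}. w i)"
      by (elim direct_sumE[OF d fin]) blast
    then have "u = (\<Sum>i\<in>{1..N}. w i) + w (Suc N)" "w (Suc N) \<in> W (Suc N)" "\<forall>i\<in>{1..N}. w i \<in> W i" by auto
    then show "u \<in> {x + y | x y. x \<in> U' \<and> y \<in> W (Suc N)}" unfolding U'_def by blast
  next
    fix u assume "u \<in> {x + y | x y. x \<in> U' \<and> y \<in> W (Suc N)}"
    then obtain w y where w: "\<forall>i\<in>{1..N}. w i \<in> W i" "u = (\<Sum>i\<in>{1..N}. w i) + y" "y \<in> W (Suc N)"
      unfolding U'_def by blast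
    define w' where "w' = w(Suc N := y)"
    have "(\<Sum>i=1..N. w' i) = (\<Sum>i=1..N. w i)" by (intro sum.cong) (auto simp: w'_def)
    then have "u = (\<Sum>i=1..Suc N. w' i)" using w by (simp add: w'_def)
    moreover have "\<forall>i\<in>{1..Suc N}. w' i \<in> W i" using w by (auto simp: w'_def le_Suc_eq)
    ultimately show "u \<in> U" using direct_sumI[OF d fin, of w'] by simp
  qed
  have "has_jordan_form_on g U' (concat (map (\<lambda>j. replicate (m j) (j, 1)) [1..<Suc N]))"
    by (rule Suc.IH[OF d']) (use Suc.prems(2) in auto)
  from has_jordan_form_on_append[OF this Suc.prems(2) disj]
  show ?case by (simp add: U)
qed

lemma num_jordan_blocks_direct_sum:
  assumes d: "is_direct_sum {1..N} W U"
    "\<And>j. j \<in> {1..N} \<Longrightarrow> has_jordan_form_on g (W j) (replicate (m j) (j, 1))"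
    and nil: "\<And>u. u \<in> U \<Longrightarrow> (T ^^ M) u = 0"
  shows "num_jordan_blocks g U i = (if i \<in> {1..N} then m i else 0)"
proof -
  have "num_jordan_blocks g U i =
      length (filter (\<lambda>p. fst p = i) (concat (map (\<lambda>j. replicate (m j) (j, 1 :: 'a)) [1..<Suc N])))"
    by (rule num_jordan_blocks_eq[OF jordan_form_direct_sum[OF d] nil])
  also have "\<dots> = (if i \<in> {1..N} then m i else 0)"
    by (induction N) (auto simp: le_Suc_eq)
  finally show ?thesis .
qed

text \<open>The second conclusion rests on existence too: the block numbers of \<open>V1\<close> are
  given by a definite description, which is evaluated through the Jordan form supplied by the
  summands.\<close>

theorem orthogonal_block_decomposition_exists:
  obtains W where "orthogonal_block_decomposition B g W"
    "\<And>i. i \<notin> {1..CARD('m)} \<Longrightarrow> num_jordan_blocks g V1 i = 0"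
proof -
  have nil: "(T ^^ CARD('m)) u = 0" if "u \<in> V1" for u using that by (simp add: gen_one_space_def)
  obtain X where X: "\<forall>j\<in>{1..CARD('m)}. generates_freely j (X j)"
    "is_direct_sum {1..CARD('m)} (\<lambda>j. cyclic j (X j)) V1"
    "\<forall>j\<in>{1..CARD('m)}. \<forall>k\<in>{1..CARD('m)}. j \<noteq> k \<longrightarrow>
      (\<forall>x\<in>cyclic j (X j). \<forall>y\<in>cyclic k (X k). B x y = 0)"
    using orthogonal_cyclic_decomposition[OF invariant_V1 nondegenerate_V1 nil] by blast
  have "\<forall>j. \<exists>a. j \<in> {1..CARD('m)} \<longrightarrow> has_jordan_form_on g (cyclic j (X j)) (replicate a (j, 1))"
  proof
    fix j
    show "\<exists>a. j \<in> {1..CARD('m)} \<longrightarrow> has_jordan_form_on g (cyclic j (X j)) (replicate a (j, 1))"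
      using jordan_form_generated_freely X(1) by (cases "j \<in> {1..CARD('m)}") auto
  qed
  then obtain m where m: "\<And>j. j \<in> {1..CARD('m)} \<Longrightarrow>
      has_jordan_form_on g (cyclic j (X j)) (replicate (m j) (j, 1))" by metis
  have n: "num_jordan_blocks g V1 i = (if i \<in> {1..CARD('m)} then m i else 0)" for i
    by (rule num_jordan_blocks_direct_sum[OF X(2)]) (use m nil in auto)
  have inv: "invariant_subspace (cyclic j (X j))" if "j \<in> {1..CARD('m)}" for j
    using X(1) that unfolding generates_freely_def by (intro invariant_cyclic) auto
  have "orthogonal_block_decomposition B g (\<lambda>j. cyclic j (X j))"
    unfolding orthogonal_block_decomposition_def
    using X(2,3) m n invariant_subspaceD(5)[OF inv] by simp
  moreover have "num_jordan_blocks g V1 i = 0" if "i \<notin> {1..CARD('m)}" for i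
    using n[of i] unfolding if_not_P[OF that] .
  ultimately show ?thesis using that by blast
qed

end

subsection \<open>Transitivity of the centralizer\<close>

lemma scale_two: "2 *s v = v + v" for v :: "'a::field^'m::finite"
  by (simp only: one_add_one[symmetric] vec.scale_left_distrib vec.scale_one)

context symplectic_isometry
begin

abbreviation centralizer_g :: "('a, 'm) vector_map set" where
  "centralizer_g \<equiv> centralizer (isometry_group B) g"

text \<open>Injectivity comes from nondegeneracy, bijectivity from the finiteness of V, and
  commuting with \<open>T\<close> amounts to commuting with \<open>g\<close>.\<close>

lemma centralizerI:
  assumes h: "Vector_Spaces.linear (*s) (*s) h" "\<And>x y. B (h x) (h y) = B x y" "\<And>x. h (T x) = T (h x)"
  shows "h \<in> centralizer_g"
proof -
  have "inj h"
  proof (rule injI)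
    fix x y assume "h x = h y"
    then have "h (x - y) = 0" by (simp add: vec.linear_diff[OF h(1)])
    then have "\<forall>z. B (x - y) z = 0" using h(2)[of "x - y"] by simp
    then have "x - y = 0" using nondegenerate unfolding nondegenerate_on_def by blast
    then show "x = y" by simp
  qed
  then have "bij h" by (simp add: bij_def finite_UNIV_inj_surj)
  moreover have "h \<circ> g = g \<circ> h"
    by (rule ext) (simp add: g_eq vec.linear_add[OF h(1)] h(3))
  ultimately show ?thesis
    using h(1,2) by (simp add: centralizer_def isometry_group_def)
qed

lemma centralizerD:
  assumes "h \<in> centralizer_g"
  shows "Vector_Spaces.linear (*s) (*s) h" "B (h x) (h y) = B x y" "h (g x) = g (h x)"
    "h (T x) = T (h x)" "h ((T ^^ k) x) = (T ^^ k) (h x)" "bij h"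
proof -
  show h: "Vector_Spaces.linear (*s) (*s) h" "B (h x) (h y) = B x y" "bij h"
    using assms by (auto simp: centralizer_def isometry_group_def)
  have "h \<circ> g = g \<circ> h" using assms by (simp add: centralizer_def isometry_group_def)
  then have hg: "h (g x) = g (h x)" for x by (simp add: fun_eq_iff)
  then show "h (g x) = g (h x)" .
  have hT: "h (T x) = T (h x)" for x by (simp add: minus_id_def vec.linear_diff[OF h(1)] hg)
  then show "h (T x) = T (h x)" .
  show "h ((T ^^ k) x) = (T ^^ k) (h x)" by (induction k) (simp_all add: hT)
qed

lemma subspace_range_T: "vec.subspace (range T)"
  by (intro vec.linear_subspace_image T_linear vec.subspace_UNIV)

lemma T_power_in_range: "k > 0 \<Longrightarrow> (T ^^ k) x \<in> range T"
  by (cases k) auto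

lemma centralizer_range_T: "h \<in> centralizer_g \<Longrightarrow> t \<in> range T \<Longrightarrow> h t \<in> range T"
  by (auto simp: centralizerD(4))

text \<open>The orbit relation on V / T V in terms of representatives; it makes sense because the
  centralizer preserves T V.\<close>

definition same_orbit :: "'a^'m \<Rightarrow> 'a^'m \<Rightarrow> bool" where
  "same_orbit x y \<longleftrightarrow> (\<exists>h\<in>centralizer_g. h x - y \<in> range T)"

lemma centralizer_comp:
  assumes "h \<in> centralizer_g" "h' \<in> centralizer_g" shows "h \<circ> h' \<in> centralizer_g"
proof (rule centralizerI)
  show "Vector_Spaces.linear (*s) (*s) (h \<circ> h')"
    by (rule Vector_Spaces.linear_compose[OF centralizerD(1)[OF assms(2)] centralizerD(1)[OF assms(1)]])
qed (simp_all add: centralizerD[OF assms(1)] centralizerD[OF assms(2)])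

lemma same_orbit_trans:
  assumes "same_orbit x y" "same_orbit y z"
  shows "same_orbit x z"
proof -
  obtain h h' where h: "h \<in> centralizer_g" "h x - y \<in> range T" and h': "h' \<in> centralizer_g" "h' y - z \<in> range T"
    using assms unfolding same_orbit_def by blast
  have "(h' \<circ> h) x - z = h' (h x - y) + (h' y - z)"
    by (simp add: vec.linear_diff[OF centralizerD(1)[OF h'(1)]])
  also have "\<dots> \<in> range T"
    by (rule vec.subspace_add[OF subspace_range_T centralizer_range_T[OF h'(1) h(2)] h'(2)])
  finally show ?thesis
    unfolding same_orbit_def by (intro bexI[of _ "h' \<circ> h"] centralizer_comp h h')
qed

lemma range_T_half:
  assumes "2 *s v \<in> range T" shows "v \<in> range T"
proof -
  have "inverse 2 *s (2 *s v) \<in> range T" by (rule vec.subspace_scale[OF subspace_range_T assms])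
  then show ?thesis using two_nonzero by simp
qed

text \<open>The isometry -1 is central, so it may be composed with any element of the
  centralizer.\<close>

lemma same_orbit_minus:
  assumes "same_orbit x (- y)" shows "same_orbit x y"
proof -
  obtain h where h: "h \<in> centralizer_g" "h x - - y \<in> range T"
    using assms unfolding same_orbit_def by blast
  have "(\<lambda>v. - h v) \<in> centralizer_g"
    by (rule centralizerI)
      (simp_all add: vec.linear_compose_neg centralizerD[OF h(1)] B_simps vec.linear_neg[OF T_linear])
  moreover have "- h x - y = - (h x - - y)" by simp
  then have "- h x - y \<in> range T" using vec.subspace_neg[OF subspace_range_T h(2)] by simp
  ultimately show ?thesis unfolding same_orbit_def by (intro bexI[of _ "\<lambda>v. - h v"])
qed

text \<open>The map is 1 - 2 p with p the orthogonal projection onto \<open>U\<close>. Both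
  \<open>U\<close> and \<open>perp U\<close> are invariant, so uniqueness of the splitting makes p
  commute with \<open>T\<close>.\<close>

lemma reflection:
  assumes inv: "invariant_subspace U" and nd: "nondegenerate_on B U"
  obtains h where "h \<in> centralizer_g" "\<And>u. u \<in> U \<Longrightarrow> h u = - u" "\<And>q. q \<in> perp U \<Longrightarrow> h q = q"
proof -
  note U = invariant_subspaceD[OF inv] and P = invariant_subspaceD[OF invariant_perp[OF inv]]
  have "\<forall>v. \<exists>p. p \<in> U \<and> v - p \<in> perp U"
  proof
    fix v show "\<exists>p. p \<in> U \<and> v - p \<in> perp U" using orthogonal_projection[OF U(1) nd, of v] by blast
  qed
  then obtain p where p: "\<And>v. p v \<in> U" "\<And>v. v - p v \<in> perp U" by metis
  have unique: "p v = u" if "u \<in> U" "v - u \<in> perp U" for u v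
  proof -
    have "p v - u \<in> U" using that p by (intro vec.subspace_diff[OF U(1)])
    moreover have "p v - u = (v - u) - (v - p v)" by simp
    then have "p v - u \<in> perp U" using that p vec.subspace_diff[OF P(1)] by metis
    ultimately show ?thesis using nd by (auto simp: nondegenerate_on_iff)
  qed
  have p_add: "p (v + w) = p v + p w" for v w
  proof (rule unique)
    have "v + w - (p v + p w) = (v - p v) + (w - p w)" by simp
    then show "v + w - (p v + p w) \<in> perp U" using p vec.subspace_add[OF P(1)] by metis
  qed (intro vec.subspace_add[OF U(1)] p)
  have p_scale: "p (c *s v) = c *s p v" for c v
  proof (rule unique)
    have "c *s v - c *s p v = c *s (v - p v)" by (simp add: vec.scale_right_diff_distrib)
    then show "c *s v - c *s p v \<in> perp U" using p vec.subspace_scale[OF P(1)] by metis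
  qed (intro vec.subspace_scale[OF U(1)] p)
  have p_T: "p (T v) = T (p v)" for v
  proof (rule unique)
    have "T v - T (p v) = T (v - p v)" by (simp add: vec.linear_diff[OF T_linear])
    then show "T v - T (p v) \<in> perp U" using p P(2) by simp
  qed (intro U p)
  define h where "h v = v - 2 *s p v" for v
  have h_eq: "h v = (v - p v) - p v" for v
    unfolding h_def scale_two by (simp only: diff_diff_eq)
  have "h \<in> centralizer_g"
  proof (rule centralizerI)
    show "Vector_Spaces.linear (*s) (*s) h"
      unfolding Vector_Spaces.linear_iff h_def
      by (simp add: vec.vector_space_axioms p_add p_scale vec.scale_right_diff_distrib
          vec.scale_right_distrib vec.scale_left_commute)
    fix x y
    have o: "B (x - p x) (p y) = 0" "B (p x) (y - p y) = 0"
      using p[of x] p[of y] perp_sym unfolding perp_def by blast+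
    have "B (h x) (h y) = B (x - p x) (y - p y) + B (p x) (p y)"
      unfolding h_eq B_diff_left[of "x - p x"] B_diff_right[of _ "y - p y"] using o by simp
    also have "\<dots> = B ((x - p x) + p x) ((y - p y) + p y)"
      unfolding B_add_left[of "x - p x"] B_add_right[of _ "y - p y"] using o by simp
    finally show "B (h x) (h y) = B x y" by simp
    show "h (T x) = T (h x)" by (simp only: h_eq p_T vec.linear_diff[OF T_linear])
  qed
  moreover have "h u = - u" if "u \<in> U" for u
    using unique[OF that] vec.subspace_0[OF P(1)] by (simp add: h_eq)
  moreover have "h q = q" if "q \<in> perp U" for q
    using unique[OF vec.subspace_0[OF U(1)], of q] that by (simp add: h_eq)
  ultimately show ?thesis using that by blast
qed

section \<open>The forms b_i and even block sizes\<close>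

definition top_form :: "nat \<Rightarrow> 'a^'m \<Rightarrow> 'a^'m \<Rightarrow> 'a" where
  "top_form i x y = B x ((T ^^ (i - 1)) y)"

context
  fixes i :: nat
  assumes i_pos: "i > 0"
begin

abbreviation "kernel_i \<equiv> {x. (T ^^ i) x = 0}"

lemma top_form_swap: "y \<in> kernel_i \<Longrightarrow> top_form i y x = (-1) ^ i * top_form i x y"
  using B_top_symmetric[where k = "i - 1"] i_pos by (simp add: top_form_def)

lemma top_form_diff_right: "top_form i x (y - z) = top_form i x y - top_form i x z"
  and top_form_add_right: "top_form i x (y + z) = top_form i x y + top_form i x z"
  and top_form_scale_right: "top_form i x (c *s y) = c * top_form i x y"
  and top_form_minus_right: "top_form i x (- y) = - top_form i x y"
  and top_form_diff_left: "top_form i (y - z) x = top_form i y x - top_form i z x"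
  and top_form_add_left: "top_form i (y + z) x = top_form i y x + top_form i z x"
  and top_form_scale_left: "top_form i (c *s y) x = c * top_form i y x"
  and top_form_minus_left: "top_form i (- y) x = - top_form i y x"
  by (simp_all add: top_form_def vec.linear_diff[OF T_power_linear] vec.linear_add[OF T_power_linear]
      vec.linear_scale[OF T_power_linear] vec.linear_neg[OF T_power_linear] B_simps)

lemmas top_form_simps = top_form_diff_right top_form_add_right top_form_scale_right top_form_minus_right
  top_form_add_left top_form_scale_left top_form_minus_left top_form_diff_left

lemma subspace_kernel_i: "vec.subspace kernel_i"
  using vec.linear_subspace_kernel[OF T_power_linear] by simp

text \<open>The reflection in the module generated by \<open>u\<close> moves v by -2 p, where p is
  the projection of v. Pairing p with T^(i-1) u sees only its constant coefficient, a multiple of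
  \<open>u\<close>; if b_i(v, u) = 0, this coefficient vanishes and p lies in T V.\<close>

lemma reflection_mod_T:
  assumes u: "u \<in> kernel_i" "top_form i u u \<noteq> 0"
  obtains h where "h \<in> centralizer_g" "h u = - u" "\<And>v. top_form i v u = 0 \<Longrightarrow> h v - v \<in> range T"
proof -
  define U where "U = cyclic i (vec.span {u})"
  have ker: "(T ^^ i) x = 0" if "x \<in> vec.span {u}" for x
    using that u by (auto simp: vec.span_singleton vec.linear_scale[OF T_power_linear])
  have nd: "x = 0" if x: "x \<in> vec.span {u}" "\<And>y. y \<in> vec.span {u} \<Longrightarrow> top_form i x y = 0" for x
  proof -
    obtain c where c: "x = c *s u" using x(1) by (auto simp: vec.span_singleton)
    have "top_form i x u = 0" by (rule x(2)) (simp add: vec.span_base)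
    then show ?thesis using u(2) by (simp add: c top_form_simps)
  qed
  have inv: "invariant_subspace U" unfolding U_def by (rule invariant_cyclic[OF vec.subspace_span ker])
  have ndU: "nondegenerate_on B U"
    unfolding U_def by (rule nondegenerate_cyclic[OF vec.subspace_span ker i_pos nd[unfolded top_form_def]])
  obtain h where h: "h \<in> centralizer_g" "\<And>u. u \<in> U \<Longrightarrow> h u = - u" "\<And>q. q \<in> perp U \<Longrightarrow> h q = q"
    using reflection[OF inv ndU] by blast
  have Tu: "(T ^^ k) u \<in> U" if "k < i" for k
    unfolding U_def using that by (intro T_power_in_cyclic vec.subspace_span vec.span_base) auto
  have "h v - v \<in> range T" if v: "top_form i v u = 0" for v
  proof -
    obtain p where p: "p \<in> U" "v - p \<in> perp U"
      using orthogonal_projection[OF invariant_subspaceD(1)[OF inv] ndU] by blast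
    obtain f where f: "p = (\<Sum>k<i. (T ^^ k) (f k))" "\<And>k. k < i \<Longrightarrow> f k \<in> vec.span {u}"
      using p(1) unfolding U_def by (elim cyclicE) blast
    have split: "{..<i} = insert 0 {1..<i}" using i_pos by auto
    have p_eq: "p = f 0 + (\<Sum>k=1..<i. (T ^^ k) (f k))" unfolding f(1) split by simp
    have B0: "B ((T ^^ k) (f k)) ((T ^^ (i - 1)) u) = 0" if "k \<in> {1..<i}" for k
      using that u(1) i_pos by (intro B_T_pos_left_top) auto
    have "B (\<Sum>k=1..<i. (T ^^ k) (f k)) ((T ^^ (i - 1)) u) = 0"
      unfolding B_sum_left by (intro sum.neutral ballI B0)
    moreover have "top_form i p u = 0"
      using p(2) Tu[of "i - 1"] i_pos v by (simp add: perp_def top_form_def B_simps)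
    ultimately have "top_form i (f 0) u = 0" unfolding p_eq top_form_def B_add_left by simp
    moreover obtain c where c: "f 0 = c *s u" using f(2)[OF i_pos] by (auto simp: vec.span_singleton)
    ultimately have "f 0 = 0" using u(2) by (simp add: top_form_simps)
    then have "p \<in> range T"
      unfolding p_eq using T_power_in_range
      by (auto intro!: vec.subspace_sum[OF subspace_range_T])
    then have "- p - p \<in> range T"
      by (intro vec.subspace_diff[OF subspace_range_T] vec.subspace_neg[OF subspace_range_T])
    moreover have "h v = h (v - p) + h p" by (simp add: vec.linear_diff[OF centralizerD(1)[OF h(1)]])
    then have "h v - v = - p - p" using h(2)[OF p(1)] h(3)[OF p(2)] by simp
    ultimately show ?thesis by (simp only:)
  qed
  moreover have "h u = - u" using h(2) Tu[of 0] i_pos by simp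
  ultimately show ?thesis using that h(1) by blast
qed

text \<open>Equal values make x + y orthogonal to x - y under the symmetric form. The reflection
  negates x - y and fixes x + y modulo T V, so it takes 2 x to 2 y there.\<close>

lemma same_orbit_anisotropic_difference:
  assumes even: "even i" and x: "x \<in> kernel_i" and y: "y \<in> kernel_i"
    and eq: "top_form i x x = top_form i y y" and ne: "top_form i (x - y) (x - y) \<noteq> 0"
  shows "same_orbit x y"
proof -
  have "x - y \<in> kernel_i" by (rule vec.subspace_diff[OF subspace_kernel_i x y])
  then obtain h where h: "h \<in> centralizer_g" "h (x - y) = - (x - y)"
      "\<And>v. top_form i v (x - y) = 0 \<Longrightarrow> h v - v \<in> range T"
    using reflection_mod_T ne by metis
  note lin = centralizerD(1)[OF h(1)]
  have "top_form i y x = top_form i x y" using top_form_swap[OF y, of x] even by simp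
  then have "top_form i (x + y) (x - y) = 0" using eq by (simp add: top_form_simps)
  then have "h (x + y) - (x + y) \<in> range T" by (rule h(3))
  moreover have "h (x + y) - (x + y) = 2 *s (h x - y) - (h (x - y) + (x - y))"
    unfolding scale_two by (simp add: vec.linear_add[OF lin] vec.linear_diff[OF lin])
  ultimately have "2 *s (h x - y) \<in> range T" using h(2) by simp
  then show ?thesis unfolding same_orbit_def using h(1) range_T_half by blast
qed

text \<open>A vector space is not the union of two proper subspaces: one of v, w, v + w avoids
  both.\<close>

lemma common_nonorthogonal:
  assumes x: "\<exists>z\<in>kernel_i. top_form i z x \<noteq> 0" and y: "\<exists>z\<in>kernel_i. top_form i z y \<noteq> 0"
  shows "\<exists>z\<in>kernel_i. top_form i z x \<noteq> 0 \<and> top_form i z y \<noteq> 0"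
proof -
  obtain v w where v: "v \<in> kernel_i" "top_form i v x \<noteq> 0" and w: "w \<in> kernel_i" "top_form i w y \<noteq> 0"
    using x y by blast
  have "v + w \<in> kernel_i" by (rule vec.subspace_add[OF subspace_kernel_i v(1) w(1)])
  then show ?thesis
    using v w by (cases "top_form i v y = 0"; cases "top_form i w x = 0") (auto simp: top_form_add_left)
qed

theorem same_orbit_even:
  assumes even: "even i" and x: "x \<in> kernel_i" and y: "y \<in> kernel_i"
    and eq: "top_form i x x = top_form i y y"
    and nx: "\<exists>z\<in>kernel_i. top_form i z x \<noteq> 0" and ny: "\<exists>z\<in>kernel_i. top_form i z y \<noteq> 0"
  shows "same_orbit x y"
proof -
  have sym: "top_form i v w = top_form i w v" if "v \<in> kernel_i" for v w
    using top_form_swap[OF that, of w] even by simp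
  consider "top_form i (x - y) (x - y) \<noteq> 0" | "top_form i (x + y) (x + y) \<noteq> 0"
    | "top_form i (x - y) (x - y) = 0" "top_form i (x + y) (x + y) = 0" by blast
  then show ?thesis
  proof cases
    case 1
    then show ?thesis by (rule same_orbit_anisotropic_difference[OF even x y eq])
  next
    case 2
    have "same_orbit x (- y)"
      by (rule same_orbit_anisotropic_difference[OF even x])
        (use y eq 2 vec.subspace_neg[OF subspace_kernel_i y] in \<open>simp_all add: top_form_simps\<close>)
    then show ?thesis by (rule same_orbit_minus)
  next
    case 3
    \<comment> \<open>Here b_i(x, x) equals both b_i(x, y) and -b_i(x, y), so in odd characteristic
      x and y are isotropic and orthogonal to each other.\<close>
    have eqs: "2 * top_form i x x - 2 * top_form i x y = 0" "2 * top_form i x x + 2 * top_form i x y = 0"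
      using 3 sym[OF x, of y] eq by (simp_all add: top_form_simps add.commute)
    have ab: "top_form i x x = top_form i x y" using eqs(1) two_nonzero by simp
    have "2 * (2 * top_form i x y) = 0" using eqs(2) unfolding ab by simp
    then have "top_form i x y = 0" using two_nonzero by (simp only: mult_eq_0_iff) simp
    then have Q0: "top_form i x x = 0" "top_form i x y = 0" using ab by simp_all
    obtain z' where z': "z' \<in> kernel_i" "top_form i z' x \<noteq> 0" "top_form i z' y \<noteq> 0"
      using common_nonorthogonal[OF nx ny] by blast
    \<comment> \<open>b_i(z' - c x, z' - c x) = b_i(z', z') - 2 c b_i(z', x), and this
      \<open>c\<close> makes it 0. Subtracting a multiple of x does not change the products with x
      and y, which stay nonzero.\<close>
    define c where "c = top_form i z' z' / (2 * top_form i z' x)"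
    define z where "z = z' - c *s x"
    have z: "z \<in> kernel_i"
      unfolding z_def by (intro vec.subspace_diff[OF subspace_kernel_i] vec.subspace_scale[OF subspace_kernel_i] z' x)
    have zx: "top_form i z x = top_form i z' x" and zy: "top_form i z y = top_form i z' y"
      unfolding z_def using Q0 by (simp_all add: top_form_simps)
    have "top_form i z z = top_form i z' z' - c * (2 * top_form i z' x)"
      unfolding z_def using Q0 sym[OF x, of z'] by (simp add: top_form_simps)
    then have zz: "top_form i z z = 0" using z'(2) two_nonzero by (simp add: c_def)
    \<comment> \<open>For isotropic v and w one has b_i(v - w, v - w) = -2 b_i(v, w), so a
      reflection is available for each half of the detour.\<close>
    have step: "same_orbit v w" if "v \<in> kernel_i" "w \<in> kernel_i" "top_form i v v = 0" "top_form i w w = 0" "top_form i v w \<noteq> 0" for v w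
    proof (rule same_orbit_anisotropic_difference[OF even that(1,2)])
      have "top_form i (v - w) (v - w) = - (2 * top_form i v w)"
        using that sym[OF that(1), of w] by (simp add: top_form_simps)
      then show "top_form i (v - w) (v - w) \<noteq> 0" using that(5) two_nonzero by simp
    qed (use that in simp)
    have "same_orbit x z" by (rule step[OF x z Q0(1) zz]) (use zx z' sym[OF x, of z] in simp)
    moreover have "same_orbit z y" by (rule step[OF z y zz]) (use zy z' Q0 eq in simp_all)
    ultimately show ?thesis by (rule same_orbit_trans)
  qed
qed

end

section \<open>Odd block sizes and the Cayley transform\<close>

lemma inverse_isometry:
  obtains g' where "symplectic_isometry B g'" "\<And>x. g' (g x) = x" "\<And>x. g (g' x) = x"
proof -
  define g' where "g' = inv_into UNIV g"
  have inv: "g' (g x) = x" "g (g' x) = x" for x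
    using g_bij by (simp_all add: g'_def bij_is_inj bij_is_surj surj_f_inv_f)
  have "Vector_Spaces.linear (*s) (*s) g'"
    by (rule vec.left_inverse_linear[OF g_linear]) (simp add: fun_eq_iff inv)
  moreover have "bij g'" using g_bij by (simp add: g'_def bij_imp_bij_inv)
  moreover have "B (g' x) (g' y) = B x y" for x y
    using B_g[of "g' x" "g' y"] by (simp add: inv)
  ultimately have "symplectic_isometry B g'"
    using symplectic two_nonzero by unfold_locales (simp_all add: isometry_group_def)
  then show ?thesis using that inv by blast
qed

text \<open>The version of \<open>v \<mapsto> top_form i v u *s u\<close> that commutes with \<open>g\<close>. Its adjoint is minus the same
  operator for the inverse of \<open>g\<close>, so that the sum of the two is skew.\<close>

definition dyad :: "nat \<Rightarrow> 'a^'m \<Rightarrow> 'a^'m \<Rightarrow> 'a^'m" where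
  "dyad i u v = (\<Sum>j<i. B ((T ^^ j) v) u *s (T ^^ (i - 1 - j)) u)"

lemma linear_dyad: "Vector_Spaces.linear (*s) (*s) (dyad i u)"
  unfolding Vector_Spaces.linear_iff
  by (simp add: vec.vector_space_axioms dyad_def vec.linear_add[OF T_power_linear]
      vec.linear_scale[OF T_power_linear] B_simps vec.scale_left_distrib sum.distrib vec.scale_sum_right)

lemma T_power_commute: "(T ^^ k) (T x) = T ((T ^^ k) x)"
  by (simp add: funpow_swap1)

lemma B_T_power_left_kernel: "(T ^^ i) u = 0 \<Longrightarrow> B ((T ^^ i) v) u = 0"
  by (simp add: B_T_power_left)

text \<open>Applying \<open>T\<close> raises the power on \<open>u\<close>, replacing v by T v
  raises the power on v. After a shift of the index the two sums differ only in boundary terms,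
  which vanish because T^i u = 0.\<close>

lemma T_dyad:
  assumes u: "(T ^^ i) u = 0" and i: "i > 0"
  shows "T (dyad i u v) = dyad i u (T v)"
proof -
  let ?f = "\<lambda>j. B ((T ^^ j) v) u *s (T ^^ (i - j)) u"
  have "T (dyad i u v) = (\<Sum>j<i. ?f j)"
    unfolding dyad_def vec.linear_sum[OF T_linear] vec.linear_scale[OF T_linear]
  proof (intro sum.cong refl)
    fix j assume "j \<in> {..<i}"
    then have "i - j = Suc (i - 1 - j)" by auto
    then show "B ((T ^^ j) v) u *s T ((T ^^ (i - 1 - j)) u) = ?f j" by simp
  qed
  also have "\<dots> = (\<Sum>j<Suc i. ?f j)" by (simp add: B_T_power_left_kernel[OF u])
  also have "\<dots> = ?f 0 + (\<Sum>j<i. ?f (Suc j))" by (rule sum.lessThan_Suc_shift)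
  also have "\<dots> = dyad i u (T v)"
    unfolding dyad_def T_power_commute by (simp add: u)
  finally show ?thesis .
qed

text \<open>Only the term j = i - 1 carries \<open>u\<close> itself; the others carry a positive
  power of \<open>T\<close>.\<close>

lemma dyad_mod_T:
  assumes i: "i > 0"
  shows "dyad i u v - B ((T ^^ (i - 1)) v) u *s u \<in> range T"
proof -
  have split: "{..<i} = insert (i - 1) {..<i - 1}" using i by auto
  have "dyad i u v - B ((T ^^ (i - 1)) v) u *s u = (\<Sum>j<i - 1. B ((T ^^ j) v) u *s (T ^^ (i - 1 - j)) u)"
    unfolding dyad_def split by simp
  also have "\<dots> \<in> range T"
    by (intro vec.subspace_sum[OF subspace_range_T] vec.subspace_scale[OF subspace_range_T] T_power_in_range) auto
  finally show ?thesis .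
qed

lemma dyad_fixed: "dyad i u v = B v u *s (T ^^ (i - 1)) u" if "T v = 0" "i > 0"
proof -
  have split: "{..<i} = insert 0 {1..<i}" using that by auto
  have "(T ^^ j) v = 0" if "j \<in> {1..<i}" for j
    using T_power_zero_mono[of 1 v j] that \<open>T v = 0\<close> by simp
  then show ?thesis unfolding dyad_def split by simp
qed

text \<open>h = (1 + S)(1 - S)^(-1). By skewness the mixed terms cancel, so 1 + S and 1 - S change
  the form in the same way; \<open>fix0\<close> makes 1 - S injective, hence invertible on the
  finite space.\<close>

lemma Cayley_transform:
  assumes lin: "Vector_Spaces.linear (*s) (*s) S"
    and skew: "\<And>v w. B (S v) w = - B v (S w)" and comm: "\<And>v. S (T v) = T (S v)"
    and fix0: "\<And>v. S v = v \<Longrightarrow> v = 0"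
  obtains h where "h \<in> centralizer_g" "\<And>p. h (p - S p) = p + S p"
proof -
  define A where "A v = v - S v" for v
  have A: "Vector_Spaces.linear (*s) (*s) A"
    using vec.linear_compose_sub[OF vec.linear_id lin] by (simp add: A_def[abs_def])
  have "inj A"
  proof (rule injI)
    fix x y assume "A x = A y"
    then have "S (x - y) = x - y" by (simp add: A_def vec.linear_diff[OF lin] algebra_simps)
    then have "x - y = 0" by (rule fix0)
    then show "x = y" by simp
  qed
  then have bij: "bij A" by (simp add: bij_def finite_UNIV_inj_surj)
  define A' where "A' = inv_into UNIV A"
  have inv: "A' (A x) = x" "A (A' x) = x" for x
    using bij by (simp_all add: A'_def bij_is_inj bij_is_surj surj_f_inv_f)
  have A': "Vector_Spaces.linear (*s) (*s) A'"
    by (rule vec.left_inverse_linear[OF A]) (simp add: fun_eq_iff inv)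
  have "A (T v) = T (A v)" for v by (simp add: A_def comm vec.linear_diff[OF T_linear])
  then have A'_T: "A' (T v) = T (A' v)" for v using inv by metis
  define h where "h v = A' v + S (A' v)" for v
  have "h \<in> centralizer_g"
  proof (rule centralizerI)
    show "Vector_Spaces.linear (*s) (*s) h"
      unfolding Vector_Spaces.linear_iff h_def
      by (simp add: vec.vector_space_axioms vec.linear_add[OF A'] vec.linear_scale[OF A'] vec.linear_add[OF lin]
          vec.linear_scale[OF lin] vec.scale_right_distrib)
    show "h (T v) = T (h v)" for v by (simp add: h_def A'_T comm vec.linear_add[OF T_linear])
    have "B (p + S p) (q + S q) = B (p - S p) (q - S q)" for p q
      using skew[of p q] by (simp add: B_simps)
    from this[of "A' v" "A' w" for v w] show "B (h v) (h w) = B v w" for v w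
      using inv(2) by (simp add: h_def A_def)
  qed
  moreover have "h (p - S p) = p + S p" for p
    using inv(1)[of p] by (simp add: h_def A_def)
  ultimately show ?thesis using that by blast
qed

text \<open>A Cayley transform sends p - S p to p + S p. If p = x + y and S p is congruent to -(x -
  y) modulo T V, this takes 2 x to 2 y there; the work lies in building such an S that is skew and
  commutes with \<open>T\<close>.\<close>

lemma same_orbit_odd_step:
  assumes i: "i > 0" and odd: "odd i" and x: "(T ^^ i) x = 0" and y: "(T ^^ i) y = 0"
    and ne: "top_form i x y \<noteq> 0"
  shows "same_orbit x y"
proof -
  obtain g' where I: "symplectic_isometry B g'" and inv: "\<And>x. g' (g x) = x" "\<And>x. g (g' x) = x"
    using inverse_isometry by blast
  interpret I: symplectic_isometry B g' by (rule I)
  \<comment> \<open>The adjoint of \<open>T\<close> is the operator \<open>minus_id g'\<close> of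
    the inverse; for this reason the inverse is interpreted as a second instance of the
    locale.\<close>
  have adj: "B (T v) w = B v (minus_id g' w)" for v w
    using B_g[of v "g' w"] by (simp add: minus_id_def B_simps inv)
  have adjk: "B ((T ^^ k) v) w = B v ((minus_id g' ^^ k) w)" for k v w
    by (induction k arbitrary: v w) (simp_all add: adj funpow_swap1)
  have T': "minus_id g' v = - g' (T v)" for v
    by (simp add: minus_id_def inv vec.linear_diff[OF I.g_linear])
  have comm_gT': "g (minus_id g' v) = minus_id g' (g v)" for v
    by (simp add: minus_id_def inv vec.linear_diff[OF g_linear])
  have comm: "f (T v) = T (f v)" if f: "Vector_Spaces.linear (*s) (*s) f" "\<And>v. f (minus_id g' v) = minus_id g' (f v)"
    for f :: "('a, 'm) vector_map" and v
  proof -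
    have fg': "f (g' v) = g' (f v)" for v
      using f(2)[of v] by (simp add: minus_id_def vec.linear_diff[OF f(1)])
    have "f (g v) = g (f v)" for v using fg'[of "g v"] inv by metis
    then show ?thesis by (simp add: minus_id_def vec.linear_diff[OF f(1)])
  qed
  have range: "range (minus_id g') \<subseteq> range T"
  proof
    fix v assume "v \<in> range (minus_id g')"
    then obtain w where "v = g' w - w" by (auto simp: minus_id_def)
    then have "v = T (- g' w)" by (simp add: minus_id_def vec.linear_neg[OF g_linear] inv)
    then show "v \<in> range T" by blast
  qed
  define u where "u = x - y"
  define c where "c = top_form i x y"
  have u: "(T ^^ i) u = 0" using x y by (simp add: u_def vec.linear_diff[OF T_power_linear])
  have self: "top_form i w w = 0" if "(T ^^ i) w = 0" for w
  proof -
    have "top_form i w w = - top_form i w w" using top_form_swap[OF i, of w w] that odd by simp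
    then have "2 * top_form i w w = 0" by (simp add: eq_neg_iff_add_eq_0)
    then show ?thesis using two_nonzero by simp
  qed
  have u': "(minus_id g' ^^ i) u = 0"
  proof -
    have "\<forall>v. B ((minus_id g' ^^ i) u) v = 0"
      using B_T_power_left_kernel[OF u] adjk B_skew by (metis neg_equal_0_iff_equal)
    then show ?thesis using nondegenerate unfolding nondegenerate_on_def by blast
  qed
  \<comment> \<open>Both dyads have the same leading coefficient b_i(v, u). For the first one,
    oddness of i makes the sign in \<open>top_form_swap\<close> cancel the sign from
    skewness.\<close>
  have coeff: "B ((T ^^ (i - 1)) v) u = top_form i v u" for v
    using top_form_swap[OF i, of u v] u odd B_skew[of "(T ^^ (i - 1)) v" u]
    by (simp add: top_form_def)
  have coeff': "B ((minus_id g' ^^ (i - 1)) v) u = top_form i v u" for v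
    using adjk[of "i - 1" u v] B_skew unfolding top_form_def by metis
  define D where "D v = dyad i u v + I.dyad i u v" for v
  have linD: "Vector_Spaces.linear (*s) (*s) D"
    using vec.linear_compose_add[OF linear_dyad I.linear_dyad] by (simp add: D_def[abs_def])
  have commD: "D (T v) = T (D v)" for v
    using T_dyad[OF u i] comm[OF I.linear_dyad I.T_dyad[OF u' i, symmetric]]
    by (simp add: D_def vec.linear_add[OF T_linear])
  \<comment> \<open>Reversing the sum by j \<mapsto> i - 1 - j matches the powers that act on v and
    on w, and moving powers across exchanges \<open>g\<close> with its inverse.\<close>
  have adjD: "B (dyad i u v) w = - B v (I.dyad i u w)" for v w
  proof -
    have "B v (I.dyad i u w) = (\<Sum>j<i. B ((minus_id g' ^^ j) w) u * B ((T ^^ (i - 1 - j)) v) u)"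
      by (simp add: I.dyad_def B_sum_right B_simps adjk)
    also have "\<dots> = (\<Sum>j<i. B ((minus_id g' ^^ (i - 1 - j)) w) u * B ((T ^^ j) v) u)"
      by (subst sum.nat_diff_reindex[symmetric]) (auto intro!: sum.cong)
    also have "\<dots> = (\<Sum>j<i. - (B ((T ^^ j) v) u * B ((T ^^ (i - 1 - j)) u) w))"
      by (intro sum.cong refl) (subst B_skew, simp add: adjk)
    also have "\<dots> = - B (dyad i u v) w"
      by (simp add: dyad_def B_sum_left B_simps sum_negf)
    finally show ?thesis by simp
  qed
  have adjD': "B (I.dyad i u v) w = - B v (dyad i u w)" for v w
    using adjD[of w v] B_skew[of "I.dyad i u v" w] B_skew[of v "dyad i u w"] by simp
  have skewD: "B (D v) w = - B v (D w)" for v w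
    by (simp add: D_def B_simps adjD adjD')
  have modD: "D v - (2 * top_form i v u) *s u \<in> range T" for v
  proof -
    have "D v - (2 * top_form i v u) *s u =
        (dyad i u v - top_form i v u *s u) + (I.dyad i u v - top_form i v u *s u)"
      unfolding D_def mult_2 vec.scale_left_distrib by simp
    moreover have "I.dyad i u v - top_form i v u *s u \<in> range T"
      using subsetD[OF range I.dyad_mod_T[OF i, of u v]] unfolding coeff' .
    ultimately show ?thesis
      using dyad_mod_T[OF i, of u v] vec.subspace_add[OF subspace_range_T] by (metis coeff)
  qed
  \<comment> \<open>b_i(x + y, x - y) = -2 c, so D (x + y) is congruent to -4 c (x - y) modulo T V;
    the factor 1 / (4 c) turns this into -(x - y).\<close>
  define S where "S v = inverse (4 * c) *s D v" for v
  have c4: "4 * c \<noteq> 0"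
  proof -
    have "2 * (2 * c) \<noteq> 0" using ne two_nonzero unfolding c_def by (simp only: mult_eq_0_iff) simp
    then show ?thesis by simp
  qed
  have linS: "Vector_Spaces.linear (*s) (*s) S"
    using vec.linear_compose_scale_right[OF linD] by (simp add: S_def[abs_def])
  \<comment> \<open>The image of D is killed by T^i, so a nonzero fixed v can be pushed to a nonzero
    w in ker T with S w = w. There D w is B(w, u) times a vector that pairs to 0 with
    \<open>u\<close>, as b_i is alternating. Hence B(w, u) = 0, so D w = 0 and w = S w = 0.\<close>
  have fixS: "v = 0" if v: "S v = v" for v
  proof (rule ccontr)
    assume "v \<noteq> 0"
    have commS: "(T ^^ k) (S w) = S ((T ^^ k) w)" for k w
      by (induction k) (simp_all add: S_def commD vec.linear_scale[OF T_linear])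
    have "(T ^^ i) ((T ^^ k) u) = 0" for k
      using T_power_zero_mono[OF u, of "i + k"] by (simp add: T_power_add)
    moreover have "(T ^^ i) ((minus_id g' ^^ k) u) = (minus_id g' ^^ k) ((T ^^ i) u)" for k
      by (rule funpow_commute, rule sym, rule funpow_commute)
        (simp add: minus_id_def inv vec.linear_diff[OF g_linear] vec.linear_diff[OF I.g_linear])
    ultimately have "(T ^^ i) (D v) = 0"
      by (simp add: D_def dyad_def I.dyad_def vec.linear_add[OF T_power_linear] vec.linear_sum[OF T_power_linear]
          vec.linear_scale[OF T_power_linear] u vec.linear_0[OF I.T_power_linear])
    then have "(T ^^ i) (S v) = 0" by (simp add: S_def vec.linear_scale[OF T_power_linear])
    then have "(T ^^ i) v = 0" using v by simp
    then obtain r where r: "T ((T ^^ r) v) = 0" "(T ^^ r) v \<noteq> 0"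
      using \<open>v \<noteq> 0\<close> lowest_power by blast
    define w where "w = (T ^^ r) v"
    have w: "T w = 0" "w \<noteq> 0" "S w = w" using r commS[of r v] v by (simp_all add: w_def)
    have w': "minus_id g' w = 0" using w(1) by (simp add: T' vec.linear_0[OF I.g_linear])
    have D: "D w = B w u *s ((T ^^ (i - 1)) u + (minus_id g' ^^ (i - 1)) u)"
      unfolding D_def dyad_fixed[OF w(1) i] I.dyad_fixed[OF w' i] by (simp add: vec.scale_right_distrib)
    have "B (D w) u = 0"
      unfolding D B_scale_left B_add_left coeff coeff' using self[OF u] by simp
    then have "B (S w) u = 0" by (simp add: S_def B_scale_left)
    then have "D w = 0" using D w(3) by simp
    then show False using w by (simp add: S_def)
  qed
  obtain h where h: "h \<in> centralizer_g" "\<And>p. h (p - S p) = p + S p"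
  proof (rule Cayley_transform[OF linS])
    show "B (S v) w = - B v (S w)" for v w by (simp add: S_def B_simps skewD)
    show "S (T v) = T (S v)" for v by (simp add: S_def commD vec.linear_scale[OF T_linear])
  qed (use fixS in auto)
  define p where "p = x + y"
  have "top_form i y x = - c" using top_form_swap[OF i, of y x] y odd by (simp add: c_def)
  then have "top_form i p u = - 2 * c"
    using self x y by (simp add: p_def u_def top_form_simps[OF i] c_def)
  then have "D p - (- (4 * c)) *s u \<in> range T" using modD[of p] by simp
  then have "inverse (4 * c) *s (D p - (- (4 * c)) *s u) \<in> range T"
    by (rule vec.subspace_scale[OF subspace_range_T])
  moreover have "inverse (4 * c) *s (D p - (- (4 * c)) *s u) = S p + u"
    unfolding vec.scale_right_diff_distrib S_def using c4 by simp
  ultimately have t: "S p + u \<in> range T" by simp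
  have "h (p - S p) - (p + S p) = 0" using h(2) by simp
  moreover have "h (p - S p) - (p + S p) = 2 *s (h x - y) - (h (S p + u) + (S p + u))"
    unfolding scale_two by (simp add: p_def u_def vec.linear_add[OF centralizerD(1)[OF h(1)]]
        vec.linear_diff[OF centralizerD(1)[OF h(1)]])
  ultimately have "2 *s (h x - y) = h (S p + u) + (S p + u)" by simp
  also have "\<dots> \<in> range T"
    by (rule vec.subspace_add[OF subspace_range_T centralizer_range_T[OF h(1) t] t])
  finally show ?thesis unfolding same_orbit_def using h(1) range_T_half by blast
qed

text \<open>All vectors of ker T^i are isotropic for odd i, so only b_i(x, y) = 0 blocks a single
  step; a z orthogonal to neither x nor y gives two steps instead.\<close>

theorem same_orbit_odd:
  assumes i: "i > 0" and odd: "odd i" and x: "(T ^^ i) x = 0" and y: "(T ^^ i) y = 0"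
    and nx: "\<exists>z\<in>{z. (T ^^ i) z = 0}. top_form i z x \<noteq> 0" and ny: "\<exists>z\<in>{z. (T ^^ i) z = 0}. top_form i z y \<noteq> 0"
  shows "same_orbit x y"
proof -
  obtain z where z: "(T ^^ i) z = 0" "top_form i z x \<noteq> 0" "top_form i z y \<noteq> 0"
    using common_nonorthogonal[OF i nx ny] by blast
  have "top_form i x z \<noteq> 0" using top_form_swap[OF i, of x z] x z by auto
  then have "same_orbit x z" by (rule same_orbit_odd_step[OF i odd x z(1)])
  moreover have "same_orbit z y" by (rule same_orbit_odd_step[OF i odd z(1) y z(3)])
  ultimately show ?thesis by (rule same_orbit_trans)
qed

end

subsection \<open>Values of quadratic forms over finite fields\<close>

text \<open>Squaring is two-to-one on the nonzero elements, since d and -d differ.\<close>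

lemma card_nonzero_squares:
  assumes two: "(2 :: 'a::{field,finite}) \<noteq> 0"
  shows "CARD('a) = 2 * card ((\<lambda>c::'a. c ^ 2) ` (UNIV - {0})) + 1"
proof -
  let ?N = "UNIV - {0 :: 'a}" and ?sq = "\<lambda>c::'a. c ^ 2"
  have fiber: "card {c \<in> ?N. ?sq c = s} = 2" if s: "s \<in> ?sq ` ?N" for s
  proof -
    obtain d where d: "d \<noteq> 0" "s = d ^ 2" using s by auto
    have "{c \<in> ?N. ?sq c = s} = {d, - d}"
      using d by (auto simp: power2_eq_iff)
    moreover have "d \<noteq> - d"
    proof
      assume "d = - d"
      then have "2 * d = 0" by (simp add: eq_neg_iff_add_eq_0)
      then show False using two d by simp
    qed
    ultimately show ?thesis by simp
  qed
  have "card ?N = (\<Sum>s\<in>?sq ` ?N. \<Sum>c\<in>{c \<in> ?N. ?sq c = s}. 1)"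
    unfolding card_eq_sum by (rule sum.image_gen) simp
  also have "\<dots> = (\<Sum>s\<in>?sq ` ?N. 2)"
    using fiber by (intro sum.cong) (simp_all only: card_eq_sum)
  finally have "card ?N = 2 * card (?sq ` ?N)" by simp
  moreover have "card ?N = CARD('a) - 1" "CARD('a) \<noteq> 0" by simp_all
  ultimately show ?thesis by linarith
qed

text \<open>The quadratic space W / U on representatives, with \<open>U\<close> the radical of
  \<open>b\<close> on \<open>W\<close>. Linearity on the left is global, as it is for b_i, while
  symmetry is confined to \<open>W\<close>.\<close>

locale finite_quadratic_form =
  fixes b :: "'a^'m \<Rightarrow> 'a^'m \<Rightarrow> 'a::{field,finite}" and W U :: "('a^'m::finite) set"
  assumes two: "(2 :: 'a) \<noteq> 0"
    and add_left: "b (x + y) z = b x z + b y z"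
    and scale_left: "b (c *s x) z = c * b x z"
    and sym: "x \<in> W \<Longrightarrow> y \<in> W \<Longrightarrow> b x y = b y x"
    and subW: "vec.subspace W" and subU: "vec.subspace U" and UW: "U \<subseteq> W"
    and radical: "x \<in> W \<Longrightarrow> (\<forall>y\<in>W. b x y = 0) \<longleftrightarrow> x \<in> U"
begin

lemma add_right: "x \<in> W \<Longrightarrow> y \<in> W \<Longrightarrow> z \<in> W \<Longrightarrow> b z (x + y) = b z x + b z y"
  using sym[of z "x + y"] sym[of z x] sym[of z y] add_left vec.subspace_add[OF subW] by simp

lemma scale_right: "x \<in> W \<Longrightarrow> z \<in> W \<Longrightarrow> b z (c *s x) = c * b z x"
  using sym[of z "c *s x"] sym[of z x] scale_left vec.subspace_scale[OF subW] by simp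

lemma radical_left: "u \<in> U \<Longrightarrow> w \<in> W \<Longrightarrow> b u w = 0"
  using radical[of u] UW by auto

lemma radical_right: "u \<in> U \<Longrightarrow> w \<in> W \<Longrightarrow> b w u = 0"
  using radical_left sym[of w u] UW by auto

lemma polarization:
  assumes X: "vec.subspace X" "X \<subseteq> W" and Q: "\<And>x. x \<in> X \<Longrightarrow> b x x = 0" and x: "x \<in> X" and y: "y \<in> X"
  shows "b x y = 0"
proof -
  have xy: "x \<in> W" "y \<in> W" "x + y \<in> W" using X x y vec.subspace_add[OF subW] by auto
  have "b (x + y) (x + y) = 0" by (intro Q vec.subspace_add[OF X(1) x y])
  then have "b x y + b y x = 0" using Q[OF x] Q[OF y] xy by (simp add: add_left add_right)
  then have "2 * b x y = 0" using sym[OF xy(1,2)] by simp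
  then show ?thesis using two by simp
qed

lemma subspace_b_left: "vec.subspace {w \<in> W. \<forall>e\<in>E. b w e = 0}"
proof -
  have "b 0 e = 0" for e using scale_left[of 0 0 e] by simp
  then show ?thesis
    unfolding vec.subspace_def
    using vec.subspace_0[OF subW] vec.subspace_add[OF subW] vec.subspace_scale[OF subW]
    by (auto simp: add_left scale_left)
qed

text \<open>Gram-Schmidt. If the orthogonal complement X of \<open>E\<close> in \<open>W\<close> had
  only isotropic vectors, polarization and the projection along \<open>E\<close> would put X into
  the radical, so \<open>U\<close> and \<open>E\<close> would span \<open>W\<close>, against the
  dimension.\<close>

lemma extend_orthogonal:
  assumes E: "finite E" "E \<subseteq> W" "\<And>e. e \<in> E \<Longrightarrow> b e e \<noteq> 0"
    "\<And>e f. e \<in> E \<Longrightarrow> f \<in> E \<Longrightarrow> e \<noteq> f \<Longrightarrow> b e f = 0"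
    and dim: "vec.dim W > vec.dim U + card E"
  obtains e where "e \<in> W" "b e e \<noteq> 0" "\<And>f. f \<in> E \<Longrightarrow> b e f = 0"
proof -
  define X where "X = {w \<in> W. \<forall>e\<in>E. b w e = 0}"
  have X: "vec.subspace X" "X \<subseteq> W" unfolding X_def using subspace_b_left by auto
  have proj: "w - (\<Sum>e\<in>E. (b w e / b e e) *s e) \<in> X" if w: "w \<in> W" for w
  proof -
    let ?p = "\<Sum>e\<in>E. (b w e / b e e) *s e"
    have p: "?p \<in> W" by (intro vec.subspace_sum[OF subW] vec.subspace_scale[OF subW]) (use E in auto)
    have "b ?p f = b w f" if f: "f \<in> E" for f
    proof -
      have sum: "b (\<Sum>e\<in>E'. (b w e / b e e) *s e) f = (\<Sum>e\<in>E'. (b w e / b e e) * b e f)" if "finite E'" for E'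
        using that
      proof (induction E')
        case empty
        show ?case using scale_left[of 0 0 f] by simp
      qed (simp add: add_left scale_left)
      have "b ?p f = (\<Sum>e\<in>E. if e = f then b w f else 0)"
        unfolding sum[OF E(1)] using E(3,4) f by (intro sum.cong) auto
      then show ?thesis using E(1) f by simp
    qed
    moreover have "b (w - ?p) f = b w f - b ?p f" for f
      using add_left[of "w - ?p" ?p f] by simp
    ultimately show ?thesis
      unfolding X_def using vec.subspace_diff[OF subW w p] by simp
  qed
  have "\<exists>e\<in>X. b e e \<noteq> 0"
  proof (rule ccontr)
    assume "\<not> (\<exists>e\<in>X. b e e \<noteq> 0)"
    then have pol: "b x y = 0" if "x \<in> X" "y \<in> X" for x y using polarization[OF X] that by blast
    have XU: "X \<subseteq> U"
    proof
      fix x assume x: "x \<in> X"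
      have "b x w = 0" if w: "w \<in> W" for w
      proof -
        let ?p = "\<Sum>e\<in>E. (b w e / b e e) *s e"
        have p: "?p \<in> W" by (intro vec.subspace_sum[OF subW] vec.subspace_scale[OF subW]) (use E in auto)
        have "b x ?p = 0"
        proof -
          have "b x (\<Sum>e\<in>E'. (b w e / b e e) *s e) = 0 \<and> (\<Sum>e\<in>E'. (b w e / b e e) *s e) \<in> W"
            if "finite E'" "E' \<subseteq> E" for E'
            using that
          proof (induction E')
            case empty
            show ?case using scale_right[of 0 x 0] vec.subspace_0[OF subW] x X by auto
          next
            case (insert e E')
            have e: "e \<in> W" "b x e = 0" using insert E x by (auto simp: X_def)
            then show ?case
              using insert x X vec.subspace_add[OF subW] vec.subspace_scale[OF subW, of e]
              by (auto simp: add_right scale_right)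
          qed
          then show ?thesis using E(1) by blast
        qed
        moreover have "b x (w - ?p) = 0" using pol x proj[OF w] by blast
        moreover have "b x w = b x ((w - ?p) + ?p)" by simp
        moreover have "b x ((w - ?p) + ?p) = b x (w - ?p) + b x ?p"
          by (rule add_right) (use x X p w vec.subspace_diff[OF subW] in auto)
        ultimately show ?thesis by simp
      qed
      then show "x \<in> U" using radical[of x] x X by blast
    qed
    obtain bu where bu: "bu \<subseteq> U" "vec.independent bu" "U \<subseteq> vec.span bu" "card bu = vec.dim U"
      using vec.basis_exists[of U] by blast
    have "W \<subseteq> vec.span (bu \<union> E)"
    proof
      fix w assume w: "w \<in> W"
      let ?p = "\<Sum>e\<in>E. (b w e / b e e) *s e"
      have "w - ?p \<in> vec.span (bu \<union> E)"
        using proj[OF w] XU bu(3) vec.span_mono[of bu "bu \<union> E"] by blast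
      moreover have "?p \<in> vec.span (bu \<union> E)"
        by (intro vec.span_sum vec.span_scale vec.span_base) auto
      ultimately have "(w - ?p) + ?p \<in> vec.span (bu \<union> E)" by (rule vec.span_add)
      then show "w \<in> vec.span (bu \<union> E)" by simp
    qed
    moreover have fin: "finite (bu \<union> E)" using bu(2) E(1) by (simp add: vec.finiteI_independent)
    ultimately have "vec.dim W \<le> card (bu \<union> E)" by (rule vec.dim_le_card)
    also have "\<dots> \<le> card bu + card E" by (rule card_Un_le)
    finally show False using dim bu(4) by simp
  qed
  then show ?thesis using that X unfolding X_def by blast
qed

text \<open>Pigeonhole: the values s^2 \<alpha> and c - t^2 \<beta> form two sets of (q + 1) / 2
  elements each, so the sets meet.\<close>

lemma binary_form_universal:
  assumes "\<alpha> \<noteq> (0::'a)" "\<beta> \<noteq> 0"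
  shows "\<exists>s t. s ^ 2 * \<alpha> + t ^ 2 * \<beta> = c"
proof -
  let ?sq = "range (\<lambda>c::'a. c ^ 2)"
  have "?sq = insert 0 ((\<lambda>c::'a. c ^ 2) ` (UNIV - {0}))"
    by (auto simp: image_iff)
  moreover have "0 \<notin> (\<lambda>c::'a. c ^ 2) ` (UNIV - {0})" by auto
  ultimately have card: "2 * card ?sq = CARD('a) + 1"
    using card_nonzero_squares[OF two] by simp
  have "card ((\<lambda>x. x * \<alpha>) ` ?sq) = card ?sq"
    using assms by (intro card_image) (simp add: inj_on_def)
  moreover have "card ((\<lambda>x. c - x * \<beta>) ` ?sq) = card ?sq"
    using assms by (intro card_image) (simp add: inj_on_def)
  ultimately have "card ((\<lambda>x. x * \<alpha>) ` ?sq) + card ((\<lambda>x. c - x * \<beta>) ` ?sq) > CARD('a)"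
    using card by simp
  moreover have "card ((\<lambda>x. x * \<alpha>) ` ?sq \<union> (\<lambda>x. c - x * \<beta>) ` ?sq) \<le> CARD('a)"
    by (rule card_mono) auto
  ultimately have "(\<lambda>x. x * \<alpha>) ` ?sq \<inter> (\<lambda>x. c - x * \<beta>) ` ?sq \<noteq> {}"
    using card_Un_disjoint[of "(\<lambda>x. x * \<alpha>) ` ?sq" "(\<lambda>x. c - x * \<beta>) ` ?sq"] by auto
  then obtain s t where "s ^ 2 * \<alpha> = c - t ^ 2 * \<beta>" by auto
  then show ?thesis by (intro exI[of _ s] exI[of _ t]) simp
qed

text \<open>In dimension one the values are the (q - 1) / 2 nonzero squares times a constant. From
  dimension two on every nonzero value occurs, and 0 occurs exactly when there is an isotropic
  vector outside the radical.\<close>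

lemma card_values:
  assumes dim: "vec.dim W = vec.dim U + a" and a: "a > 0"
  shows "card {b w w | w. w \<in> W - U} = even_contribution CARD('a) a (\<exists>w\<in>W - U. b w w = 0)"
proof -
  obtain e1 where e1: "e1 \<in> W" "b e1 e1 \<noteq> 0"
    using extend_orthogonal[of "{}"] dim a by auto
  have not_U: "w \<notin> U" if "w \<in> W" "v \<in> W" "b w v \<noteq> 0" for w v
    using radical_left that by blast
  show ?thesis
  proof (cases "a = 1")
    case True
    have W: "W = vec.span (insert e1 U)"
    proof (rule vec.subspace_dim_equal[symmetric])
      show "vec.span (insert e1 U) \<subseteq> W" using e1 UW by (intro vec.span_minimal subW) auto
      have "e1 \<notin> vec.span U" using not_U[OF e1(1) e1(1,2)] subU by (simp add: vec.span_eq_iff[THEN iffD2])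
      then show "vec.dim W \<le> vec.dim (vec.span (insert e1 U))"
        using dim True by (simp add: vec.dim_insert)
    qed (simp_all add: subW)
    have "{b w w | w. w \<in> W - U} = (\<lambda>s. s * b e1 e1) ` (\<lambda>c. c ^ 2) ` (UNIV - {0})"
    proof (intro subset_antisym subsetI)
      fix r assume "r \<in> {b w w | w. w \<in> W - U}"
      then obtain w where w: "w \<in> W" "w \<notin> U" "r = b w w" by blast
      then obtain c where c: "w - c *s e1 \<in> vec.span U" unfolding W by (auto simp: vec.in_span_insert vec.span_insert)
      define u where "u = w - c *s e1"
      have u: "u \<in> U" "u \<in> W" using c subU UW by (auto simp: u_def vec.span_eq_iff[THEN iffD2])
      have w_eq: "w = c *s e1 + u" by (simp add: u_def)
      have ce: "c *s e1 \<in> W" by (rule vec.subspace_scale[OF subW e1(1)])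
      have "r = b (c *s e1) (c *s e1)"
        unfolding w(3) w_eq using u ce vec.subspace_add[OF subW ce u(2)]
        by (simp add: add_left add_right radical_left radical_right)
      also have "\<dots> = c ^ 2 * b e1 e1"
        using e1 ce by (simp add: scale_left scale_right power2_eq_square)
      finally have "r = c ^ 2 * b e1 e1" .
      moreover have "c \<noteq> 0" using w(2) u w_eq by auto
      ultimately show "r \<in> (\<lambda>s. s * b e1 e1) ` (\<lambda>c. c ^ 2) ` (UNIV - {0})" by auto
    next
      fix r assume "r \<in> (\<lambda>s. s * b e1 e1) ` (\<lambda>c. c ^ 2) ` (UNIV - {0})"
      then obtain c where c: "c \<noteq> 0" "r = c ^ 2 * b e1 e1" by auto
      have ce: "c *s e1 \<in> W" by (rule vec.subspace_scale[OF subW e1(1)])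
      have "r = b (c *s e1) (c *s e1)"
        using e1 ce c by (simp add: scale_left scale_right power2_eq_square)
      moreover have "c *s e1 \<notin> U" by (rule not_U[OF ce e1(1)]) (use c e1 in \<open>simp add: scale_left\<close>)
      ultimately show "r \<in> {b w w | w. w \<in> W - U}" using ce by blast
    qed
    moreover have "card ((\<lambda>s. s * b e1 e1) ` (\<lambda>c. c ^ 2) ` (UNIV - {0})) = card ((\<lambda>c::'a. c ^ 2) ` (UNIV - {0}))"
      using e1 by (intro card_image) (simp add: inj_on_def)
    ultimately show ?thesis
      using card_nonzero_squares[OF two] True by (simp add: even_contribution_def)
  next
    case False
    then have a2: "a \<ge> 2" using a by simp
    obtain e2 where e2: "e2 \<in> W" "b e2 e2 \<noteq> 0" "b e2 e1 = 0"
      using extend_orthogonal[of "{e1}"] dim a2 e1 by auto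
    have e12: "b e1 e2 = 0" using sym[OF e1(1) e2(1)] e2(3) by simp
    have val: "s *s e1 + t *s e2 \<in> W" "b (s *s e1 + t *s e2) (s *s e1 + t *s e2) = s ^ 2 * b e1 e1 + t ^ 2 * b e2 e2" for s t
    proof -
      have m: "s *s e1 \<in> W" "t *s e2 \<in> W" using vec.subspace_scale[OF subW] e1 e2 by auto
      then show m': "s *s e1 + t *s e2 \<in> W" by (rule vec.subspace_add[OF subW])
      show "b (s *s e1 + t *s e2) (s *s e1 + t *s e2) = s ^ 2 * b e1 e1 + t ^ 2 * b e2 e2"
        using m m' e1 e2 e12 by (simp add: add_left add_right scale_left scale_right power2_eq_square)
    qed
    have nonzero: "c \<in> {b w w | w. w \<in> W - U}" if "c \<noteq> 0" for c
    proof -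
      obtain s t where st: "s ^ 2 * b e1 e1 + t ^ 2 * b e2 e2 = c"
        using binary_form_universal[OF e1(2) e2(2)] by blast
      let ?w = "s *s e1 + t *s e2"
      have "b ?w ?w = c" using val st by simp
      moreover from this have "?w \<notin> U" using not_U[OF val(1) val(1)] that by metis
      ultimately show ?thesis using val(1) by blast
    qed
    have iso: "\<exists>w\<in>W - U. b w w = 0" if "a > 2"
    proof -
      have "card {e1, e2} = 2" using e1 e2 e12 by (auto simp: card_insert_if)
      then have dim3: "vec.dim W > vec.dim U + card {e1, e2}" using dim that by simp
      obtain e3 where "e3 \<in> W" "b e3 e3 \<noteq> 0" "\<And>f. f \<in> {e1, e2} \<Longrightarrow> b e3 f = 0"
        by (rule extend_orthogonal[OF _ _ _ _ dim3]) (use e1 e2 e12 in auto)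
      then have e3: "e3 \<in> W" "b e3 e3 \<noteq> 0" "b e3 e1 = 0" "b e3 e2 = 0" by auto
      \<comment> \<open>A combination of e1 and e2 with value -b(e3, e3), added to e3, is isotropic;
        its pairing with e3 is nonzero, which keeps it outside \<open>U\<close>.\<close>
      obtain s t where st: "s ^ 2 * b e1 e1 + t ^ 2 * b e2 e2 = - b e3 e3"
        using binary_form_universal[OF e1(2) e2(2)] by blast
      let ?w = "s *s e1 + t *s e2"
      have sw: "b ?w e3 = 0" using sym[OF e1(1) e3(1)] sym[OF e2(1) e3(1)] e3 by (simp add: add_left scale_left)
      have ws: "b e3 ?w = 0" using sym[OF val(1) e3(1)] sw by simp
      have m: "?w + e3 \<in> W" by (rule vec.subspace_add[OF subW val(1) e3(1)])
      have "b (?w + e3) (?w + e3) = b ?w ?w + b e3 e3"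
        unfolding add_right[OF val(1) e3(1) m] unfolding add_left[of ?w e3] sw ws by simp
      also have "\<dots> = 0" using val(2) st by simp
      finally have "b (?w + e3) (?w + e3) = 0" .
      moreover have "?w + e3 \<notin> U"
        by (rule not_U[OF m e3(1)]) (use e3(2) sw add_left[of ?w e3 e3] in simp)
      ultimately show ?thesis using m by blast
    qed
    define S where "S = {b w w | w. w \<in> W - U}"
    have nz: "c \<in> S" if "c \<noteq> 0" for c using nonzero[OF that] by (simp only: S_def)
    have S0: "0 \<in> S \<longleftrightarrow> (\<exists>w\<in>W - U. b w w = 0)"
      unfolding S_def mem_Collect_eq by (metis (no_types))
    have "S = (if 0 \<in> S then UNIV else UNIV - {0})"
    proof (rule Set.set_eqI)
      fix x show "x \<in> S \<longleftrightarrow> x \<in> (if 0 \<in> S then UNIV else UNIV - {0})"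
        using nz by (cases "x = 0") auto
    qed
    then have "card S = card (if 0 \<in> S then UNIV else UNIV - {0 :: 'a})" by (rule arg_cong)
    also have "\<dots> = (if 0 \<in> S then CARD('a) else CARD('a) - 1)" by simp
    finally have "card S = (if 0 \<in> S then CARD('a) else CARD('a) - 1)" .
    moreover have "a > 2 \<Longrightarrow> 0 \<in> S" using iso unfolding S0 .
    ultimately show ?thesis
      unfolding S_def[symmetric] S0[symmetric] even_contribution_def using a2 by (cases "a > 2") simp_all
  qed
qed

end

subsection \<open>Orbits and their invariants\<close>

locale symplectic_decomposition = symplectic_isometry B g
  for B :: "('a::{field,finite}, 'm::finite) form" and g :: "('a, 'm) vector_map" +
  fixes W :: "nat \<Rightarrow> ('a^'m) set"
  assumes decomposition: "orthogonal_block_decomposition B g W"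
begin

abbreviation blocks :: "nat \<Rightarrow> nat" where "blocks i \<equiv> num_jordan_blocks g V1 i"

lemma direct: "is_direct_sum {1..CARD('m)} W V1"
  and orth: "i \<in> {1..CARD('m)} \<Longrightarrow> j \<in> {1..CARD('m)} \<Longrightarrow> i \<noteq> j \<Longrightarrow> x \<in> W i \<Longrightarrow> y \<in> W j \<Longrightarrow> B x y = 0"
  and jordan: "i \<in> {1..CARD('m)} \<Longrightarrow> has_jordan_form_on g (W i) (replicate (blocks i) (i, 1))"
  using decomposition unfolding orthogonal_block_decomposition_def by blast+

lemma fin_sizes: "finite {1..CARD('m)}" by simp

lemma invariant_W: "i \<in> {1..CARD('m)} \<Longrightarrow> invariant_subspace (W i)"
  using direct_sum_subspace[OF direct fin_sizes] decomposition vec.subspace_diff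
  unfolding orthogonal_block_decomposition_def invariant_subspace_def minus_id_def by blast

lemmas W_subspace = invariant_subspaceD(1)[OF invariant_W]
  and W_T = invariant_subspaceD(2)[OF invariant_W]
  and W_T_power = invariant_subspaceD(3)[OF invariant_W]

lemma W_V1: "i \<in> {1..CARD('m)} \<Longrightarrow> x \<in> W i \<Longrightarrow> x \<in> V1"
  using direct_sum_summand[OF direct fin_sizes] by blast

lemma V1_nilpotent: "x \<in> V1 \<Longrightarrow> (T ^^ CARD('m)) x = 0"
  by (simp add: gen_one_space_def)

lemma W_dim: "i \<in> {1..CARD('m)} \<Longrightarrow> vec.dim (W i) = vec.dim (T ` W i) + blocks i"
  and W_kernel: "i \<in> {1..CARD('m)} \<Longrightarrow> w \<in> W i \<Longrightarrow> (T ^^ i) w = 0"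
  and W_top: "i \<in> {1..CARD('m)} \<Longrightarrow> w \<in> W i \<Longrightarrow> (T ^^ (i - 1)) w = 0 \<Longrightarrow> w \<in> T ` W i"
  using homogeneous_block[OF jordan V1_nilpotent[OF W_V1] _ invariant_W] by auto

lemma subspace_TW: "i \<in> {1..CARD('m)} \<Longrightarrow> vec.subspace (T ` W i)"
  by (intro vec.linear_subspace_image T_linear W_subspace)

lemma nondegenerate_W: assumes i: "i \<in> {1..CARD('m)}" shows "nondegenerate_on B (W i)"
  unfolding nondegenerate_on_def
proof (intro ballI impI)
  fix x assume x: "x \<in> W i" "\<forall>y\<in>W i. B x y = 0"
  have "B x v = 0" if v: "v \<in> V1" for v
  proof -
    obtain w where w: "\<And>j. j \<in> {1..CARD('m)} \<Longrightarrow> w j \<in> W j" "v = (\<Sum>j\<in>{1..CARD('m)}. w j)"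
      using direct_sumE[OF direct fin_sizes v] by blast
    have "B x (w j) = 0" if "j \<in> {1..CARD('m)}" for j
      using that x w(1) orth[OF i that _ x(1)] by (cases "i = j") auto
    then show ?thesis unfolding w(2) by (simp add: B_sum_right)
  qed
  then show "x = 0"
    using nondegenerate_V1 W_V1[OF i x(1)] unfolding nondegenerate_on_def by blast
qed

text \<open>Describes v modulo the Fitting complement. Uniqueness for this relation yields the
  compatibility of \<open>component\<close> with differences and with \<open>T\<close>, whatever
  choice is made.\<close>

definition decomp :: "'a^'m \<Rightarrow> (nat \<Rightarrow> 'a^'m) \<Rightarrow> bool" where
  "decomp v w \<longleftrightarrow> (\<forall>j\<in>{1..CARD('m)}. w j \<in> W j) \<and> v - (\<Sum>j\<in>{1..CARD('m)}. w j) \<in> T_range"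

definition component :: "'a^'m \<Rightarrow> nat \<Rightarrow> 'a^'m" where "component v = (SOME w. decomp v w)"

lemma decomp_comp: "decomp v (component v)"
proof -
  obtain u r where u: "u \<in> V1" "r \<in> T_range" "v = u + r" using Fitting_decomposition by blast
  obtain w where "\<And>j. j \<in> {1..CARD('m)} \<Longrightarrow> w j \<in> W j" "u = (\<Sum>j\<in>{1..CARD('m)}. w j)"
    using direct_sumE[OF direct fin_sizes u(1)] by blast
  then have "decomp v w" using u unfolding decomp_def by simp
  then show ?thesis unfolding component_def by (rule someI[of "decomp v"])
qed

lemma decomp_unique:
  assumes "decomp v w" "decomp v w'" "j \<in> {1..CARD('m)}"
  shows "w j = w' j"
proof -
  let ?d = "\<lambda>j. w j - w' j"
  have d: "?d j \<in> W j" if "j \<in> {1..CARD('m)}" for j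
    using assms that by (auto simp: decomp_def intro: vec.subspace_diff[OF W_subspace])
  have "(\<Sum>j\<in>{1..CARD('m)}. ?d j) = (v - (\<Sum>j\<in>{1..CARD('m)}. w' j)) - (v - (\<Sum>j\<in>{1..CARD('m)}. w j))"
    by (simp add: sum_subtractf)
  also have "\<dots> \<in> T_range"
    by (rule vec.subspace_diff[OF subspace_T_range]) (use assms in \<open>simp_all only: decomp_def\<close>)
  finally have "(\<Sum>j\<in>{1..CARD('m)}. ?d j) \<in> T_range" .
  moreover have "(\<Sum>j\<in>{1..CARD('m)}. ?d j) \<in> V1" by (rule direct_sumI[OF direct fin_sizes d])
  ultimately have "(\<Sum>j\<in>{1..CARD('m)}. ?d j) = 0" using T_range_power_zero V1_nilpotent by blast
  then have "?d j = 0" using direct_sum_zero[OF direct fin_sizes, of ?d] d assms(3) by blast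
  then show ?thesis by simp
qed

lemma comp_eqI: "decomp v w \<Longrightarrow> j \<in> {1..CARD('m)} \<Longrightarrow> component v j = w j"
  using decomp_unique decomp_comp by blast

lemma comp_in: "j \<in> {1..CARD('m)} \<Longrightarrow> component v j \<in> W j"
  using decomp_comp unfolding decomp_def by blast

lemma comp_diff: assumes j: "j \<in> {1..CARD('m)}" shows "component (x - y) j = component x j - component y j"
proof (rule comp_eqI[OF _ j])
  have "x - y - (\<Sum>j\<in>{1..CARD('m)}. component x j - component y j) = (x - (\<Sum>j\<in>{1..CARD('m)}. component x j)) - (y - (\<Sum>j\<in>{1..CARD('m)}. component y j))"
    by (simp add: sum_subtractf)
  also have "\<dots> \<in> T_range"
    by (rule vec.subspace_diff[OF subspace_T_range])
      (use decomp_comp[of x] decomp_comp[of y] in \<open>simp_all only: decomp_def\<close>)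
  finally show "decomp (x - y) (\<lambda>j. component x j - component y j)"
    unfolding decomp_def using comp_in vec.subspace_diff[OF W_subspace] by blast
qed

lemma comp_T: assumes j: "j \<in> {1..CARD('m)}" shows "component (T x) j = T (component x j)"
proof (rule comp_eqI[OF _ j])
  have "T x - (\<Sum>j\<in>{1..CARD('m)}. T (component x j)) = T (x - (\<Sum>j\<in>{1..CARD('m)}. component x j))"
    by (simp add: vec.linear_diff[OF T_linear] vec.linear_sum[OF T_linear])
  also have "\<dots> \<in> T ` T_range" using decomp_comp unfolding decomp_def by blast
  finally show "decomp (T x) (\<lambda>j. T (component x j))"
    unfolding decomp_def T_range_eq using comp_in W_T by blast
qed

lemma comp_T_power: "j \<in> {1..CARD('m)} \<Longrightarrow> component ((T ^^ k) x) j = (T ^^ k) (component x j)"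
  by (induction k) (simp_all add: comp_T)

lemma comp_zero: "j \<in> {1..CARD('m)} \<Longrightarrow> component 0 j = 0"
  using comp_diff[of j 0 0] by simp

lemma comp_W:
  assumes i: "i \<in> {1..CARD('m)}" and x: "x \<in> W i" and j: "j \<in> {1..CARD('m)}"
  shows "component x j = (if j = i then x else 0)"
proof (rule comp_eqI[OF _ j])
  have "x - (\<Sum>j\<in>{1..CARD('m)}. if j = i then x else 0) = 0" using i by simp
  then show "decomp x (\<lambda>j. if j = i then x else 0)"
    unfolding decomp_def using x vec.subspace_0[OF W_subspace] vec.subspace_0[OF subspace_T_range] by auto
qed

lemma T_range_subset: "T_range \<subseteq> range T"
  using T_range_eq by blast

text \<open>V / T V is the direct sum of the W_j / T W_j, because \<open>T_range\<close> lies in T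
  V.\<close>

lemma range_T_iff: "v \<in> range T \<longleftrightarrow> (\<forall>j\<in>{1..CARD('m)}. component v j \<in> T ` W j)"
proof
  assume "v \<in> range T"
  then show "\<forall>j\<in>{1..CARD('m)}. component v j \<in> T ` W j" using comp_T comp_in by auto
next
  assume v: "\<forall>j\<in>{1..CARD('m)}. component v j \<in> T ` W j"
  have "v = (v - (\<Sum>j\<in>{1..CARD('m)}. component v j)) + (\<Sum>j\<in>{1..CARD('m)}. component v j)" by simp
  also have "\<dots> \<in> range T"
  proof (rule vec.subspace_add[OF subspace_range_T])
    show "v - (\<Sum>j\<in>{1..CARD('m)}. component v j) \<in> range T"
      using decomp_comp[of v] T_range_subset unfolding decomp_def by blast
    show "(\<Sum>j\<in>{1..CARD('m)}. component v j) \<in> range T"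
      by (rule vec.subspace_sum[OF subspace_range_T]) (use v in blast)
  qed
  finally show "v \<in> range T" .
qed

text \<open>ker T^i meets \<open>T_range\<close> only in 0, which gives the first claim. In W_j with
  j > i the kernel of T^i lies in that of T^(j-1), which is contained in T W_j.\<close>

lemma kernel_decomposition:
  assumes "(T ^^ i) x = 0"
  shows "x = (\<Sum>j\<in>{1..CARD('m)}. component x j)" "j \<in> {1..CARD('m)} \<Longrightarrow> (T ^^ i) (component x j) = 0"
    "j \<in> {1..CARD('m)} \<Longrightarrow> i < j \<Longrightarrow> component x j \<in> T ` W j"
proof -
  show k: "(T ^^ i) (component x j) = 0" if "j \<in> {1..CARD('m)}" for j
    using comp_T_power[OF that, of i x] assms comp_zero[OF that] by simp
  have "(T ^^ i) (x - (\<Sum>j\<in>{1..CARD('m)}. component x j)) = 0"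
    using assms k by (simp add: vec.linear_diff[OF T_power_linear] vec.linear_sum[OF T_power_linear])
  moreover have "x - (\<Sum>j\<in>{1..CARD('m)}. component x j) \<in> T_range" using decomp_comp by (simp add: decomp_def)
  ultimately have "x - (\<Sum>j\<in>{1..CARD('m)}. component x j) = 0" using T_range_power_zero by blast
  then show "x = (\<Sum>j\<in>{1..CARD('m)}. component x j)" by simp
  show "component x j \<in> T ` W j" if "j \<in> {1..CARD('m)}" "i < j" for j
    using W_top[OF that(1) comp_in[OF that(1)]] T_power_zero_mono[OF k[OF that(1)], of "j - 1"] that by auto
qed

lemma top_form_radical:
  assumes i: "i \<in> {1..CARD('m)}" and x: "x \<in> W i" and t: "t \<in> T ` W i"
  shows "top_form i t x = 0" "top_form i x t = 0"
proof -
  obtain z where z: "z \<in> W i" "t = T z" using t by blast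
  have Suc: "Suc (i - 1) = i" using i by simp
  show "top_form i t x = 0"
    unfolding top_form_def z using W_kernel[OF i x] Suc by (intro B_T_left_top) simp
  have "(T ^^ (i - 1)) (T z) = (T ^^ Suc (i - 1)) z" by (simp add: funpow_swap1)
  then show "top_form i x t = 0" unfolding top_form_def z Suc using W_kernel[OF i z(1)] by simp
qed

text \<open>Components of different sizes are orthogonal. Those with j < i are killed by T^(i-1);
  those with j > i lie in T W_j and therefore pair to 0 with T^(i-1) of the kernel of T^i.\<close>

lemma top_form_kernel:
  assumes i: "i \<in> {1..CARD('m)}" and x: "(T ^^ i) x = 0"
  shows "top_form i x x = top_form i (component x i) (component x i)"
proof -
  have B0: "B (component x j) ((T ^^ (i - 1)) (component x k)) = (if j = k \<and> j = i then top_form i (component x i) (component x i) else 0)"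
    if j: "j \<in> {1..CARD('m)}" and k: "k \<in> {1..CARD('m)}" for j k
  proof (cases "j = k")
    case False
    then show ?thesis using orth[OF j k _ comp_in[OF j] W_T_power[OF k comp_in[OF k]]] by simp
  next
    case jk: True
    consider "j < i" | "j = i" | "j > i" by linarith
    then show ?thesis
    proof cases
      case 1
      then have "(T ^^ (i - 1)) (component x k) = 0"
        using T_power_zero_mono[OF W_kernel[OF k comp_in[OF k]], of "i - 1"] jk by simp
      then show ?thesis using 1 by simp
    next
      case 3
      then obtain z where "component x j = T z" using kernel_decomposition(3)[OF x j] by blast
      moreover have "B (T z) ((T ^^ (i - 1)) (component x k)) = 0"
        using kernel_decomposition(2)[OF x k] i by (intro B_T_left_top) auto
      ultimately show ?thesis using 3 by simp
    qed (use jk in \<open>simp add: top_form_def\<close>)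
  qed
  have "top_form i x x = B (\<Sum>j\<in>{1..CARD('m)}. component x j) ((T ^^ (i - 1)) (\<Sum>k\<in>{1..CARD('m)}. component x k))"
    unfolding top_form_def using kernel_decomposition(1)[OF x] by simp
  also have "\<dots> = (\<Sum>j\<in>{1..CARD('m)}. \<Sum>k\<in>{1..CARD('m)}. B (component x j) ((T ^^ (i - 1)) (component x k)))"
    by (simp add: vec.linear_sum[OF T_power_linear] B_sum_left B_sum_right) (rule sum.swap)
  also have "\<dots> = (\<Sum>j\<in>{1..CARD('m)}. \<Sum>k\<in>{1..CARD('m)}. if j = k \<and> j = i then top_form i (component x i) (component x i) else 0)"
    by (intro sum.cong refl B0)
  also have "\<dots> = (\<Sum>j\<in>{1..CARD('m)}. if j = i then top_form i (component x i) (component x i) else 0)"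
  proof (intro sum.cong refl)
    fix j assume j: "j \<in> {1..CARD('m)}"
    have "(\<Sum>k\<in>{1..CARD('m)}. if j = k \<and> j = i then top_form i (component x i) (component x i) else 0) =
        (\<Sum>k\<in>{1..CARD('m)}. if k = j then if j = i then top_form i (component x i) (component x i) else 0 else 0)"
      by (intro sum.cong) auto
    then show "(\<Sum>k\<in>{1..CARD('m)}. if j = k \<and> j = i then top_form i (component x i) (component x i) else 0) =
        (if j = i then top_form i (component x i) (component x i) else 0)"
      using j by simp
  qed
  also have "\<dots> = top_form i (component x i) (component x i)" using i by simp
  finally show ?thesis .
qed

section \<open>A complete invariant of the orbits\<close>

definition level :: "'a^'m \<Rightarrow> nat" where
  "level v = Max (insert 0 {j\<in>{1..CARD('m)}. component v j \<notin> T ` W j})"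

text \<open>For odd i the form b_i is alternating and its values carry no information; the constant
  0 stands in for them.\<close>

definition level_value :: "nat \<Rightarrow> 'a^'m \<Rightarrow> 'a" where
  "level_value i w = (if even i then top_form i w w else 0)"

text \<open>The level is the index at which v enters the filtration of V / T V by the images of ker
  T^i. Level 0 is the zero coset; its pair (0, 0) differs from all others because block sizes are
  positive.\<close>

definition key :: "'a^'m \<Rightarrow> nat \<times> 'a" where
  "key v = (if level v = 0 then (0, 0) else (level v, level_value (level v) (component v (level v))))"

lemma level_le_iff: "level v \<le> i \<longleftrightarrow> (\<forall>j\<in>{1..CARD('m)}. i < j \<longrightarrow> component v j \<in> T ` W j)"
proof -
  have "level v \<le> i \<longleftrightarrow> (\<forall>j\<in>{1..CARD('m)}. component v j \<notin> T ` W j \<longrightarrow> j \<le> i)"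
    unfolding level_def by (subst Max_le_iff) auto
  then show ?thesis unfolding linorder_not_less[symmetric] by blast
qed

lemma level_pos: "level v \<noteq> 0 \<Longrightarrow> level v \<in> {1..CARD('m)} \<and> component v (level v) \<notin> T ` W (level v)"
  using Max_in[of "insert 0 {j\<in>{1..CARD('m)}. component v j \<notin> T ` W j}"] unfolding level_def[symmetric] by auto

lemma level_zero_iff: "level v = 0 \<longleftrightarrow> v \<in> range T"
  using level_le_iff[of v 0] unfolding range_T_iff by auto

text \<open>The components of index above i lie in T W_j, so dropping them and the part in
  \<open>T_range\<close> does not change v modulo T V. With \<open>level_leI\<close> this says that
  level at most i means membership in ker T^i + T V, a condition free of \<open>W\<close>.\<close>

lemma level_le_kernel:
  assumes "level v \<le> i"
  obtains x where "(T ^^ i) x = 0" "v - x \<in> range T"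
    "\<And>j. j \<in> {1..CARD('m)} \<Longrightarrow> j \<le> i \<Longrightarrow> component x j = component v j"
proof -
  define w where "w j = (if j \<le> i then component v j else 0)" for j
  define x where "x = (\<Sum>j\<in>{1..CARD('m)}. w j)"
  have wW: "w j \<in> W j" if "j \<in> {1..CARD('m)}" for j
    using comp_in[OF that] vec.subspace_0[OF W_subspace[OF that]] by (simp add: w_def)
  have "decomp x w" unfolding decomp_def x_def using wW vec.subspace_0[OF subspace_T_range] by simp
  then have cx: "component x j = w j" if "j \<in> {1..CARD('m)}" for j using comp_eqI that by blast
  have "(T ^^ i) (w j) = 0" if "j \<in> {1..CARD('m)}" for j
    using T_power_zero_mono[OF W_kernel[OF that comp_in[OF that]], of i]
    by (simp add: w_def vec.linear_0[OF T_power_linear])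
  then have "(T ^^ i) x = 0" by (simp add: x_def vec.linear_sum[OF T_power_linear])
  moreover have "v - x \<in> range T"
    unfolding range_T_iff
  proof
    fix j assume j: "j \<in> {1..CARD('m)}"
    show "component (v - x) j \<in> T ` W j"
      using assms j vec.subspace_0[OF subspace_TW[OF j]]
      by (cases "j \<le> i") (auto simp: comp_diff cx w_def level_le_iff)
  qed
  ultimately show ?thesis using that cx by (simp add: w_def)
qed

lemma level_leI:
  assumes "(T ^^ i) x = 0" "v - x \<in> range T"
  shows "level v \<le> i"
  unfolding level_le_iff
proof (intro ballI impI)
  fix j assume j: "j \<in> {1..CARD('m)}" "i < j"
  have "component v j = component (v - x) j + component x j" by (simp add: comp_diff[OF j(1)])
  also have "\<dots> \<in> T ` W j"
    using assms j kernel_decomposition(3)[OF assms(1)]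
    by (intro vec.subspace_add[OF subspace_TW]) (auto simp: range_T_iff)
  finally show "component v j \<in> T ` W j" .
qed

text \<open>The value may be computed from any representative in ker T^i, hence without the
  decomposition; this makes it invariant under the centralizer.\<close>

lemma top_form_comp:
  assumes i: "i \<in> {1..CARD('m)}" and x: "(T ^^ i) x = 0" "v - x \<in> range T"
  shows "top_form i (component v i) (component v i) = top_form i x x"
proof -
  have i0: "i > 0" using i by simp
  define t where "t = component (v - x) i"
  have t: "t \<in> T ` W i" using x(2) i by (simp add: t_def range_T_iff)
  have v: "component v i = component x i + t" by (simp add: t_def comp_diff[OF i])
  have tW: "t \<in> W i" using t W_T[OF i] by auto
  show ?thesis
    unfolding top_form_kernel[OF i x(1)] v top_form_add_left[OF i0] top_form_add_right[OF i0]
    using top_form_radical[OF i comp_in[OF i] t] top_form_radical[OF i tW t] by simp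
qed

lemma centralizer_inverse:
  assumes h: "h \<in> centralizer_g"
  obtains h' where "h' \<in> centralizer_g" "\<And>x. h' (h x) = x" "\<And>x. h (h' x) = x"
proof -
  define h' where "h' = inv_into UNIV h"
  have inv: "h' (h x) = x" "h (h' x) = x" for x
    using centralizerD(6)[OF h] by (simp_all add: h'_def bij_is_inj bij_is_surj surj_f_inv_f)
  have "h' \<in> centralizer_g"
  proof (rule centralizerI)
    show "Vector_Spaces.linear (*s) (*s) h'"
      by (rule vec.left_inverse_linear[OF centralizerD(1)[OF h]]) (simp add: fun_eq_iff inv)
    show "B (h' x) (h' y) = B x y" for x y
      using centralizerD(2)[OF h, of "h' x" "h' y"] by (simp add: inv)
    show "h' (T x) = T (h' x)" for x
      using centralizerD(4)[OF h, of "h' x"] inv by metis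
  qed
  then show ?thesis using that inv by blast
qed

lemma same_orbit_sym: assumes "same_orbit x y" shows "same_orbit y x"
proof -
  obtain h where h: "h \<in> centralizer_g" "h x - y \<in> range T" using assms unfolding same_orbit_def by blast
  obtain h' where h': "h' \<in> centralizer_g" "\<And>x. h' (h x) = x" "\<And>x. h (h' x) = x"
    using centralizer_inverse[OF h(1)] by blast
  have "h' y - x = - h' (h x - y)" by (simp add: vec.linear_diff[OF centralizerD(1)[OF h'(1)]] h')
  also have "\<dots> \<in> range T" by (rule vec.subspace_neg[OF subspace_range_T centralizer_range_T[OF h'(1) h(2)]])
  finally show ?thesis unfolding same_orbit_def using h'(1) by blast
qed

lemma same_orbitI: "x - y \<in> range T \<Longrightarrow> same_orbit x y"
  unfolding same_orbit_def
  by (intro bexI[of _ id] centralizerI vec.linear_id) auto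

lemma same_orbit_kernel:
  assumes "same_orbit v v'" "(T ^^ i) x = 0" "v - x \<in> range T"
  obtains x' where "(T ^^ i) x' = 0" "v' - x' \<in> range T" "top_form i x' x' = top_form i x x"
proof -
  obtain h where h: "h \<in> centralizer_g" "h v - v' \<in> range T" using assms(1) unfolding same_orbit_def by blast
  have "(T ^^ i) (h x) = 0"
    using centralizerD(5)[OF h(1), of i x] assms(2) by (simp add: vec.linear_0[OF centralizerD(1)[OF h(1)]])
  moreover have eq: "v' - h x = h (v - x) - (h v - v')"
    by (simp add: vec.linear_diff[OF centralizerD(1)[OF h(1)]])
  have "v' - h x \<in> range T"
    unfolding eq by (rule vec.subspace_diff[OF subspace_range_T centralizer_range_T[OF h(1) assms(3)] h(2)])
  moreover have "top_form i (h x) (h x) = top_form i x x"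
    unfolding top_form_def centralizerD(5)[OF h(1), symmetric] by (rule centralizerD(2)[OF h(1)])
  ultimately show ?thesis using that by blast
qed

lemma level_mono_orbit: "same_orbit v v' \<Longrightarrow> level v' \<le> level v"
proof -
  assume o: "same_orbit v v'"
  obtain x where x: "(T ^^ level v) x = 0" "v - x \<in> range T" using level_le_kernel[of v "level v"] by blast
  obtain x' where "(T ^^ level v) x' = 0" "v' - x' \<in> range T" using same_orbit_kernel[OF o x] by blast
  then show ?thesis by (rule level_leI)
qed

lemma key_orbit: assumes o: "same_orbit v v'" shows "key v = key v'"
proof -
  have l: "level v' = level v" using level_mono_orbit o same_orbit_sym le_antisym by blast
  show ?thesis
  proof (cases "level v = 0")
    case False
    then have i: "level v \<in> {1..CARD('m)}" using level_pos by blast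
    obtain x where x: "(T ^^ level v) x = 0" "v - x \<in> range T" using level_le_kernel[of v "level v"] by blast
    obtain x' where x': "(T ^^ level v) x' = 0" "v' - x' \<in> range T"
        "top_form (level v) x' x' = top_form (level v) x x"
      using same_orbit_kernel[OF o x] by blast
    show ?thesis
      using False top_form_comp[OF i x] top_form_comp[OF i x'(1,2)] x'(3) by (simp add: key_def l level_value_def)
  qed (simp add: key_def l)
qed

text \<open>For x in the radical, T^(i-1) x is orthogonal to W_i, hence zero by nondegeneracy; all
  blocks of W_i having size i, x then lies in T W_i.\<close>

lemma W_radical:
  assumes i: "i \<in> {1..CARD('m)}" and x: "x \<in> W i"
  shows "(\<forall>y\<in>W i. top_form i y x = 0) \<longleftrightarrow> x \<in> T ` W i"
proof
  assume "\<forall>y\<in>W i. top_form i y x = 0"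
  then have "(T ^^ (i - 1)) x \<in> W i \<inter> perp (W i)"
    using W_T_power[OF i x] by (simp add: top_form_def perp_sym)
  then have "(T ^^ (i - 1)) x = 0" using nondegenerate_W[OF i] unfolding nondegenerate_on_iff by blast
  then show "x \<in> T ` W i" by (rule W_top[OF i x])
qed (use top_form_radical[OF i] in blast)

lemma same_orbit_key: assumes k: "key v = key v'" shows "same_orbit v v'"
proof -
  have l: "level v' = level v" using k by (auto simp: key_def split: if_splits)
  show ?thesis
  proof (cases "level v = 0")
    case True
    then have "v \<in> range T" "v' \<in> range T" unfolding level_zero_iff[symmetric] using l by simp_all
    then show ?thesis by (intro same_orbitI vec.subspace_diff[OF subspace_range_T])
  next
    case False
    define i where "i = level v"
    have i: "i \<in> {1..CARD('m)}" "component v i \<notin> T ` W i" "component v' i \<notin> T ` W i"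
      using False level_pos[of v] level_pos[of v'] l by (auto simp: i_def)
    then have i0: "i > 0" by simp
    \<comment> \<open>Some z in W_i pairs nontrivially with the component at i, and orthogonality of
      the summands removes the other components. This provides the nonradical vectors that
      \<open>same_orbit_even\<close> and \<open>same_orbit_odd\<close> require.\<close>
    have rep: "\<exists>x. (T ^^ i) x = 0 \<and> v - x \<in> range T \<and> (\<exists>z\<in>{z. (T ^^ i) z = 0}. top_form i z x \<noteq> 0)"
      if lv: "level v = i" and cv: "component v i \<notin> T ` W i" for v
    proof -
      obtain x where x: "(T ^^ i) x = 0" "v - x \<in> range T" "component x i = component v i"
        using level_le_kernel[of v i] lv i by (metis order_refl)
      obtain z where z: "z \<in> W i" "top_form i z (component x i) \<noteq> 0"
        using W_radical[OF i(1) comp_in[OF i(1)], of v] cv x(3) by auto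
      have "top_form i z x = (\<Sum>j\<in>{1..CARD('m)}. top_form i z (component x j))"
        unfolding top_form_def
        by (subst kernel_decomposition(1)[OF x(1)]) (simp add: vec.linear_sum[OF T_power_linear] B_sum_right)
      also have "\<dots> = (\<Sum>j\<in>{1..CARD('m)}. if j = i then top_form i z (component x i) else 0)"
      proof (intro sum.cong refl)
        fix j assume j: "j \<in> {1..CARD('m)}"
        show "top_form i z (component x j) = (if j = i then top_form i z (component x i) else 0)"
          using orth[OF i(1) j _ z(1) W_T_power[OF j comp_in[OF j]]] by (auto simp: top_form_def)
      qed
      also have "\<dots> \<noteq> 0" using z i by simp
      finally show ?thesis using x W_kernel[OF i(1) z(1)] by blast
    qed
    obtain x where x: "(T ^^ i) x = 0" "v - x \<in> range T" "\<exists>z\<in>{z. (T ^^ i) z = 0}. top_form i z x \<noteq> 0"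
      using rep[of v] i by (auto simp: i_def)
    obtain x' where x': "(T ^^ i) x' = 0" "v' - x' \<in> range T" "\<exists>z\<in>{z. (T ^^ i) z = 0}. top_form i z x' \<noteq> 0"
      using rep[of v'] i l by (auto simp: i_def)
    have "same_orbit x x'"
    proof (cases "even i")
      case True
      have "level_value i (component v i) = level_value i (component v' i)"
        using k False by (simp add: key_def l i_def)
      then have "top_form i x x = top_form i x' x'"
        using True top_form_comp[OF i(1) x(1,2)] top_form_comp[OF i(1) x'(1,2)] by (simp add: level_value_def)
      then show ?thesis using same_orbit_even[OF i0 True _ _ _ x(3) x'(3)] x x' by simp
    next
      case False
      show ?thesis by (rule same_orbit_odd[OF i0 False x(1) x'(1) x(3) x'(3)])
    qed
    moreover have "same_orbit v x" by (rule same_orbitI[OF x(2)])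
    moreover have "same_orbit x' v'" by (rule same_orbit_sym[OF same_orbitI[OF x'(2)]])
    ultimately show ?thesis using same_orbit_trans by blast
  qed
qed

text \<open>Every admissible pair is attained, because a w in W_i outside T W_i has level i and is
  its own component there.\<close>

lemma range_key: "range key = insert (0, 0) (\<Union>i\<in>{1..CARD('m)}. (\<lambda>w. (i, level_value i w)) ` (W i - T ` W i))"
proof (intro subset_antisym subsetI)
  fix p assume "p \<in> range key"
  then obtain v where v: "p = key v" by blast
  show "p \<in> insert (0, 0) (\<Union>i\<in>{1..CARD('m)}. (\<lambda>w. (i, level_value i w)) ` (W i - T ` W i))"
  proof (cases "level v = 0")
    case False
    then have "level v \<in> {1..CARD('m)}" "component v (level v) \<in> W (level v) - T ` W (level v)"
      using level_pos[OF False] comp_in by blast+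
    moreover have "p = (level v, level_value (level v) (component v (level v)))" using False v by (simp add: key_def)
    ultimately show ?thesis by blast
  qed (simp add: v key_def)
next
  fix p assume "p \<in> insert (0, 0) (\<Union>i\<in>{1..CARD('m)}. (\<lambda>w. (i, level_value i w)) ` (W i - T ` W i))"
  then consider "p = (0, 0)" | i w where "i \<in> {1..CARD('m)}" "w \<in> W i" "w \<notin> T ` W i" "p = (i, level_value i w)" by blast
  then show "p \<in> range key"
  proof cases
    case 1
    have "0 \<in> range T" by (rule vec.subspace_0[OF subspace_range_T])
    then have "key 0 = p" using 1 by (simp add: key_def level_zero_iff)
    then show ?thesis by blast
  next
    case 2
    have "{j\<in>{1..CARD('m)}. component w j \<notin> T ` W j} = {i}"
      using 2 vec.subspace_0[OF subspace_TW] comp_W[OF 2(1,2)] by auto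
    then have "level w = i" by (simp add: level_def)
    moreover have "i \<noteq> 0" using 2(1) by simp
    ultimately have "key w = p" using 2 comp_W[OF 2(1,2,1)] by (simp add: key_def)
    then show ?thesis by blast
  qed
qed

end

lemma coset_eq_iff:
  assumes U: "vec.subspace U"
  shows "coset U x = coset U y \<longleftrightarrow> x - y \<in> U"
proof
  assume "coset U x = coset U y"
  moreover have "x \<in> coset U x" unfolding coset_def using vec.subspace_0[OF U] by force
  ultimately obtain u where "u \<in> U" "x = y + u" unfolding coset_def by blast
  then show "x - y \<in> U" by simp
next
  have sub: "coset U x \<subseteq> coset U y" if d: "x - y \<in> U" for x y
  proof
    fix z assume "z \<in> coset U x"
    then obtain u where u: "u \<in> U" "z = x + u" unfolding coset_def by blast
    then have "(x - y) + u \<in> U" using vec.subspace_add[OF U d] by blast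
    moreover have "z = y + ((x - y) + u)" using u by simp
    ultimately show "z \<in> coset U y" unfolding coset_def by blast
  qed
  assume d: "x - y \<in> U"
  have "y - x = - (x - y)" by simp
  then have "y - x \<in> U" using vec.subspace_neg[OF U d] by simp
  then show "coset U x = coset U y" using sub d by blast
qed

lemma coset_eq_self_iff: "vec.subspace U \<Longrightarrow> coset U x = U \<longleftrightarrow> x \<in> U"
  using coset_eq_iff[of U x 0] by (simp add: coset_def)

lemma card_range_cong:
  assumes "\<And>x y. f x = f y \<longleftrightarrow> k x = k y"
  shows "card (range f) = card (range k)"
proof (rule bij_betw_same_card[of "\<lambda>z. k (inv_into UNIV f z)"])
  have eq: "k (inv_into UNIV f (f x)) = k x" for x
    using assms[of "inv_into UNIV f (f x)" x] f_inv_into_f[of "f x" f UNIV] by simp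
  show "bij_betw (\<lambda>z. k (inv_into UNIV f z)) (range f) (range k)"
    unfolding bij_betw_def
  proof
    show "inj_on (\<lambda>z. k (inv_into UNIV f z)) (range f)"
      by (rule inj_onI) (auto simp: eq assms)
    show "(\<lambda>z. k (inv_into UNIV f z)) ` range f = range k"
      unfolding image_image eq ..
  qed
qed

section \<open>Independence of the representative of the class\<close>

lemma group_isometry_group: "group (isometry_group B)"
proof (rule groupI)
  show "\<one>\<^bsub>isometry_group B\<^esub> \<in> carrier (isometry_group B)"
    using vec.linear_id by (simp add: isometry_group_def)
next
  fix x y assume "x \<in> carrier (isometry_group B)" "y \<in> carrier (isometry_group B)"
  then show "x \<otimes>\<^bsub>isometry_group B\<^esub> y \<in> carrier (isometry_group B)"
    by (auto simp: isometry_group_def intro: Vector_Spaces.linear_compose bij_comp)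
next
  fix h assume h: "h \<in> carrier (isometry_group B)"
  then have lin: "Vector_Spaces.linear (*s) (*s) h" and bij: "bij h" and iso: "\<And>x y. B (h x) (h y) = B x y"
    by (auto simp: isometry_group_def)
  define h' where "h' = inv_into UNIV h"
  have inv: "h' (h x) = x" "h (h' x) = x" for x
    using bij by (simp_all add: h'_def bij_is_inj bij_is_surj surj_f_inv_f)
  have "Vector_Spaces.linear (*s) (*s) h'"
    by (rule vec.left_inverse_linear[OF lin]) (simp add: fun_eq_iff inv)
  moreover have "bij h'" using bij by (simp add: h'_def bij_imp_bij_inv)
  moreover have "B (h' x) (h' y) = B x y" for x y
    using iso[of "h' x" "h' y"] by (simp add: inv)
  ultimately have "h' \<in> carrier (isometry_group B)" by (simp add: isometry_group_def)
  moreover have "h' \<circ> h = id" using inv by auto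
  ultimately show "\<exists>y\<in>carrier (isometry_group B). y \<otimes>\<^bsub>isometry_group B\<^esub> h = \<one>\<^bsub>isometry_group B\<^esub>"
    by (auto simp: isometry_group_def)
qed (auto simp: isometry_group_def o_assoc)

text \<open>Conjugation by \<open>h\<close> transports the commutator space, its cosets and the
  centralizer. An orbit is a set of cosets, so orbits correspond under the map that \<open>h\<close>
  induces on sets of sets.\<close>

lemma num_orbits_conjugate:
  assumes h: "h \<in> carrier (isometry_group B)" and g: "g \<in> carrier (isometry_group B)"
  defines "g' \<equiv> h \<otimes>\<^bsub>isometry_group B\<^esub> g \<otimes>\<^bsub>isometry_group B\<^esub> inv\<^bsub>isometry_group B\<^esub> h"
  shows "num_orbits B g' = num_orbits B g"
proof -
  let ?G = "isometry_group B"
  interpret G: group ?G by (rule group_isometry_group)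
  define h' where "h' = inv\<^bsub>?G\<^esub> h"
  have h'_in: "h' \<in> carrier ?G" using h by (simp add: h'_def)
  have mult: "x \<otimes>\<^bsub>?G\<^esub> y = x \<circ> y" for x y by (simp add: isometry_group_def)
  have one: "\<one>\<^bsub>?G\<^esub> = id" by (simp add: isometry_group_def)
  have "h' \<circ> h = id" "h \<circ> h' = id"
    using G.l_inv[OF h] G.r_inv[OF h] by (simp_all add: mult one h'_def)
  then have inv: "h' (h x) = x" "h (h' x) = x" for x by (simp_all add: fun_eq_iff)
  have g': "g' x = h (g (h' x))" for x by (simp add: g'_def mult h'_def)
  have lin: "Vector_Spaces.linear (*s) (*s) h" using h by (simp add: isometry_group_def)
  define Orb where "Orb C X = (\<lambda>k. k ` X) ` C" for C :: "('a, 'b) vector_map set" and X :: "('a^'b) set"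
  have orbits: "orbits (?G\<lparr>carrier := centralizer ?G f\<rparr>) E (\<lambda>h X. h ` X) = Orb (centralizer ?G f) ` E" for f E
    by (auto simp: orbits_def orbit_def Orb_def image_def)
  have comm: "commutator_space g' = h ` commutator_space g"
  proof -
    have "commutator_space g' = range (\<lambda>v. h (h' v - g (h' v)))"
      by (simp add: commutator_space_def g' vec.linear_diff[OF lin] inv)
    also have "\<dots> = h ` (\<lambda>v. v - g v) ` range h'" by (simp add: image_image)
    also have "range h' = UNIV" using inv by (metis surj_def)
    finally show ?thesis by (simp add: commutator_space_def)
  qed
  have coset: "coset (h ` U) (h x) = h ` coset U x" for U x
    by (simp add: coset_def image_image vec.linear_add[OF lin])
  have quot: "quotient_space UNIV (commutator_space g') = image h ` quotient_space UNIV (commutator_space g)"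
  proof -
    have "range h = UNIV" using inv by (metis surj_def)
    then have "quotient_space UNIV (h ` commutator_space g) = coset (h ` commutator_space g) ` range h"
      by (simp add: quotient_space_def)
    then show ?thesis unfolding comm by (simp add: quotient_space_def image_image coset)
  qed
  have orb: "Orb (centralizer ?G g') (h ` X) = image h ` Orb (centralizer ?G g) X" for X
  proof (intro subset_antisym subsetI)
    fix Y assume "Y \<in> Orb (centralizer ?G g') (h ` X)"
    then obtain k where k: "k \<in> carrier ?G" "k \<circ> g' = g' \<circ> k" "Y = k ` h ` X"
      by (auto simp: Orb_def centralizer_def mult)
    have "h' \<circ> k \<circ> h \<in> carrier ?G" using G.m_closed[OF G.m_closed[OF h'_in k(1)] h] by (simp add: mult)
    moreover have "(h' \<circ> k \<circ> h) \<circ> g = g \<circ> (h' \<circ> k \<circ> h)"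
    proof
      fix x
      have "k (g' (h x)) = g' (k (h x))" using k(2) by (simp add: fun_eq_iff)
      then show "((h' \<circ> k \<circ> h) \<circ> g) x = (g \<circ> (h' \<circ> k \<circ> h)) x" by (simp add: g' inv)
    qed
    moreover have "Y = h ` (h' \<circ> k \<circ> h) ` X" by (simp add: k(3) image_image inv)
    ultimately show "Y \<in> image h ` Orb (centralizer ?G g) X"
      unfolding Orb_def centralizer_def mult by blast
  next
    fix Y assume "Y \<in> image h ` Orb (centralizer ?G g) X"
    then obtain k where k: "k \<in> carrier ?G" "k \<circ> g = g \<circ> k" "Y = h ` k ` X"
      by (auto simp: Orb_def centralizer_def mult)
    have "h \<circ> k \<circ> h' \<in> carrier ?G" using G.m_closed[OF G.m_closed[OF h k(1)] h'_in] by (simp add: mult)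
    moreover have "(h \<circ> k \<circ> h') \<circ> g' = g' \<circ> (h \<circ> k \<circ> h')"
    proof
      fix x
      have "k (g (h' x)) = g (k (h' x))" using k(2) by (simp add: fun_eq_iff)
      then show "((h \<circ> k \<circ> h') \<circ> g') x = (g' \<circ> (h \<circ> k \<circ> h')) x" by (simp add: g' inv)
    qed
    moreover have "Y = (h \<circ> k \<circ> h') ` h ` X" by (simp add: k(3) image_image inv)
    ultimately show "Y \<in> Orb (centralizer ?G g') (h ` X)"
      unfolding Orb_def centralizer_def mult by blast
  qed
  have "inj h" by (rule injI) (metis inv(1))
  then have "inj (image h)" by (intro injI) (simp add: inj_image_eq_iff)
  then have inj: "inj (image (image h))" by (intro injI) (simp add: inj_image_eq_iff)
  have "orbits (?G\<lparr>carrier := centralizer ?G g'\<rparr>) (quotient_space UNIV (commutator_space g')) (\<lambda>h X. h ` X) =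
      image (image h) ` orbits (?G\<lparr>carrier := centralizer ?G g\<rparr>) (quotient_space UNIV (commutator_space g)) (\<lambda>h X. h ` X)"
    unfolding orbits quot by (simp add: image_image orb)
  then show ?thesis
    unfolding num_orbits_def using inj by (simp add: card_image inj_on_subset)
qed

text \<open>The orbit number is constant on the class and the class contains \<open>g\<close>, so
  the definite description is determined.\<close>

lemma class_orbits_conjugacy_class:
  assumes g: "g \<in> carrier (isometry_group B)"
  shows "class_orbits B (conjugacy_class (isometry_group B) g) = num_orbits B g"
proof -
  interpret G: group "isometry_group B" by (rule group_isometry_group)
  have self: "g \<in> conjugacy_class (isometry_group B) g"
    unfolding conjugacy_class_def using g by (intro CollectI exI[of _ "\<one>\<^bsub>isometry_group B\<^esub>"]) simp
  have "\<forall>x\<in>conjugacy_class (isometry_group B) g. num_orbits B x = num_orbits B g"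
    unfolding conjugacy_class_def using num_orbits_conjugate[OF _ g] by blast
  then show ?thesis
    unfolding class_orbits_def
  proof (rule the_equality)
    fix k assume k: "\<forall>x\<in>conjugacy_class (isometry_group B) g. num_orbits B x = k"
    show "k = num_orbits B g" using bspec[OF k self] by (rule sym)
  qed
qed

section \<open>Counting the orbits\<close>

context symplectic_decomposition
begin

lemma commutator_space_eq: "commutator_space g = range T"
proof -
  have "v - g v = T (- v)" for v by (simp add: minus_id_def vec.linear_neg[OF g_linear])
  then have "commutator_space g = range (\<lambda>v. T (- v))" by (simp add: commutator_space_def)
  also have "\<dots> = T ` range uminus" by (simp only: image_image)
  also have "range uminus = (UNIV :: ('a^'m) set)" by (rule surjI[of _ uminus]) simp
  finally show ?thesis .
qed

text \<open>\<open>Orb\<close> and \<open>key\<close> have the same fibres, so their ranges have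
  equally many elements.\<close>

lemma num_orbits_card_key: "num_orbits B g = card (range key)"
proof -
  let ?R = "range T"
  define Orb where "Orb v = (\<lambda>h. coset ?R (h v)) ` centralizer_g" for v
  have img: "h ` coset ?R v = coset ?R (h v)" if h: "h \<in> centralizer_g" for h v
  proof -
    have "h ` ?R = T ` range h" by (simp add: image_image centralizerD(4)[OF h])
    also have "range h = UNIV" using centralizerD(6)[OF h] by (simp add: bij_is_surj)
    finally have hR: "h ` ?R = ?R" .
    have "h ` coset ?R v = (\<lambda>u. h v + u) ` h ` ?R"
      by (simp add: coset_def image_image vec.linear_add[OF centralizerD(1)[OF h]])
    then show ?thesis unfolding hR by (simp add: coset_def)
  qed
  have "orbits (isometry_group B\<lparr>carrier := centralizer_g\<rparr>) (quotient_space UNIV ?R) (\<lambda>h X. h ` X) = range Orb"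
  proof -
    have "orbit (isometry_group B\<lparr>carrier := centralizer_g\<rparr>) (\<lambda>h X. h ` X) (coset ?R v) = Orb v" for v
    proof -
      have "orbit (isometry_group B\<lparr>carrier := centralizer_g\<rparr>) (\<lambda>h X. h ` X) (coset ?R v) =
          (\<lambda>h. h ` coset ?R v) ` centralizer_g"
        by (simp add: orbit_def Setcompr_eq_image)
      also have "\<dots> = Orb v" unfolding Orb_def by (intro image_cong refl img)
      finally show ?thesis .
    qed
    then show ?thesis unfolding orbits_def quotient_space_def by auto
  qed
  then have "num_orbits B g = card (range Orb)"
    by (simp add: num_orbits_def commutator_space_eq)
  moreover have "Orb v = Orb v' \<longleftrightarrow> key v = key v'" for v v'
  proof
    assume eq: "Orb v = Orb v'"
    have "id \<in> centralizer_g" by (intro centralizerI vec.linear_id) auto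
    then have "coset ?R v' \<in> Orb v'" unfolding Orb_def by (intro image_eqI[of _ _ id]) simp_all
    then have "coset ?R v' \<in> Orb v" unfolding eq .
    then obtain h where h: "h \<in> centralizer_g" "coset ?R v' = coset ?R (h v)"
      unfolding Orb_def by blast
    then have "h v - v' \<in> ?R" by (intro coset_eq_iff[OF subspace_range_T, THEN iffD1]) (rule sym)
    then have "same_orbit v v'" using h(1) unfolding same_orbit_def by blast
    then show "key v = key v'" by (rule key_orbit)
  next
    have sub: "Orb v' \<subseteq> Orb v" if o: "same_orbit v v'" for v v'
    proof
      fix X assume "X \<in> Orb v'"
      then obtain k where k: "k \<in> centralizer_g" "X = coset ?R (k v')" unfolding Orb_def by blast
      obtain h where h: "h \<in> centralizer_g" "h v - v' \<in> ?R" using o unfolding same_orbit_def by blast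
      have "(k \<circ> h) v - k v' \<in> ?R"
        using centralizer_range_T[OF k(1) h(2)] by (simp add: vec.linear_diff[OF centralizerD(1)[OF k(1)]])
      then have "X = coset ?R ((k \<circ> h) v)"
        unfolding k(2) using coset_eq_iff[OF subspace_range_T] by blast
      then show "X \<in> Orb v" unfolding Orb_def using centralizer_comp[OF k(1) h(1)] by blast
    qed
    assume "key v = key v'"
    then have "same_orbit v v'" by (rule same_orbit_key)
    then show "Orb v = Orb v'" using sub same_orbit_sym by blast
  qed
  ultimately show ?thesis using card_range_cong[of Orb key] by simp
qed

lemma top_form_symmetric_W:
  "even i \<Longrightarrow> i \<in> {1..CARD('m)} \<Longrightarrow> x \<in> W i \<Longrightarrow> y \<in> W i \<Longrightarrow> top_form i x y = top_form i y x"
  using top_form_swap[of i y x] W_kernel by simp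

text \<open>T W_i lies in both the left and the right radical of b_i on W_i, so the value is
  constant on pairs of cosets and the definite description picks it.\<close>

lemma induced_form_eq:
  assumes i: "i \<in> {1..CARD('m)}" and x: "x \<in> W i" and y: "y \<in> W i"
  shows "induced_form B g i (coset (T ` W i) x) (coset (T ` W i) y) = top_form i x y"
proof -
  let ?U = "T ` W i"
  have i0: "i > 0" using i by simp
  have UW: "?U \<subseteq> W i" using W_T[OF i] by blast
  have const: "B x' ((T ^^ (i - 1)) y') = top_form i x y" if x': "x' \<in> coset ?U x" and y': "y' \<in> coset ?U y" for x' y'
  proof -
    obtain u where u: "u \<in> ?U" "x' = x + u" using x' unfolding coset_def by blast
    obtain u' where u': "u' \<in> ?U" "y' = y + u'" using y' unfolding coset_def by blast
    have "u' \<in> W i" using u' UW by blast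
    then show ?thesis
      using top_form_radical[OF i y u(1)] top_form_radical[OF i x u'(1)] top_form_radical[OF i _ u(1)]
      unfolding top_form_def[symmetric] u(2) u'(2) top_form_add_left[OF i0] top_form_add_right[OF i0] by simp
  qed
  have mem: "z \<in> coset ?U z" for z
    unfolding coset_def using vec.subspace_0[OF subspace_TW[OF i]] by force
  show ?thesis
    unfolding induced_form_def
  proof (rule the_equality)
    show "c = top_form i x y" if "\<forall>x'\<in>coset ?U x. \<forall>y'\<in>coset ?U y. B x' ((T ^^ (i - 1)) y') = c" for c
      using that mem[of x] mem[of y] const by metis
  qed (use const in blast)
qed

lemma induces_form:
  assumes i: "i \<in> {1..CARD('m)}" and ev: "even i"
  shows "induces_nondegenerate_symmetric_form B g i (W i)"
  unfolding induces_nondegenerate_symmetric_form_def Let_def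
proof (intro conjI ballI impI)
  fix x y assume "x \<in> W i" "y \<in> W i"
  then show "induced_form B g i (coset (T ` W i) x) (coset (T ` W i) y) = B x ((T ^^ (i - 1)) y)"
    using induced_form_eq[OF i] by (simp add: top_form_def)
next
  fix X Y assume "X \<in> quotient_space (W i) (T ` W i)" "Y \<in> quotient_space (W i) (T ` W i)"
  then show "induced_form B g i X Y = induced_form B g i Y X"
    unfolding quotient_space_def using induced_form_eq[OF i] top_form_symmetric_W[OF ev i] by auto
next
  fix X assume X: "X \<in> quotient_space (W i) (T ` W i)"
    and 0: "\<forall>Y\<in>quotient_space (W i) (T ` W i). induced_form B g i X Y = 0"
  obtain x where x: "x \<in> W i" "X = coset (T ` W i) x" using X unfolding quotient_space_def by blast
  have "top_form i y x = 0" if y: "y \<in> W i" for y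
  proof -
    have "induced_form B g i X (coset (T ` W i) y) = 0" using 0 y unfolding quotient_space_def by blast
    then show ?thesis using induced_form_eq[OF i x(1) y] x(2) top_form_symmetric_W[OF ev i x(1) y] by simp
  qed
  then have "x \<in> T ` W i" using W_radical[OF i x(1)] by blast
  then show "X = T ` W i" unfolding x(2) by (simp add: coset_eq_self_iff[OF subspace_TW[OF i]])
qed

lemma plus_sign_iff:
  assumes i: "i \<in> {1..CARD('m)}"
  shows "plus_sign B g i (W i) \<longleftrightarrow> (\<exists>w\<in>W i - T ` W i. top_form i w w = 0)"
proof -
  have "plus_sign B g i (W i) \<longleftrightarrow> (\<exists>w\<in>W i. coset (T ` W i) w \<noteq> T ` W i \<and>
      induced_form B g i (coset (T ` W i) w) (coset (T ` W i) w) = 0)"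
    unfolding plus_sign_def quotient_space_def by blast
  also have "\<dots> \<longleftrightarrow> (\<exists>w\<in>W i - T ` W i. top_form i w w = 0)"
    using induced_form_eq[OF i] coset_eq_self_iff[OF subspace_TW[OF i]] by auto
  finally show ?thesis .
qed

text \<open>The block number is dim W_i - dim T W_i, so W_i equals T W_i exactly when it is 0. For
  odd i the level value is constant; for even i the values of the quadratic form on the nonzero
  vectors of W_i / T W_i are counted.\<close>

lemma card_level_values:
  assumes i: "i \<in> {1..CARD('m)}"
  shows "card ((\<lambda>w. (i, level_value i w)) ` (W i - T ` W i)) =
    (if blocks i = 0 then 0 else if odd i then 1
     else even_contribution CARD('a) (blocks i) (plus_sign B g i (W i)))"
proof -
  have i0: "i > 0" using i by simp
  have UW: "T ` W i \<subseteq> W i" using W_T[OF i] by blast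
  have empty: "W i - T ` W i = {} \<longleftrightarrow> blocks i = 0"
  proof
    assume "W i - T ` W i = {}"
    then have "W i = T ` W i" using UW by blast
    then have "vec.dim (W i) = vec.dim (T ` W i)" by simp
    then show "blocks i = 0" using W_dim[OF i] by simp
  next
    assume "blocks i = 0"
    then have "vec.dim (W i) \<le> vec.dim (T ` W i)" using W_dim[OF i] by simp
    then have "T ` W i = W i" by (intro vec.subspace_dim_equal subspace_TW[OF i] W_subspace[OF i] UW)
    then show "W i - T ` W i = {}" by blast
  qed
  have pair: "card ((\<lambda>w. (i, level_value i w)) ` A) = card (level_value i ` A)" for A
  proof -
    have "(\<lambda>w. (i, level_value i w)) ` A = Pair i ` level_value i ` A" by (simp add: image_image)
    then show ?thesis by (simp add: card_image inj_on_def)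
  qed
  show ?thesis
  proof (cases "blocks i = 0")
    case True
    then have e: "W i - T ` W i = {}" using empty by (rule iffD2[rotated])
    show ?thesis unfolding e using True by simp
  next
    case nz: False
    then have ne: "W i - T ` W i \<noteq> {}" unfolding empty .
    show ?thesis
    proof (cases "even i")
      case False
      then have "level_value i ` (W i - T ` W i) = {0}" using ne by (auto simp: level_value_def)
      then show ?thesis using False nz pair by simp
    next
      case True
      interpret Q: finite_quadratic_form "top_form i" "W i" "T ` W i"
      proof
        show "(\<forall>y\<in>W i. top_form i x y = 0) \<longleftrightarrow> x \<in> T ` W i" if "x \<in> W i" for x
          using W_radical[OF i that] top_form_symmetric_W[OF True i that] by auto
      qed (use two_nonzero W_subspace[OF i] subspace_TW[OF i] UW top_form_symmetric_W[OF True i]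
          in \<open>simp_all add: top_form_simps[OF i0]\<close>)
      have "level_value i ` (W i - T ` W i) = {top_form i w w | w. w \<in> W i - T ` W i}"
        using True by (auto simp: level_value_def)
      then show ?thesis
        using Q.card_values[OF W_dim[OF i]] nz True pair plus_sign_iff[OF i] by simp
    qed
  qed
qed

text \<open>Keys for different block sizes differ in their first entry, so the counts add up; the
  summand 1 is the pair (0, 0) of the zero coset.\<close>

theorem num_orbits_formula:
  assumes outside: "\<And>i. i \<notin> {1..CARD('m)} \<Longrightarrow> blocks i = 0"
  shows "num_orbits B g = 1 + card {i. odd i \<and> blocks i \<noteq> 0} +
    (\<Sum>i | even i \<and> blocks i \<noteq> 0. even_contribution CARD('a) (blocks i) (plus_sign B g i (W i)))"
proof -
  let ?S = "{1..CARD('m)}"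
  let ?A = "\<lambda>i. (\<lambda>w. (i, level_value i w)) ` (W i - T ` W i)"
  let ?f = "\<lambda>i. even_contribution CARD('a) (blocks i) (plus_sign B g i (W i))"
  have inS: "i \<in> ?S" if "blocks i \<noteq> 0" for i
    using that outside[of i] by (rule contrapos_np)
  have restrict: "(\<Sum>i\<in>?S. if P i \<and> blocks i \<noteq> 0 then f i else 0) = (\<Sum>i | P i \<and> blocks i \<noteq> 0. f i)"
    for P and f :: "nat \<Rightarrow> nat"
  proof -
    have "?S \<inter> {i. P i \<and> blocks i \<noteq> 0} = {i. P i \<and> blocks i \<noteq> 0}"
      by (rule inf_absorb2) (use inS in blast)
    moreover have "(\<Sum>i\<in>?S. if Q i then f i else 0) = sum f (?S \<inter> {i. Q i})" for Q
      by (simp add: sum.If_cases)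
    ultimately show ?thesis by simp
  qed
  have "num_orbits B g = Suc (card (\<Union>i\<in>?S. ?A i))"
    unfolding num_orbits_card_key range_key by (subst card_insert_disjoint) auto
  also have "card (\<Union>i\<in>?S. ?A i) = (\<Sum>i\<in>?S. card (?A i))"
    by (rule card_UN_disjoint) auto
  also have "\<dots> = (\<Sum>i\<in>?S. (if odd i \<and> blocks i \<noteq> 0 then 1 else 0) + (if even i \<and> blocks i \<noteq> 0 then ?f i else 0))"
    by (intro sum.cong refl) (simp add: card_level_values)
  also have "\<dots> = (\<Sum>i\<in>?S. if odd i \<and> blocks i \<noteq> 0 then 1 else 0) + (\<Sum>i\<in>?S. if even i \<and> blocks i \<noteq> 0 then ?f i else 0)"
    by (rule sum.distrib)
  also have "(\<Sum>i\<in>?S. if odd i \<and> blocks i \<noteq> 0 then 1 else 0) = card {i. odd i \<and> blocks i \<noteq> 0}"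
    unfolding restrict by (simp only: card_eq_sum)
  also have "(\<Sum>i\<in>?S. if even i \<and> blocks i \<noteq> 0 then ?f i else 0) = (\<Sum>i | even i \<and> blocks i \<noteq> 0. ?f i)"
    by (rule restrict)
  finally show ?thesis by simp
qed

end

section \<open>Odd order and the orbit formula\<close>

lemma of_nat_card_eq_0: "(of_nat CARD('a) :: 'a::{field,finite}) = 0"
proof -
  \<comment> \<open>Translation by 1 permutes the field, so the sum of all elements equals itself
    plus q.\<close>
  have "(\<Sum>x\<in>UNIV. x) = (\<Sum>x\<in>UNIV. x + (1::'a))"
    by (rule sum.reindex_bij_witness[of _ "\<lambda>x. x + 1" "\<lambda>x. x - 1"]) auto
  then show ?thesis by (simp add: sum.distrib)
qed

theorem theorem5p1:
  fixes B :: "('a::{field,finite}, 'm::finite) form"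
    and g :: "('a, 'm) vector_map"
    and C :: "('a, 'm) vector_map set"
    and V1 :: "('a^'m) set"
    and a :: "nat \<Rightarrow> nat"
    and n q :: nat
  assumes "q = CARD('a)" and "odd q"
    and "n \<ge> 1" and "CARD('m) = 2 * n"
    and "symplectic_form B"
    and "g \<in> carrier (isometry_group B)"
    and "C = conjugacy_class (isometry_group B) g"
    and "V1 = gen_one_space g"
    and "a = num_jordan_blocks g V1"
  shows "nondegenerate_on B V1 \<and>
    (\<exists>W. orthogonal_block_decomposition B g W) \<and>
    (\<forall>W. orthogonal_block_decomposition B g W \<longrightarrow>
       (\<forall>i. even i \<and> a i \<noteq> 0 \<longrightarrow>
          induces_nondegenerate_symmetric_form B g i (W i) \<and>
          vec.dim (W i) = vec.dim (minus_id g ` W i) + a i) \<and>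
       class_orbits B C =
         1 + card {i. odd i \<and> a i \<noteq> 0} +
         (\<Sum>i | even i \<and> a i \<noteq> 0. even_contribution q (a i) (plus_sign B g i (W i))))"
proof -
  have two: "(2 :: 'a) \<noteq> 0"
  proof
    assume 0: "(2 :: 'a) = 0"
    \<comment> \<open>If 2 = 0, then q = 2 k + 1 becomes 1 in the field, but it also becomes
      0.\<close>
    obtain k where "CARD('a) = 2 * k + 1" using assms(1,2) by (metis oddE)
    then have "(of_nat CARD('a) :: 'a) = 2 * of_nat k + 1" by simp
    then show False using 0 of_nat_card_eq_0[where 'a = 'a] by simp
  qed
  interpret S: symplectic_isometry B g
    using assms(5,6) two by unfold_locales
  have V1: "V1 = gen_one_space g" and a: "a = num_jordan_blocks g (gen_one_space g)" using assms(8,9) by simp_all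
  \<comment> \<open>Existence enters the count as well: it makes the block numbers vanish outside
    the sizes from 1 to dim V, so that the sums over all i are finite.\<close>
  obtain W0 where W0: "orthogonal_block_decomposition B g W0"
    "\<And>i. i \<notin> {1..CARD('m)} \<Longrightarrow> num_jordan_blocks g (gen_one_space g) i = 0"
    using S.orthogonal_block_decomposition_exists by blast
  have main: "(\<forall>i. even i \<and> a i \<noteq> 0 \<longrightarrow>
          induces_nondegenerate_symmetric_form B g i (W i) \<and>
          vec.dim (W i) = vec.dim (minus_id g ` W i) + a i) \<and>
       class_orbits B C =
         1 + card {i. odd i \<and> a i \<noteq> 0} +
         (\<Sum>i | even i \<and> a i \<noteq> 0. even_contribution q (a i) (plus_sign B g i (W i)))"
    if W: "orthogonal_block_decomposition B g W" for W
  proof -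
    interpret D: symplectic_decomposition B g W
      using W by unfold_locales
    show ?thesis
    proof (intro conjI allI impI)
      fix i assume i: "even i \<and> a i \<noteq> 0"
      then have iS: "i \<in> {1..CARD('m)}" using W0(2)[of i] unfolding a by meson
      show "induces_nondegenerate_symmetric_form B g i (W i)" using D.induces_form[OF iS] i by blast
      show "vec.dim (W i) = vec.dim (minus_id g ` W i) + a i" using D.W_dim[OF iS] a by simp
    next
      show "class_orbits B C = 1 + card {i. odd i \<and> a i \<noteq> 0} +
         (\<Sum>i | even i \<and> a i \<noteq> 0. even_contribution q (a i) (plus_sign B g i (W i)))"
        unfolding assms(1,7) a class_orbits_conjugacy_class[OF assms(6)]
        by (rule D.num_orbits_formula[OF W0(2)])
    qed
  qed
  show ?thesis
    unfolding V1 using S.nondegenerate_V1 W0(1) main by blast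
qed

end
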